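(* Let $\mathcal{A}$ and $\mathcal{B}$ be finite von Neumann algebras with traces $d$ and $\tau$ respectively, let $k>0$, and let $(\mathcal{A},\mathcal{B},d,\tau,\mathcal{F})$ be a von Neumann $k$-bi-algebra with $\mathcal{F}^*\mathcal{F}=kI$. Then for every $x\in\mathcal{A}$, every $2\le p\le\infty$ and $q$ with $1/p+1/q=1$, \[\|\mathcal{F}(x)\|_p\le k^{1/p}\|x\|_q.\]
   Context: A finite von Neumann algebra $\mathcal{M}$ is taken with a trace $\tau_{\mathcal{M}}$ (faithful normal tracial positive linear functional). $\|x\|_p=\tau_{\mathcal{M}}(|x|^p)^{1/p}$ for $p<\infty$, $\|x\|_\infty$ is the operator norm. For a linear map $\mathcal{F}:\mathcal{A}\to\mathcal{B}$, $\|\mathcal{F}\|_{q\to p}=\sup\{\|\mathcal{F}(x)\|_p:\|x\|_q=1\}$ and $\mathcal{F}^*:\mathcal{B}\to\mathcal{A}$ is the adjoint, $\tau(\mathcal{F}(x)y^* )=d(x\,\mathcal{F}^*(y)^* )$. For $k>0$, a $k$-transform is a linear $\mathcal{F}:\mathcal{A}\to\mathcal{B}$ with $\|\mathcal{F}\|_{1\to\infty}\le1$ and $\|\mathcal{F}^*\mathcal{F}(x)\|_\infty\ge k\|x\|_\infty$ for all $x$; $(\mathcal{A},\mathcal{B},d,\tau,\mathcal{F})$ is then a von Neumann $k$-bi-algebra. *)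

theory Defs
  imports "HOL-Analysis.Analysis" "HOL-Library.Extended_Real"
begin

text \<open>Concrete model: every Hilbert space is (isometric to) a space l2(I).
  Vectors are functions 'i => complex; bounded operators are represented canonically
  as functions on all such vectors that vanish outside l2.\<close>

type_synonym 'i vec = "'i \<Rightarrow> complex"
type_synonym 'i op = "'i vec \<Rightarrow> 'i vec"

definition ell2 :: "'i vec set" where
  "ell2 = {f. (\<lambda>i. (cmod (f i))^2) summable_on UNIV}"

definition vinner :: "'i vec \<Rightarrow> 'i vec \<Rightarrow> complex" where
  "vinner f g = (\<Sum>\<^sub>\<infinity>i. cnj (f i) * g i)"

definition vnorm :: "'i vec \<Rightarrow> real" where
  "vnorm f = sqrt (\<Sum>\<^sub>\<infinity>i. (cmod (f i))^2)"

definition bop :: "'i op set" where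
  "bop = {T. (\<forall>f\<in>ell2. T f \<in> ell2)
           \<and> (\<forall>f\<in>ell2. \<forall>g\<in>ell2. \<forall>a b. T (\<lambda>i. a * f i + b * g i) = (\<lambda>i. a * T f i + b * T g i))
           \<and> (\<exists>C. \<forall>f\<in>ell2. vnorm (T f) \<le> C * vnorm f)
           \<and> (\<forall>f. f \<notin> ell2 \<longrightarrow> T f = (\<lambda>i. 0))}"

definition opnorm :: "'i op \<Rightarrow> real" where
  "opnorm T = Sup ((\<lambda>f. vnorm (T f)) ` {f \<in> ell2. vnorm f \<le> 1})"

definition op_zero :: "'i op" where "op_zero = (\<lambda>f i. 0)"
definition op_one :: "'i op" where "op_one = (\<lambda>f. if f \<in> ell2 then f else (\<lambda>i. 0))"
definition op_add :: "'i op \<Rightarrow> 'i op \<Rightarrow> 'i op" where "op_add T S = (\<lambda>f i. T f i + S f i)"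
definition op_scale :: "complex \<Rightarrow> 'i op \<Rightarrow> 'i op" where "op_scale c T = (\<lambda>f i. c * T f i)"

definition op_adj :: "'i op \<Rightarrow> 'i op" where
  "op_adj T = (THE S. S \<in> bop \<and> (\<forall>f\<in>ell2. \<forall>g\<in>ell2. vinner (T f) g = vinner f (S g)))"

definition commutant :: "'i op set \<Rightarrow> 'i op set" where
  "commutant S = {T \<in> bop. \<forall>A\<in>S. T \<circ> A = A \<circ> T}"

definition von_neumann_algebra :: "'i op set \<Rightarrow> bool" where
  "von_neumann_algebra M \<longleftrightarrow> M \<subseteq> bop \<and> (\<forall>x\<in>M. op_adj x \<in> M) \<and> commutant (commutant M) = M"

definition op_pos :: "'i op \<Rightarrow> bool" where
  "op_pos T \<longleftrightarrow> T \<in> bop \<and> (\<forall>f\<in>ell2. Im (vinner f (T f)) = 0 \<and> Re (vinner f (T f)) \<ge> 0)"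

definition op_le :: "'i op \<Rightarrow> 'i op \<Rightarrow> bool" where
  "op_le a b \<longleftrightarrow> op_pos (op_add b (op_scale (-1) a))"

definition op_selfadj :: "'i op \<Rightarrow> bool" where
  "op_selfadj a \<longleftrightarrow> a \<in> bop \<and> op_adj a = a"

definition trace_on :: "'i op set \<Rightarrow> ('i op \<Rightarrow> complex) \<Rightarrow> bool" where
  "trace_on M t \<longleftrightarrow>
     (\<forall>x\<in>M. \<forall>y\<in>M. t (op_add x y) = t x + t y)
   \<and> (\<forall>x\<in>M. \<forall>c. t (op_scale c x) = c * t x)
   \<and> (\<forall>x\<in>M. op_pos x \<longrightarrow> Im (t x) = 0 \<and> Re (t x) \<ge> 0)
   \<and> (\<forall>x\<in>M. \<forall>y\<in>M. t (x \<circ> y) = t (y \<circ> x))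
   \<and> (\<forall>x\<in>M. op_pos x \<longrightarrow> t x = 0 \<longrightarrow> x = op_zero)
   \<and> (\<forall>D s. D \<subseteq> M \<and> D \<noteq> {} \<and> (\<forall>a\<in>D. op_pos a)
          \<and> (\<forall>a\<in>D. \<forall>b\<in>D. \<exists>c\<in>D. op_le a c \<and> op_le b c)
          \<and> s \<in> M \<and> op_selfadj s \<and> (\<forall>a\<in>D. op_le a s)
          \<and> (\<forall>u. op_selfadj u \<and> (\<forall>a\<in>D. op_le a u) \<longrightarrow> op_le s u)
        \<longrightarrow> Re (t s) = (SUP a\<in>D. Re (t a)))"

primrec op_power :: "'i op \<Rightarrow> nat \<Rightarrow> 'i op" where
  "op_power T 0 = op_one"
| "op_power T (Suc n) = T \<circ> op_power T n"

primrec op_psum :: "(nat \<Rightarrow> 'i op) \<Rightarrow> nat \<Rightarrow> 'i op" where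
  "op_psum S 0 = op_zero"
| "op_psum S (Suc n) = op_add (op_psum S n) (S n)"

definition op_lim :: "(nat \<Rightarrow> 'i op) \<Rightarrow> 'i op" where
  "op_lim S = (THE L. L \<in> bop \<and> (\<lambda>N. opnorm (op_add (S N) (op_scale (-1) L))) \<longlonglongrightarrow> 0)"

text \<open>Functional calculus a^s (s > 0) for a positive operator a, via the norm-convergent
  binomial series: a^s = c^s * sum_n (s choose n) (-(1 - a/c))^n with c = norm a.\<close>
definition op_rpow :: "'i op \<Rightarrow> real \<Rightarrow> 'i op" where
  "op_rpow a s = (if a = op_zero then op_zero else
     (let c = opnorm a in
      op_scale (complex_of_real (c powr s))
        (op_lim (op_psum (\<lambda>n. op_scale (complex_of_real ((s gchoose n) * (-1)^n))
                   (op_power (op_add op_one (op_scale (- complex_of_real (inverse c)) a)) n))))))"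

definition op_abs_pow :: "'i op \<Rightarrow> real \<Rightarrow> 'i op" where
  "op_abs_pow x p = op_rpow (op_adj x \<circ> x) (p / 2)"

definition lpnorm :: "('i op \<Rightarrow> complex) \<Rightarrow> ereal \<Rightarrow> 'i op \<Rightarrow> real" where
  "lpnorm t p x = (case p of ereal r \<Rightarrow> Re (t (op_abs_pow x r)) powr (1 / r)
                            | PInfty \<Rightarrow> opnorm x | MInfty \<Rightarrow> 0)"

end

theory Submission
  imports Defs "HOL-Complex_Analysis.Complex_Analysis" "HOL-Real_Asymp.Real_Asymp"
begin

text \<open>
  This is Riesz--Thorin interpolation between the bounds \<open>1 \<rightarrow> \<infinity>\<close> (constant \<open>1\<close>) and \<open>2 \<rightarrow> 2\<close>
  (constant \<open>sqrt k\<close>, since \<open>Fs \<circ> F = k\<close>). Let \<open>X = F x\<close>. To have complex powers at hand without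
  a spectral theorem, replace \<open>x\<^sup>* x\<close> and \<open>X\<^sup>* X\<close> by \<open>a = x\<^sup>* x + \<epsilon>\<close> and \<open>b = X\<^sup>* X + \<delta>\<close>, which are
  multiples of operators \<open>1 - T\<close> with \<open>norm T < 1\<close>, so that \<open>a\<^sup>z\<close> and \<open>b\<^sup>z\<close> are given by the binomial
  series for all complex \<open>z\<close>. The entire function
  \<open>G z = \<tau> (F (x a\<^bsup>f z\<^esup>) b\<^bsup>g z\<^esup> X\<^sup>*)\<close> with \<open>f z = (q - 1)/2 - q z/4\<close> and \<open>g z = (p - 1)/2 - p z/4\<close>
  is bounded by \<open>d (a\<^bsup>q/2\<^esup>) \<tau> (b\<^bsup>p/2\<^esup>)\<close> on \<open>Re z = 0\<close> and by the square root of \<open>k\<close> times this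
  quantity on \<open>Re z = 1\<close>; at \<open>z = 2/p\<close> it equals \<open>\<tau> (b\<^bsup>p/2 - 1\<^esup> X\<^sup>* X)\<close>. The three lines theorem and
  the limit \<open>\<epsilon>, \<delta> \<rightarrow> 0\<close> give the claim. All trace estimates come down to the
  Cauchy--Schwarz inequality, applied to suitable factorizations.
\<close>

section \<open>The Banach algebra of bounded operators\<close>

text \<open>The exponents follow from one rule. Up to the regularization, \<open>x * a^w\<close> has
  modulus \<open>a^(1/2 + Re w)\<close>, so its trace norm is controlled by
  \<open>d (a^(1/2 + Re w))\<close> and its squared 2-norm by \<open>d (a^(1 + 2 Re w))\<close>.
  Asking that the first exponent be \<open>q/2\<close> on \<open>Re z = 0\<close> and the second be
  \<open>q/2\<close> on \<open>Re z = 1\<close> determines the affine function \<open>f\<close>;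
  \<open>g\<close> arises in the same way from \<open>p\<close>. Because \<open>x\<close> itself
  stays in front of the power, no polar decomposition enters.

  At \<open>z = 2/p\<close> the function \<open>f\<close> vanishes, and the second argument of the
  pairing becomes \<open>b^(p/2 - 1) X*\<close>, the extremal dual element of \<open>X\<close>.
  Duality of the p- and q-norms is thus built into \<open>G\<close>: with \<open>P\<close> the trace
  of \<open>|X|^p\<close> and \<open>Q\<close> that of \<open>|x|^q\<close>, the limit reads
  \<open>P <= k^(1/p) (Q P)^(1 - 1/p)\<close>, and a power of \<open>P\<close> cancels.

  The regularization is needed because without it \<open>norm T\<close> may equal 1, where the
  binomial series is controlled only for real exponents \<open>s > 0\<close>. These suffice in the
  limit, as only \<open>q/2\<close>, \<open>p/2\<close> and \<open>p/2 - 1\<close> survive; the last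
  is zero for \<open>p = 2\<close> and is treated apart.\<close>

lemma ell2_boundI:
  assumes "\<And>S. finite S \<Longrightarrow> L2_set (\<lambda>i. cmod (f i)) S \<le> C"
  shows ell2_boundI_mem: "f \<in> ell2" and ell2_boundI_norm: "vnorm f \<le> C"
proof -
  have C: "C \<ge> 0" using assms[of "{}"] by simp
  \<comment> \<open>A sum of nonnegative terms converges once its finite partial sums are bounded.
    Norm estimates in \<open>ell2\<close> are thereby reduced to \<open>L2_set\<close> over finite
    index sets, here and for Minkowski, operator limits and adjoints.\<close>
  have le: "(\<Sum>i\<in>S. (cmod (f i))\<^sup>2) \<le> C\<^sup>2" if "finite S" for S
    using assms[OF that] C unfolding L2_set_def by (simp add: real_sqrt_le_iff sqrt_le_D)
  show mem: "f \<in> ell2" unfolding ell2_def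
    by (auto intro!: nonneg_bounded_partial_sums_imp_summable_on[where C="C\<^sup>2"] le eventually_finite_subsets_at_top_weakI)
  have "(\<Sum>\<^sub>\<infinity>i. (cmod (f i))\<^sup>2) \<le> C\<^sup>2"
    using mem unfolding ell2_def by (intro infsum_le_finite_sums) (auto intro: le)
  thus "vnorm f \<le> C" unfolding vnorm_def using C by (simp add: real_le_lsqrt)
qed

lemma L2_le_vnorm:
  assumes "f \<in> ell2" "finite S"
  shows "L2_set (\<lambda>i. cmod (f i)) S \<le> vnorm f"
  unfolding L2_set_def vnorm_def
  using assms by (intro real_sqrt_le_mono finite_sum_le_infsum) (auto simp: ell2_def)

lemma vnorm_nonneg [simp]: "vnorm f \<ge> 0"
  unfolding vnorm_def by (intro real_sqrt_ge_zero infsum_nonneg) auto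

lemma cmod_le_vnorm: "f \<in> ell2 \<Longrightarrow> cmod (f i) \<le> vnorm f"
  using L2_le_vnorm[of f "{i}"] by simp

lemma vnorm_zero [simp]: "vnorm (\<lambda>i. 0) = 0"
  by (simp add: vnorm_def)

lemma vnorm_eq_0: "f \<in> ell2 \<Longrightarrow> vnorm f = 0 \<Longrightarrow> f = (\<lambda>i. 0)"
  using cmod_le_vnorm by fastforce

lemma
  assumes "f \<in> ell2" "g \<in> ell2"
  shows ell2_add: "(\<lambda>i. f i + g i) \<in> ell2"
    and vnorm_triangle: "vnorm (\<lambda>i. f i + g i) \<le> vnorm f + vnorm g"
proof -
  have "L2_set (\<lambda>i. cmod (f i + g i)) S \<le> vnorm f + vnorm g" if "finite S" for S
  proof -
    have "L2_set (\<lambda>i. cmod (f i + g i)) S \<le> L2_set (\<lambda>i. cmod (f i) + cmod (g i)) S"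
      by (intro L2_set_mono norm_triangle_ineq) auto
    also have "\<dots> \<le> L2_set (\<lambda>i. cmod (f i)) S + L2_set (\<lambda>i. cmod (g i)) S"
      by (rule L2_set_triangle_ineq)
    also have "\<dots> \<le> vnorm f + vnorm g" using assms that by (intro add_mono L2_le_vnorm)
    finally show ?thesis .
  qed
  from ell2_boundI[OF this] show "(\<lambda>i. f i + g i) \<in> ell2" "vnorm (\<lambda>i. f i + g i) \<le> vnorm f + vnorm g" by auto
qed

lemma ell2_scale: "f \<in> ell2 \<Longrightarrow> (\<lambda>i. c * f i) \<in> ell2"
  unfolding ell2_def by (simp add: norm_mult power_mult_distrib summable_on_cmult_right)

lemma vnorm_scale: "vnorm (\<lambda>i. c * f i) = cmod c * vnorm f"
  unfolding vnorm_def by (simp add: norm_mult power_mult_distrib infsum_cmult_right' real_sqrt_mult)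

lemma ell2_zero [simp]: "(\<lambda>i. 0) \<in> ell2"
  by (simp add: ell2_def)

lemma ell2_uminus: "f \<in> ell2 \<Longrightarrow> (\<lambda>i. - f i) \<in> ell2"
  using ell2_scale[of f "-1"] by simp

lemma ell2_diff: "f \<in> ell2 \<Longrightarrow> g \<in> ell2 \<Longrightarrow> (\<lambda>i. f i - g i) \<in> ell2"
  using ell2_add[of f "\<lambda>i. - g i"] ell2_uminus by auto

lemma ell2_lincomb: "f \<in> ell2 \<Longrightarrow> g \<in> ell2 \<Longrightarrow> (\<lambda>i. a * f i + b * g i) \<in> ell2"
  by (intro ell2_add ell2_scale)

definition evec :: "'i \<Rightarrow> 'i vec" where "evec i = (\<lambda>j. if j = i then 1 else 0)"

lemma evec_ell2: "evec i \<in> ell2"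
  unfolding evec_def ell2_def by (auto intro!: finite_nonzero_values_imp_summable_on)

lemma vnorm_evec_pos: "vnorm (evec i) > 0"
proof -
  have "1 \<le> vnorm (evec i)" using cmod_le_vnorm[OF evec_ell2, of i i] by (simp add: evec_def)
  thus ?thesis by linarith
qed

section \<open>Bounded operators and their norm\<close>

lemma bopD:
  assumes "T \<in> bop"
  shows bop_mem: "f \<in> ell2 \<Longrightarrow> T f \<in> ell2"
    and bop_lin: "f \<in> ell2 \<Longrightarrow> g \<in> ell2 \<Longrightarrow> T (\<lambda>i. a * f i + b * g i) = (\<lambda>i. a * T f i + b * T g i)"
    and bop_out: "f \<notin> ell2 \<Longrightarrow> T f = (\<lambda>i. 0)"
  using assms unfolding bop_def by blast+

lemma bop_add: "T \<in> bop \<Longrightarrow> f \<in> ell2 \<Longrightarrow> g \<in> ell2 \<Longrightarrow> T (\<lambda>i. f i + g i) = (\<lambda>i. T f i + T g i)"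
  using bop_lin[of T f g 1 1] by simp

lemma bop_scale: "T \<in> bop \<Longrightarrow> f \<in> ell2 \<Longrightarrow> T (\<lambda>i. c * f i) = (\<lambda>i. c * T f i)"
  using bop_lin[of T f f c 0] by simp

lemma bop_zero: "T \<in> bop \<Longrightarrow> T (\<lambda>i. 0) = (\<lambda>i. 0)"
  using bop_scale[of T "\<lambda>i. 0" 0] by simp

lemma bop_mem': "T \<in> bop \<Longrightarrow> T f \<in> ell2"
  using bop_mem[of T f] bop_out[of T f] ell2_zero by (cases "f \<in> ell2") auto

lemma bop_bound: assumes "T \<in> bop" obtains C where "C \<ge> 0" "\<And>f. f \<in> ell2 \<Longrightarrow> vnorm (T f) \<le> C * vnorm f"
proof -
  obtain C where C: "\<And>f. f \<in> ell2 \<Longrightarrow> vnorm (T f) \<le> C * vnorm f"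
    using assms unfolding bop_def by blast
  have "vnorm (T f) \<le> \<bar>C\<bar> * vnorm f" if "f \<in> ell2" for f
    using C[OF that] mult_right_mono[of C "\<bar>C\<bar>" "vnorm f"] vnorm_nonneg[of f] by linarith
  thus ?thesis using that[of "\<bar>C\<bar>"] by simp
qed

lemma bop_opnorm:
  assumes "T \<in> bop" "f \<in> ell2"
  shows "vnorm (T f) \<le> opnorm T * vnorm f"
proof (cases "vnorm f = 0")
  case True
  then have "f = (\<lambda>i. 0)" using assms vnorm_eq_0 by blast
  hence "T f = (\<lambda>i. 0)" using bop_zero[OF assms(1)] by metis
  thus ?thesis using True by (metis mult_zero_right order_refl vnorm_zero)
next
  case False
  obtain C where C: "C \<ge> 0" "\<And>f. f \<in> ell2 \<Longrightarrow> vnorm (T f) \<le> C * vnorm f" using bop_bound assms by blast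
  \<comment> \<open>\<open>opnorm\<close> is a supremum of reals, so it dominates the values only
    after they are known to be bounded.\<close>
  have bdd: "bdd_above ((\<lambda>f. vnorm (T f)) ` {f \<in> ell2. vnorm f \<le> 1})"
  proof (rule bdd_aboveI2)
    fix g :: "'a vec" assume g: "g \<in> {f \<in> ell2. vnorm f \<le> 1}"
    have "vnorm (T g) \<le> C * vnorm g" using C(2) g by blast
    also have "\<dots> \<le> C" using C(1) g by (simp add: mult_left_le)
    finally show "vnorm (T g) \<le> C" .
  qed
  define c where "c = complex_of_real (1 / vnorm f)"
  have cf: "(\<lambda>i. c * f i) \<in> ell2" "vnorm (\<lambda>i. c * f i) = 1"
  proof -
    show "(\<lambda>i. c * f i) \<in> ell2" by (rule ell2_scale[OF assms(2)])
    show "vnorm (\<lambda>i. c * f i) = 1" unfolding vnorm_scale using False vnorm_nonneg[of f] by (simp add: c_def norm_divide)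
  qed
  have "vnorm (T (\<lambda>i. c * f i)) \<le> opnorm T" unfolding opnorm_def
    by (rule cSUP_upper[OF _ bdd]) (use cf in simp)
  also have "vnorm (T (\<lambda>i. c * f i)) = cmod c * vnorm (T f)"
    using bop_scale[OF assms, of c] by (metis vnorm_scale)
  also have "cmod c = 1 / vnorm f" using vnorm_nonneg[of f] by (simp add: c_def norm_divide)
  finally show ?thesis using False vnorm_nonneg[of f] by (simp add: field_simps)
qed

lemma opnorm_le:
  assumes "0 \<le> C" "\<And>f. f \<in> ell2 \<Longrightarrow> vnorm (T f) \<le> C * vnorm f"
  shows "opnorm T \<le> C"
  unfolding opnorm_def
proof (rule cSUP_least)
  show "{f \<in> ell2. vnorm f \<le> 1} \<noteq> {}" using ell2_zero vnorm_zero by fastforce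
  show "vnorm (T f) \<le> C" if "f \<in> {f \<in> ell2. vnorm f \<le> 1}" for f
    using assms(2)[of f] that mult_left_le[of "vnorm f" C] assms(1) by auto
qed

lemma opnorm_nonneg: fixes T :: "'a op" shows "T \<in> bop \<Longrightarrow> 0 \<le> opnorm T"
proof -
  assume T: "T \<in> bop"
  \<comment> \<open>Types are inhabited, so \<open>undefined\<close> is a legitimate index and
    \<open>ell2\<close> contains a nonzero vector. The same witness gives
    \<open>0 \<noteq> 1\<close> and \<open>norm 1 = 1\<close> below.\<close>
  define f :: "'a vec" where "f = evec undefined"
  have f: "f \<in> ell2" "vnorm f > 0" unfolding f_def by (rule evec_ell2, rule vnorm_evec_pos)
  have "0 \<le> opnorm T * vnorm f" using bop_opnorm[OF T f(1)] vnorm_nonneg[of "T f"] by linarith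
  thus ?thesis using f(2) by (simp add: zero_le_mult_iff)
qed

lemma bopI:
  assumes "\<And>f. f \<in> ell2 \<Longrightarrow> T f \<in> ell2"
    and "\<And>f g a b. f \<in> ell2 \<Longrightarrow> g \<in> ell2 \<Longrightarrow> T (\<lambda>i. a * f i + b * g i) = (\<lambda>i. a * T f i + b * T g i)"
    and "\<And>f. f \<in> ell2 \<Longrightarrow> vnorm (T f) \<le> C * vnorm f"
    and "\<And>f. f \<notin> ell2 \<Longrightarrow> T f = (\<lambda>i. 0)"
  shows "T \<in> bop"
  using assms unfolding bop_def by blast

lemma op_zero_bop: "op_zero \<in> bop"
  by (rule bopI[of _ 0]) (auto simp: op_zero_def)

lemma op_one_bop: "op_one \<in> bop"
  by (rule bopI[of _ 1]) (auto simp: op_one_def ell2_lincomb)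

lemma op_add_bop: assumes "T \<in> bop" "S \<in> bop" shows "op_add T S \<in> bop"
proof -
  obtain C where C: "C \<ge> 0" "\<And>f. f \<in> ell2 \<Longrightarrow> vnorm (T f) \<le> C * vnorm f" using bop_bound assms by blast
  obtain D where D: "D \<ge> 0" "\<And>f. f \<in> ell2 \<Longrightarrow> vnorm (S f) \<le> D * vnorm f" using bop_bound assms by blast
  show ?thesis
  proof (rule bopI[of _ "C + D"])
    fix f :: "'a vec" assume f: "f \<in> ell2"
    show "op_add T S f \<in> ell2" unfolding op_add_def
      by (intro ell2_add bop_mem'[OF assms(1)] bop_mem'[OF assms(2)])
    have "vnorm (op_add T S f) \<le> vnorm (T f) + vnorm (S f)"
      unfolding op_add_def by (intro vnorm_triangle bop_mem'[OF assms(1)] bop_mem'[OF assms(2)])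
    thus "vnorm (op_add T S f) \<le> (C + D) * vnorm f" using C(2)[OF f] D(2)[OF f] by (simp add: algebra_simps)
  qed (simp_all add: op_add_def bop_lin[OF assms(1)] bop_lin[OF assms(2)] bop_out[OF assms(1)] bop_out[OF assms(2)] algebra_simps)
qed

lemma op_scale_bop: assumes "T \<in> bop" shows "op_scale c T \<in> bop"
proof -
  obtain C where C: "C \<ge> 0" "\<And>f. f \<in> ell2 \<Longrightarrow> vnorm (T f) \<le> C * vnorm f" using bop_bound assms by blast
  show ?thesis
  proof (rule bopI[of _ "cmod c * C"])
    fix f :: "'a vec" assume f: "f \<in> ell2"
    show "op_scale c T f \<in> ell2" unfolding op_scale_def by (intro ell2_scale bop_mem'[OF assms])
    show "vnorm (op_scale c T f) \<le> cmod c * C * vnorm f"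
      unfolding op_scale_def vnorm_scale mult.assoc by (intro mult_left_mono C f) auto
  next
    fix f g :: "'a vec" and a b assume "f \<in> ell2" "g \<in> ell2"
    thus "op_scale c T (\<lambda>i. a * f i + b * g i) = (\<lambda>i. a * op_scale c T f i + b * op_scale c T g i)"
      by (simp add: op_scale_def bop_lin[OF assms] algebra_simps)
  qed (simp add: op_scale_def bop_out[OF assms])
qed

lemma op_comp_bop: assumes "T \<in> bop" "S \<in> bop" shows "T \<circ> S \<in> bop"
proof -
  obtain C where C: "C \<ge> 0" "\<And>f. f \<in> ell2 \<Longrightarrow> vnorm (T f) \<le> C * vnorm f" using bop_bound assms by blast
  obtain D where D: "D \<ge> 0" "\<And>f. f \<in> ell2 \<Longrightarrow> vnorm (S f) \<le> D * vnorm f" using bop_bound assms by blast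
  show ?thesis
  proof (rule bopI[of _ "C * D"])
    fix f :: "'a vec" assume f: "f \<in> ell2"
    have "vnorm (T (S f)) \<le> C * vnorm (S f)" by (intro C bop_mem'[OF assms(2)])
    also have "\<dots> \<le> C * (D * vnorm f)" using C D f by (intro mult_left_mono) auto
    finally show "vnorm ((T \<circ> S) f) \<le> C * D * vnorm f" by (simp add: algebra_simps)
  qed (simp_all add: bop_lin[OF assms(1)] bop_lin[OF assms(2)] bop_out[OF assms(2)] bop_mem'[OF assms(1)] bop_mem'[OF assms(2)] bop_zero[OF assms(1)])
qed

text \<open>Turning the set \<open>bop\<close> into a type makes the classes
  \<open>real_normed_algebra_1\<close> and \<open>banach\<close> available, and with them powers,
  absolutely convergent series and Cauchy products.\<close>

typedef 'i bo = "bop :: 'i op set"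
  using op_zero_bop by blast

setup_lifting type_definition_bo

text \<open>The algebra classes carry real scalars. Complex scalars are represented by the central
  elements \<open>cs c\<close>, and scaling by \<open>c\<close> is left multiplication by
  \<open>cs c\<close>.\<close>

lift_definition cs :: "complex \<Rightarrow> 'i bo" is "\<lambda>c. op_scale c op_one"
  by (simp add: op_scale_bop op_one_bop)

instantiation bo :: (type) real_normed_algebra_1
begin

lift_definition zero_bo :: "'a bo" is op_zero by (rule op_zero_bop)
lift_definition one_bo :: "'a bo" is op_one by (rule op_one_bop)
lift_definition plus_bo :: "'a bo \<Rightarrow> 'a bo \<Rightarrow> 'a bo" is op_add by (rule op_add_bop)
lift_definition times_bo :: "'a bo \<Rightarrow> 'a bo \<Rightarrow> 'a bo" is "(\<circ>)" by (rule op_comp_bop)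
lift_definition uminus_bo :: "'a bo \<Rightarrow> 'a bo" is "op_scale (-1)" by (rule op_scale_bop)
lift_definition minus_bo :: "'a bo \<Rightarrow> 'a bo \<Rightarrow> 'a bo" is "\<lambda>T S. op_add T (op_scale (-1) S)"
  by (intro op_add_bop op_scale_bop)
lift_definition scaleR_bo :: "real \<Rightarrow> 'a bo \<Rightarrow> 'a bo" is "\<lambda>r. op_scale (of_real r)"
  by (rule op_scale_bop)
lift_definition norm_bo :: "'a bo \<Rightarrow> real" is opnorm .
definition sgn_bo :: "'a bo \<Rightarrow> 'a bo" where "sgn_bo x = inverse (norm x) *\<^sub>R x"
definition dist_bo :: "'a bo \<Rightarrow> 'a bo \<Rightarrow> real" where "dist_bo x y = norm (x - y)"
definition uniformity_bo :: "('a bo \<times> 'a bo) filter"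
  where "uniformity_bo = (INF e\<in>{0 <..}. principal {(x, y). dist x y < e})"
definition open_bo :: "'a bo set \<Rightarrow> bool"
  where "open_bo U \<longleftrightarrow> (\<forall>x\<in>U. eventually (\<lambda>(x', y). x' = x \<longrightarrow> y \<in> U) uniformity)"

lemmas rep_bo = zero_bo.rep_eq one_bo.rep_eq plus_bo.rep_eq times_bo.rep_eq uminus_bo.rep_eq
  minus_bo.rep_eq scaleR_bo.rep_eq norm_bo.rep_eq cs.rep_eq

lemmas bo_eq = Rep_bo_inject[symmetric]

lemmas Rep_bo_rules = bop_mem'[OF Rep_bo] bop_add[OF Rep_bo] bop_scale[OF Rep_bo] bop_out[OF Rep_bo]
  bop_zero[OF Rep_bo]

instance
proof
  fix x y z :: "'a bo" and r s :: real
  show "x + y + z = x + (y + z)" unfolding bo_eq rep_bo by (auto simp: Rep_bo_rules fun_eq_iff algebra_simps op_add_def)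
  show "x + y = y + x" unfolding bo_eq rep_bo by (auto simp: Rep_bo_rules fun_eq_iff algebra_simps op_add_def)
  show "0 + x = x" unfolding bo_eq rep_bo by (auto simp: Rep_bo_rules fun_eq_iff algebra_simps op_add_def op_zero_def)
  show "- x + x = 0" unfolding bo_eq rep_bo by (auto simp: Rep_bo_rules fun_eq_iff algebra_simps op_add_def op_zero_def op_scale_def)
  show "x - y = x + - y" unfolding bo_eq rep_bo by (auto simp: Rep_bo_rules fun_eq_iff algebra_simps op_add_def op_scale_def)
  show "r *\<^sub>R (x + y) = r *\<^sub>R x + r *\<^sub>R y" unfolding bo_eq rep_bo by (auto simp: Rep_bo_rules fun_eq_iff algebra_simps op_add_def op_scale_def)
  show "(r + s) *\<^sub>R x = r *\<^sub>R x + s *\<^sub>R x" unfolding bo_eq rep_bo by (auto simp: Rep_bo_rules fun_eq_iff algebra_simps op_add_def op_scale_def)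
  show "r *\<^sub>R s *\<^sub>R x = (r * s) *\<^sub>R x" unfolding bo_eq rep_bo by (auto simp: Rep_bo_rules fun_eq_iff algebra_simps op_scale_def)
  show "1 *\<^sub>R x = x" unfolding bo_eq rep_bo by (auto simp: Rep_bo_rules fun_eq_iff algebra_simps op_scale_def)
  show "x * y * z = x * (y * z)" unfolding bo_eq rep_bo by (auto simp: Rep_bo_rules fun_eq_iff algebra_simps o_assoc)
  show "(x + y) * z = x * z + y * z" unfolding bo_eq rep_bo by (auto simp: Rep_bo_rules fun_eq_iff algebra_simps op_add_def)
  show "x * (y + z) = x * y + x * z" unfolding bo_eq rep_bo by (auto simp: Rep_bo_rules fun_eq_iff algebra_simps op_add_def)
  show "r *\<^sub>R x * y = r *\<^sub>R (x * y)" unfolding bo_eq rep_bo by (auto simp: Rep_bo_rules fun_eq_iff algebra_simps op_scale_def)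
  show "x * r *\<^sub>R y = r *\<^sub>R (x * y)" unfolding bo_eq rep_bo by (auto simp: Rep_bo_rules fun_eq_iff algebra_simps op_scale_def)
  show "1 * x = x" unfolding bo_eq rep_bo by (auto simp: Rep_bo_rules fun_eq_iff algebra_simps op_one_def)
  show "x * 1 = x" unfolding bo_eq rep_bo by (auto simp: Rep_bo_rules fun_eq_iff algebra_simps op_one_def)
  show "(0 :: 'a bo) \<noteq> 1" unfolding bo_eq rep_bo
  proof -
    define f :: "'a vec" where "f = evec undefined"
    have f: "f \<in> ell2" unfolding f_def by (rule evec_ell2)
    show "(op_zero :: 'a op) \<noteq> op_one"
    proof
      assume "(op_zero :: 'a op) = op_one"
      hence "op_zero f undefined = op_one f undefined" by simp
      thus False using f by (simp add: op_zero_def op_one_def f_def evec_def)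
    qed
  qed
  show "dist x y = norm (x - y)" by (rule dist_bo_def)
  show "sgn x = inverse (norm x) *\<^sub>R x" by (rule sgn_bo_def)
  show "uniformity = (INF e\<in>{0 <..}. principal {(x, y :: 'a bo). dist x y < e})" by (rule uniformity_bo_def)
  show "open U \<longleftrightarrow> (\<forall>x\<in>U. eventually (\<lambda>(x', y). x' = x \<longrightarrow> y \<in> U) uniformity)" for U :: "'a bo set"
    by (rule open_bo_def)
  show "norm x = 0 \<longleftrightarrow> x = 0"
  proof -
    define T where "T = Rep_bo x"
    have T: "T \<in> bop" unfolding T_def by (rule Rep_bo)
    have "opnorm T = 0 \<longleftrightarrow> T = op_zero"
    proof
      assume 0: "opnorm T = 0"
      have "T f = (\<lambda>i. 0)" for f
      proof (cases "f \<in> ell2")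
        case True
        have "vnorm (T f) = 0" using bop_opnorm[OF T True] vnorm_nonneg[of "T f"] unfolding 0 by linarith
        thus ?thesis by (rule vnorm_eq_0[OF bop_mem'[OF T]])
      qed (rule bop_out[OF T])
      thus "T = op_zero" unfolding op_zero_def by (intro ext) metis
    next
      assume "T = op_zero"
      hence "opnorm T \<le> 0" by (intro opnorm_le) (simp_all add: op_zero_def)
      thus "opnorm T = 0" using opnorm_nonneg[OF T] by linarith
    qed
    thus ?thesis unfolding bo_eq rep_bo T_def .
  qed
  show "norm (x + y) \<le> norm x + norm y"
  proof -
    define T where "T = Rep_bo x"
    define S where "S = Rep_bo y"
    have TS: "T \<in> bop" "S \<in> bop" unfolding T_def S_def by (rule Rep_bo)+
    have "opnorm (op_add T S) \<le> opnorm T + opnorm S"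
    proof (rule opnorm_le)
      fix f :: "'a vec" assume f: "f \<in> ell2"
      have "vnorm (op_add T S f) \<le> vnorm (T f) + vnorm (S f)"
        unfolding op_add_def by (intro vnorm_triangle bop_mem'[OF TS(1)] bop_mem'[OF TS(2)])
      thus "vnorm (op_add T S f) \<le> (opnorm T + opnorm S) * vnorm f"
        using bop_opnorm[OF TS(1) f] bop_opnorm[OF TS(2) f] by (simp add: algebra_simps)
    qed (use TS in \<open>simp add: opnorm_nonneg\<close>)
    thus ?thesis unfolding rep_bo T_def S_def .
  qed
  show "norm (r *\<^sub>R x) = \<bar>r\<bar> * norm x"
  proof -
    define T where "T = Rep_bo x"
    have T: "T \<in> bop" unfolding T_def by (rule Rep_bo)
    \<comment> \<open>Stated for all scalars and operators, so that applying it once more with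
      \<open>1/r\<close> yields the reverse inequality. \<open>norm_cs_mult\<close> uses the same
      device for complex scalars.\<close>
    have le: "opnorm (op_scale (of_real r) T) \<le> \<bar>r\<bar> * opnorm T" if T: "T \<in> bop" for r and T :: "'a op"
      using bop_opnorm[OF T] opnorm_nonneg[OF T]
      by (intro opnorm_le) (auto simp: op_scale_def vnorm_scale mult_left_mono mult.assoc)
    have "opnorm (op_scale (of_real r) T) = \<bar>r\<bar> * opnorm T"
    proof (cases "r = 0")
      case True
      thus ?thesis using le[OF T, of 0] opnorm_nonneg[OF op_scale_bop[OF T, of 0]] by simp
    next
      case False
      have "op_scale (of_real (1/r)) (op_scale (of_real r) T) = T"
        using False by (simp add: op_scale_def)
      hence "opnorm T \<le> \<bar>1/r\<bar> * opnorm (op_scale (of_real r) T)"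
        using le[OF op_scale_bop[OF T, of "of_real r"], of "1/r"] by simp
      hence "\<bar>r\<bar> * opnorm T \<le> opnorm (op_scale (of_real r) T)" using False by (simp add: field_simps)
      thus ?thesis using le[OF T, of r] by simp
    qed
    thus ?thesis unfolding rep_bo T_def .
  qed
  show "norm (x * y) \<le> norm x * norm y"
  proof -
    define T where "T = Rep_bo x"
    define S where "S = Rep_bo y"
    have TS: "T \<in> bop" "S \<in> bop" unfolding T_def S_def by (rule Rep_bo)+
    have "opnorm (T \<circ> S) \<le> opnorm T * opnorm S"
    proof (rule opnorm_le)
      fix f :: "'a vec" assume f: "f \<in> ell2"
      have "vnorm ((T \<circ> S) f) \<le> opnorm T * vnorm (S f)" using bop_opnorm[OF TS(1) bop_mem'[OF TS(2)]] by simp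
      also have "\<dots> \<le> opnorm T * (opnorm S * vnorm f)"
        using bop_opnorm[OF TS(2) f] opnorm_nonneg[OF TS(1)] by (intro mult_left_mono)
      finally show "vnorm ((T \<circ> S) f) \<le> opnorm T * opnorm S * vnorm f" by (simp add: algebra_simps)
    qed (use TS in \<open>simp add: opnorm_nonneg\<close>)
    thus ?thesis unfolding rep_bo T_def S_def .
  qed
  show "norm (1 :: 'a bo) = 1" unfolding rep_bo
  proof -
    define f :: "'a vec" where "f = evec undefined"
    have f: "f \<in> ell2" and pos: "vnorm f > 0" unfolding f_def by (rule evec_ell2, rule vnorm_evec_pos)
    have "vnorm f \<le> opnorm (op_one :: 'a op) * vnorm f"
      using bop_opnorm[OF op_one_bop f] f by (simp add: op_one_def)
    hence "1 \<le> opnorm (op_one :: 'a op)" using pos by simp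
    moreover have "opnorm (op_one :: 'a op) \<le> 1" by (rule opnorm_le) (auto simp: op_one_def)
    ultimately show "opnorm (op_one :: 'a op) = 1" by simp
  qed
qed

end

lemma cs_0 [simp]: "cs 0 = 0" unfolding bo_eq rep_bo by (auto simp: Rep_bo_rules fun_eq_iff algebra_simps op_scale_def op_zero_def)
lemma cs_1 [simp]: "cs 1 = 1" unfolding bo_eq rep_bo by (auto simp: Rep_bo_rules fun_eq_iff algebra_simps op_scale_def)
lemma cs_add: "cs (a + b) = cs a + cs b"
  unfolding bo_eq rep_bo by (auto simp: Rep_bo_rules fun_eq_iff algebra_simps op_scale_def op_add_def)
lemma cs_mult: "cs (a * b) = cs a * cs b"
  unfolding bo_eq rep_bo by (auto simp: Rep_bo_rules fun_eq_iff algebra_simps op_scale_def op_one_def ell2_scale)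
lemma cs_diff: "cs (a - b) = cs a - cs b" unfolding bo_eq rep_bo by (auto simp: Rep_bo_rules fun_eq_iff algebra_simps op_scale_def op_add_def)
lemma cs_uminus: "cs (- b) = - cs b" unfolding bo_eq rep_bo by (auto simp: Rep_bo_rules fun_eq_iff algebra_simps op_scale_def)
lemma scaleR_cs: "r *\<^sub>R x = cs (of_real r) * x"
  unfolding bo_eq rep_bo by (auto simp: Rep_bo_rules fun_eq_iff algebra_simps op_scale_def op_one_def)
lemma cs_commute: "x * cs c = cs c * x"
  unfolding bo_eq rep_bo by (auto simp: Rep_bo_rules fun_eq_iff algebra_simps op_scale_def op_one_def)
lemma cs_left_commute: "x * (cs c * y) = cs c * (x * y)"
  by (simp add: mult.assoc[symmetric] cs_commute)
lemma Rep_cs_mult: "Rep_bo (cs c * x) = op_scale c (Rep_bo x)"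
  unfolding bo_eq rep_bo by (auto simp: Rep_bo_rules fun_eq_iff algebra_simps op_scale_def op_one_def)
lemma cs_sum: "cs (sum f A) = (\<Sum>x\<in>A. cs (f x))"
  by (induct A rule: infinite_finite_induct) (auto simp: cs_add)

lemma norm_bo_bound: "f \<in> ell2 \<Longrightarrow> vnorm (Rep_bo x f) \<le> norm x * vnorm f"
  unfolding rep_bo by (rule bop_opnorm[OF Rep_bo])

lemma norm_bo_le: "0 \<le> C \<Longrightarrow> (\<And>f. f \<in> ell2 \<Longrightarrow> vnorm (Rep_bo x f) \<le> C * vnorm f) \<Longrightarrow> norm x \<le> C"
  unfolding rep_bo by (rule opnorm_le)

lemma norm_cs_mult: "norm (cs c * x) = cmod c * norm x"
proof -
  have le: "norm (cs c * x) \<le> cmod c * norm x" for c and x :: "'a bo"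
    using norm_bo_bound[of _ x]
    by (intro norm_bo_le) (auto simp: Rep_cs_mult op_scale_def vnorm_scale mult_left_mono mult.assoc)
  show ?thesis
  proof (cases "c = 0")
    case False
    have "norm x = norm (cs (1/c) * (cs c * x))" using False by (simp add: mult.assoc[symmetric] cs_mult[symmetric])
    also have "\<dots> \<le> cmod (1/c) * norm (cs c * x)" by (rule le)
    finally have "cmod c * norm x \<le> norm (cs c * x)" using False by (simp add: norm_divide field_simps)
    thus ?thesis using le[of c x] by simp
  qed simp
qed

text \<open>Each coordinate of \<open>X n\<close> applied to \<open>f\<close> is a Cauchy sequence
  of complex numbers. The coordinatewise limit \<open>L\<close> is linear, and the Cauchy estimate
  passes to it on finite coordinate sets, which yields both boundedness of \<open>L\<close> and
  convergence in operator norm.\<close>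

lemma bo_Cauchy_convergent:
  fixes X :: "nat \<Rightarrow> 'i bo"
  assumes "Cauchy X"
  shows "convergent X"
proof -
  let ?T = "\<lambda>n. Rep_bo (X n)"
  have T: "?T n \<in> bop" for n by (rule Rep_bo)
  have diff: "Rep_bo (x - y) f = (\<lambda>i. Rep_bo x f i - Rep_bo y f i)" for x y :: "'i bo" and f
    unfolding bo_eq rep_bo by (auto simp: Rep_bo_rules fun_eq_iff algebra_simps op_add_def op_scale_def)
  have bd: "vnorm (\<lambda>i. ?T n f i - ?T m f i) \<le> norm (X n - X m) * vnorm f" if "f \<in> ell2" for n m f
    using norm_bo_bound[OF that, of "X n - X m"] by (simp add: diff)
  have conv: "convergent (\<lambda>n. ?T n f i)" if f: "f \<in> ell2" for f i
  proof -
    have "Cauchy (\<lambda>n. ?T n f i)"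
    proof (rule metric_CauchyI)
      fix e :: real assume e: "e > 0"
      obtain N where N: "\<And>m n. m \<ge> N \<Longrightarrow> n \<ge> N \<Longrightarrow> norm (X m - X n) < e / (vnorm f + 1)"
        using CauchyD[OF assms, of "e / (vnorm f + 1)"] e vnorm_nonneg[of f] by (meson add_nonneg_pos divide_pos_pos zero_less_one)
      have "dist (?T m f i) (?T n f i) < e" if "m \<ge> N" "n \<ge> N" for m n
      proof -
        have "dist (?T m f i) (?T n f i) \<le> vnorm (\<lambda>i. ?T m f i - ?T n f i)"
          unfolding dist_norm using cmod_le_vnorm[OF ell2_diff[OF bop_mem'[OF T] bop_mem'[OF T]]] by simp
        also have "\<dots> \<le> norm (X m - X n) * vnorm f" by (rule bd[OF f])
        also have "\<dots> \<le> e / (vnorm f + 1) * vnorm f" using N[OF that] by (intro mult_right_mono) auto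
        also have "\<dots> < e" using e vnorm_nonneg[of f] by (simp add: field_simps add_pos_nonneg)
        finally show ?thesis .
      qed
      thus "\<exists>M. \<forall>m\<ge>M. \<forall>n\<ge>M. dist (?T m f i) (?T n f i) < e" by blast
    qed
    thus ?thesis by (rule Cauchy_convergent)
  qed
  define L where "L = (\<lambda>f i. if f \<in> ell2 then lim (\<lambda>n. ?T n f i) else 0)"
  have L: "(\<lambda>n. ?T n f i) \<longlonglongrightarrow> L f i" if "f \<in> ell2" for f i
    using conv[OF that] that by (simp add: L_def convergent_LIMSEQ_iff)
  have close: "\<exists>N. \<forall>n\<ge>N. \<forall>f\<in>ell2. (\<lambda>i. ?T n f i - L f i) \<in> ell2 \<and> vnorm (\<lambda>i. ?T n f i - L f i) \<le> e * vnorm f"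
    if e: "e > 0" for e
  proof -
    obtain N where N: "\<And>m n. m \<ge> N \<Longrightarrow> n \<ge> N \<Longrightarrow> norm (X m - X n) < e"
      using CauchyD[OF assms e] by blast
    have "(\<lambda>i. ?T n f i - L f i) \<in> ell2 \<and> vnorm (\<lambda>i. ?T n f i - L f i) \<le> e * vnorm f"
      if n: "n \<ge> N" and f: "f \<in> ell2" for n f
    proof -
      \<comment> \<open>With \<open>n\<close> fixed and \<open>m\<close> tending to infinity, the
        bound survives on every finite set of coordinates; \<open>ell2_boundI\<close> then restores
        the full norm, as in Fatou's lemma.\<close>
      have "L2_set (\<lambda>i. cmod (?T n f i - L f i)) S \<le> e * vnorm f" if S: "finite S" for S
      proof (rule tendsto_upperbound)
        show "(\<lambda>m. L2_set (\<lambda>i. cmod (?T n f i - ?T m f i)) S) \<longlonglongrightarrow> L2_set (\<lambda>i. cmod (?T n f i - L f i)) S"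
          unfolding L2_set_def by (intro tendsto_intros L f)
        show "\<forall>\<^sub>F m in sequentially. L2_set (\<lambda>i. cmod (?T n f i - ?T m f i)) S \<le> e * vnorm f"
          using eventually_ge_at_top[of N]
        proof eventually_elim
          case (elim m)
          have "L2_set (\<lambda>i. cmod (?T n f i - ?T m f i)) S \<le> vnorm (\<lambda>i. ?T n f i - ?T m f i)"
            by (intro L2_le_vnorm ell2_diff bop_mem'[OF T] S)
          also have "\<dots> \<le> norm (X n - X m) * vnorm f" by (rule bd[OF f])
          also have "\<dots> \<le> e * vnorm f" using N[OF n elim] by (intro mult_right_mono) auto
          finally show ?case .
        qed
      qed auto
      from ell2_boundI[OF this] show ?thesis by auto
    qed
    thus ?thesis by blast
  qed
  obtain N where N: "\<And>f. f \<in> ell2 \<Longrightarrow> (\<lambda>i. ?T N f i - L f i) \<in> ell2 \<and> vnorm (\<lambda>i. ?T N f i - L f i) \<le> 1 * vnorm f"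
    using close[of 1] by auto
  have Lbop: "L \<in> bop"
  proof (rule bopI[of _ "norm (X N) + 1"])
    fix f :: "'i vec" assume f: "f \<in> ell2"
    have eq: "L f = (\<lambda>i. ?T N f i + - (?T N f i - L f i))" by simp
    have mem: "(\<lambda>i. - (?T N f i - L f i)) \<in> ell2" using N[OF f] by (intro ell2_uminus) auto
    show "L f \<in> ell2" by (subst eq) (intro ell2_add bop_mem'[OF T] mem)
    have "vnorm (L f) \<le> vnorm (?T N f) + vnorm (\<lambda>i. - (?T N f i - L f i))"
      by (subst eq) (intro vnorm_triangle bop_mem'[OF T] mem)
    also have "vnorm (\<lambda>i. - (?T N f i - L f i)) = vnorm (\<lambda>i. ?T N f i - L f i)"
      using vnorm_scale[of "-1" "\<lambda>i. ?T N f i - L f i"] by simp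
    finally show "vnorm (L f) \<le> (norm (X N) + 1) * vnorm f"
      using N[OF f] norm_bo_bound[OF f, of "X N"] by (simp add: algebra_simps)
  next
    fix f g :: "'i vec" and a b assume fg: "f \<in> ell2" "g \<in> ell2"
    show "L (\<lambda>i. a * f i + b * g i) = (\<lambda>i. a * L f i + b * L g i)"
    proof
      fix i
      have "(\<lambda>n. ?T n (\<lambda>i. a * f i + b * g i) i) \<longlonglongrightarrow> a * L f i + b * L g i"
        by (simp add: bop_lin[OF T fg]) (intro tendsto_intros L fg)
      thus "L (\<lambda>i. a * f i + b * g i) i = a * L f i + b * L g i"
        using L[OF ell2_lincomb[OF fg]] LIMSEQ_unique by blast
    qed
  qed (simp add: L_def)
  have "X \<longlonglongrightarrow> Abs_bo L"
  proof (rule metric_LIMSEQ_I)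
    fix e :: real assume e: "e > 0"
    then obtain N where N: "\<And>n f. n \<ge> N \<Longrightarrow> f \<in> ell2 \<Longrightarrow> vnorm (\<lambda>i. ?T n f i - L f i) \<le> e/2 * vnorm f"
      using close[of "e/2"] by auto
    have "dist (X n) (Abs_bo L) < e" if "n \<ge> N" for n
    proof -
      have "norm (X n - Abs_bo L) \<le> e/2"
        using N[OF that] e by (intro norm_bo_le) (auto simp: diff Abs_bo_inverse[OF Lbop])
      thus ?thesis using e by (simp add: dist_norm)
    qed
    thus "\<exists>N. \<forall>n\<ge>N. dist (X n) (Abs_bo L) < e" by blast
  qed
  thus ?thesis by (auto simp: convergent_def)
qed

instance bo :: (type) banach
  by standard (rule bo_Cauchy_convergent)

section \<open>Adjoints\<close>

lemma
  assumes "f \<in> ell2" "g \<in> ell2"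
  shows vinner_abs_summable: "(\<lambda>i. cmod (cnj (f i) * g i)) summable_on UNIV"
    and vinner_le: "cmod (vinner f g) \<le> vnorm f * vnorm g"
proof -
  have le: "(\<Sum>i\<in>S. cmod (cnj (f i) * g i)) \<le> vnorm f * vnorm g" if "finite S" for S
  proof -
    have "(\<Sum>i\<in>S. cmod (cnj (f i) * g i)) \<le> L2_set (\<lambda>i. cmod (f i)) S * L2_set (\<lambda>i. cmod (g i)) S"
      using L2_set_mult_ineq[of "\<lambda>i. cmod (f i)" "\<lambda>i. cmod (g i)" S] by (simp add: norm_mult)
    also have "\<dots> \<le> vnorm f * vnorm g"
      by (intro mult_mono L2_le_vnorm assms that L2_set_nonneg vnorm_nonneg)
    finally show ?thesis .
  qed
  show *: "(\<lambda>i. cmod (cnj (f i) * g i)) summable_on UNIV"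
    unfolding Infinite_Sum.abs_summable_iff_bdd_above by (intro bdd_aboveI2[of _ _ "vnorm f * vnorm g"]) (use le in auto)
  have "cmod (vinner f g) \<le> (\<Sum>\<^sub>\<infinity>i. cmod (cnj (f i) * g i))"
    unfolding vinner_def using * by (rule norm_infsum_bound)
  also have "\<dots> \<le> vnorm f * vnorm g"
    by (rule infsum_le_finite_sums[OF *]) (use le in auto)
  finally show "cmod (vinner f g) \<le> vnorm f * vnorm g" .
qed

lemma vinner_summable: "f \<in> ell2 \<Longrightarrow> g \<in> ell2 \<Longrightarrow> (\<lambda>i. cnj (f i) * g i) summable_on UNIV"
  using Infinite_Sum.abs_summable_summable[OF vinner_abs_summable] .

lemma vinner_cnj: "cnj (vinner f g) = vinner g f"
  unfolding vinner_def infsum_cnj[symmetric] by (simp add: mult.commute)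

lemma vinner_add_right:
  assumes "f \<in> ell2" "g \<in> ell2" "h \<in> ell2"
  shows "vinner f (\<lambda>i. g i + h i) = vinner f g + vinner f h"
  unfolding vinner_def ring_distribs by (intro infsum_add vinner_summable assms)

lemma vinner_scale_right: "vinner f (\<lambda>i. c * g i) = c * vinner f g"
  unfolding vinner_def infsum_cmult_right'[symmetric] by (simp add: mult.left_commute)

lemma vinner_add_left:
  assumes "f \<in> ell2" "g \<in> ell2" "h \<in> ell2"
  shows "vinner (\<lambda>i. g i + h i) f = vinner g f + vinner h f"
  using vinner_add_right[OF assms] by (metis complex_cnj_add vinner_cnj)

lemma vinner_scale_left: "vinner (\<lambda>i. c * g i) f = cnj c * vinner g f"
  by (metis complex_cnj_mult vinner_cnj vinner_scale_right)

lemma vinner_diff_right: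
  assumes "f \<in> ell2" "g \<in> ell2" "h \<in> ell2"
  shows "vinner f (\<lambda>i. g i - h i) = vinner f g - vinner f h"
  using vinner_add_right[OF assms(1,2) ell2_uminus[OF assms(3)]] vinner_scale_right[of f "-1" h] by simp

lemma vinner_self:
  assumes "f \<in> ell2"
  shows "vinner f f = of_real ((vnorm f)\<^sup>2)"
proof -
  have "((\<lambda>i. of_real ((cmod (f i))\<^sup>2) :: complex) has_sum of_real (\<Sum>\<^sub>\<infinity>i. (cmod (f i))\<^sup>2)) UNIV"
    by (intro has_sum_of_real has_sum_infsum) (use assms in \<open>simp add: ell2_def\<close>)
  moreover have "cnj (f i) * f i = of_real ((cmod (f i))\<^sup>2)" for i
    by (metis complex_norm_square mult.commute)
  ultimately have "vinner f f = of_real (\<Sum>\<^sub>\<infinity>i. (cmod (f i))\<^sup>2)"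
    unfolding vinner_def by (simp only: infsumI)
  moreover have "(\<Sum>\<^sub>\<infinity>i. (cmod (f i))\<^sup>2) \<ge> 0" by (intro infsum_nonneg) auto
  ultimately show ?thesis unfolding vnorm_def by simp
qed

lemma vinner_evec: "vinner (evec i) g = g i"
proof -
  have "vinner (evec i) g = (\<Sum>\<^sub>\<infinity>j\<in>{i}. g j)"
    unfolding vinner_def by (intro infsum_cong_neutral) (auto simp: evec_def)
  thus ?thesis by simp
qed

lemma finite_support_ell2: "finite S \<Longrightarrow> (\<lambda>j. if j \<in> S then c j else 0) \<in> ell2"
  unfolding ell2_def by (auto intro!: finite_nonzero_values_imp_summable_on elim: finite_subset[rotated])

lemma vnorm_finite_support:
  assumes "finite S"
  shows "vnorm (\<lambda>j. if j \<in> S then c j else 0) = L2_set (\<lambda>i. cmod (c i)) S"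
proof -
  have "(\<Sum>\<^sub>\<infinity>j. (cmod (if j \<in> S then c j else 0))\<^sup>2) = (\<Sum>\<^sub>\<infinity>j\<in>S. (cmod (c j))\<^sup>2)"
    by (intro infsum_cong_neutral) auto
  thus ?thesis using assms unfolding vnorm_def L2_set_def by simp
qed

lemma vinner_bop_finite_support:
  assumes T: "T \<in> bop" and g: "g \<in> ell2" and S: "finite S"
  shows "vinner (T (\<lambda>j. if j \<in> S then c j else 0)) g = (\<Sum>i\<in>S. cnj (c i) * vinner (T (evec i)) g)"
  using S
proof induct
  case empty
  thus ?case by (simp add: bop_zero[OF T] vinner_def)
next
  case (insert x F)
  let ?f = "\<lambda>j. if j \<in> F then c j else 0"
  have eq: "(\<lambda>j. if j \<in> insert x F then c j else 0) = (\<lambda>j. 1 * ?f j + c x * evec x j)"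
    using insert by (auto simp: evec_def)
  have "T (\<lambda>j. if j \<in> insert x F then c j else 0) = (\<lambda>j. T ?f j + c x * T (evec x) j)"
    unfolding eq by (subst bop_lin[OF T]) (auto intro: finite_support_ell2 evec_ell2 insert)
  hence "vinner (T (\<lambda>j. if j \<in> insert x F then c j else 0)) g
      = vinner (T ?f) g + cnj (c x) * vinner (T (evec x)) g"
    using g bop_mem'[OF T] by (simp add: vinner_add_left ell2_scale vinner_scale_left)
  thus ?case using insert by simp
qed

text \<open>Pairing with \<open>evec i\<close> reads off coordinate \<open>i\<close>, so the
  defining identity of an adjoint forces this formula.\<close>

definition adjop :: "'i op \<Rightarrow> 'i op" where
  "adjop T = (\<lambda>g. if g \<in> ell2 then (\<lambda>i. vinner (T (evec i)) g) else (\<lambda>i. 0))"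

text \<open>Let \<open>h\<close> be the truncation of \<open>adjop T g\<close> to a finite set and
  \<open>l\<close> its norm. Then \<open>vinner (T h) g\<close> equals \<open>l^2\<close>, while
  Cauchy-Schwarz bounds it by \<open>C * l * vnorm g\<close>; cancelling \<open>l\<close> gives a
  bound independent of the finite set.\<close>

lemma adjop_bop:
  assumes T: "T \<in> bop"
  shows "adjop T \<in> bop"
proof -
  obtain C where C: "C \<ge> 0" "\<And>f. f \<in> ell2 \<Longrightarrow> vnorm (T f) \<le> C * vnorm f" using bop_bound T by blast
  have L2: "L2_set (\<lambda>i. cmod (adjop T g i)) S \<le> C * vnorm g" if g: "g \<in> ell2" and S: "finite S" for g S
  proof -
    define h where "h = (\<lambda>j. if j \<in> S then adjop T g j else 0)"
    define l where "l = L2_set (\<lambda>i. cmod (adjop T g i)) S"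
    have h: "h \<in> ell2" "vnorm h = l"
      unfolding h_def l_def by (rule finite_support_ell2[OF S], rule vnorm_finite_support[OF S])
    have "vinner (T h) g = (\<Sum>i\<in>S. cnj (adjop T g i) * adjop T g i)"
      unfolding h_def by (subst vinner_bop_finite_support[OF T g S]) (simp add: adjop_def g)
    also have "\<dots> = of_real (\<Sum>i\<in>S. (cmod (adjop T g i))\<^sup>2)"
      unfolding of_real_sum by (intro sum.cong refl) (metis complex_norm_square mult.commute)
    also have "(\<Sum>i\<in>S. (cmod (adjop T g i))\<^sup>2) = l\<^sup>2"
      unfolding l_def L2_set_def by (simp add: sum_nonneg)
    finally have "cmod (vinner (T h) g) = l\<^sup>2" by (simp add: norm_power)
    hence "l * l \<le> vnorm (T h) * vnorm g"
      using vinner_le[OF bop_mem'[OF T] g, of h] by (simp add: power2_eq_square)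
    also have "\<dots> \<le> C * l * vnorm g" using C(2)[OF h(1)] h(2) by (intro mult_right_mono) auto
    finally have le: "l * l \<le> l * (C * vnorm g)" by (simp add: algebra_simps)
    have "l \<ge> 0" unfolding l_def by simp
    show ?thesis
    proof (cases "l = 0")
      case True
      thus ?thesis using C(1) vnorm_nonneg[of g] unfolding l_def[symmetric] by simp
    next
      case False
      thus ?thesis using le \<open>l \<ge> 0\<close> unfolding l_def[symmetric] by (simp add: mult_le_cancel_left)
    qed
  qed
  show ?thesis
  proof (rule bopI[of _ C])
    fix f g :: "'a vec" and a b assume fg: "f \<in> ell2" "g \<in> ell2"
    show "adjop T (\<lambda>i. a * f i + b * g i) = (\<lambda>i. a * adjop T f i + b * adjop T g i)"
      using fg by (simp add: adjop_def ell2_lincomb vinner_add_right[OF bop_mem'[OF T] ell2_scale ell2_scale] vinner_scale_right)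
  next
    fix f :: "'a vec" assume f: "f \<in> ell2"
    show "adjop T f \<in> ell2" "vnorm (adjop T f) \<le> C * vnorm f"
      using ell2_boundI[OF L2[OF f]] by auto
  qed (simp add: adjop_def)
qed

text \<open>For finitely supported \<open>f\<close> the identity is linearity together with the
  definition of \<open>adjop\<close>. The general case follows by continuity, since the truncations
  \<open>fS S\<close> converge to \<open>f\<close> in norm along the finite subsets.\<close>

lemma vinner_adjop:
  assumes T: "T \<in> bop" and f: "f \<in> ell2" and g: "g \<in> ell2"
  shows "vinner (T f) g = vinner f (adjop T g)"
proof -
  define fS where "fS = (\<lambda>S j. if j \<in> S then f j else 0)"
  have fS: "fS S \<in> ell2" if "finite S" for S unfolding fS_def by (rule finite_support_ell2[OF that])
  let ?F = "finite_subsets_at_top (UNIV :: 'a set)"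
  have fin: "eventually finite ?F" by (rule eventually_finite_subsets_at_top_weakI) auto
  have sq: "(\<lambda>i. (cmod (f i))\<^sup>2) summable_on UNIV" using f by (simp add: ell2_def)
  have norm_eq: "vnorm (\<lambda>i. f i - fS S i) = sqrt ((\<Sum>\<^sub>\<infinity>i. (cmod (f i))\<^sup>2) - (\<Sum>i\<in>S. (cmod (f i))\<^sup>2))"
    if "finite S" for S
  proof -
    have "(\<Sum>\<^sub>\<infinity>i. (cmod (f i - fS S i))\<^sup>2) = (\<Sum>\<^sub>\<infinity>i\<in>UNIV - S. (cmod (f i))\<^sup>2)"
      by (intro infsum_cong_neutral) (auto simp: fS_def)
    also have "\<dots> = (\<Sum>\<^sub>\<infinity>i. (cmod (f i))\<^sup>2) - (\<Sum>\<^sub>\<infinity>i\<in>S. (cmod (f i))\<^sup>2)"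
      by (rule infsum_Diff[OF sq]) (use that in auto)
    finally show ?thesis using that by (simp add: vnorm_def)
  qed
  have "((\<lambda>S. sqrt ((\<Sum>\<^sub>\<infinity>i. (cmod (f i))\<^sup>2) - (\<Sum>i\<in>S. (cmod (f i))\<^sup>2))) \<longlongrightarrow>
      sqrt ((\<Sum>\<^sub>\<infinity>i. (cmod (f i))\<^sup>2) - (\<Sum>\<^sub>\<infinity>i. (cmod (f i))\<^sup>2))) ?F"
    by (intro tendsto_intros infsum_tendsto sq)
  hence "((\<lambda>S. sqrt ((\<Sum>\<^sub>\<infinity>i. (cmod (f i))\<^sup>2) - (\<Sum>i\<in>S. (cmod (f i))\<^sup>2))) \<longlongrightarrow> 0) ?F" by simp
  hence lim0: "((\<lambda>S. vnorm (\<lambda>i. f i - fS S i)) \<longlongrightarrow> 0) ?F"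
    by (rule Lim_transform_eventually) (use fin in eventually_elim, simp add: norm_eq)
  have "((\<lambda>S. vinner (T (fS S)) g) \<longlongrightarrow> vinner f (adjop T g)) ?F"
  proof (rule Lim_transform_eventually)
    show "((\<lambda>S. \<Sum>i\<in>S. cnj (f i) * adjop T g i) \<longlongrightarrow> vinner f (adjop T g)) ?F"
      unfolding vinner_def by (intro infsum_tendsto vinner_summable f bop_mem'[OF adjop_bop[OF T]])
    show "\<forall>\<^sub>F S in ?F. (\<Sum>i\<in>S. cnj (f i) * adjop T g i) = vinner (T (fS S)) g"
      using fin by eventually_elim (simp add: fS_def vinner_bop_finite_support[OF T g] adjop_def g)
  qed
  moreover have "((\<lambda>S. vinner (T (fS S)) g) \<longlongrightarrow> vinner (T f) g) ?F"
  proof -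
    have "((\<lambda>S. vinner (T (fS S)) g - vinner (T f) g) \<longlongrightarrow> 0) ?F"
    proof (rule Lim_null_comparison)
      show "((\<lambda>S. opnorm T * vnorm (\<lambda>i. f i - fS S i) * vnorm g) \<longlongrightarrow> 0) ?F"
        using tendsto_mult_left_zero[OF tendsto_mult_right_zero[OF lim0]] .
      show "\<forall>\<^sub>F S in ?F. norm (vinner (T (fS S)) g - vinner (T f) g) \<le> opnorm T * vnorm (\<lambda>i. f i - fS S i) * vnorm g"
        using fin
      proof eventually_elim
        case (elim S)
        have d: "(\<lambda>i. f i - fS S i) \<in> ell2" by (intro ell2_diff f fS elim)
        have "T f = T (\<lambda>i. (f i - fS S i) + fS S i)" by simp
        also have "\<dots> = (\<lambda>i. T (\<lambda>i. f i - fS S i) i + T (fS S) i)" by (rule bop_add[OF T d fS[OF elim]])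
        finally have "vinner (T f) g = vinner (T (\<lambda>i. f i - fS S i)) g + vinner (T (fS S)) g"
          using vinner_add_left[OF g bop_mem'[OF T] bop_mem'[OF T]] by metis
        hence "norm (vinner (T (fS S)) g - vinner (T f) g) = norm (vinner (T (\<lambda>i. f i - fS S i)) g)"
          by (simp add: norm_minus_commute)
        also have "\<dots> \<le> vnorm (T (\<lambda>i. f i - fS S i)) * vnorm g" by (rule vinner_le[OF bop_mem'[OF T] g])
        also have "\<dots> \<le> opnorm T * vnorm (\<lambda>i. f i - fS S i) * vnorm g"
          by (intro mult_right_mono bop_opnorm[OF T d]) auto
        finally show ?case .
      qed
    qed
    thus ?thesis by (simp add: LIM_zero_iff)
  qed
  ultimately show ?thesis
    using tendsto_unique[OF finite_subsets_at_top_neq_bot] by blast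
qed

lift_definition adj :: "'i bo \<Rightarrow> 'i bo" is adjop by (rule adjop_bop)

lemma vinner_adj: "f \<in> ell2 \<Longrightarrow> g \<in> ell2 \<Longrightarrow> vinner (Rep_bo x f) g = vinner f (Rep_bo (adj x) g)"
  unfolding adj.rep_eq by (rule vinner_adjop[OF Rep_bo])

text \<open>Supplies the uniqueness demanded by the \<open>THE\<close> in \<open>op_adj\<close>:
  test vectors \<open>evec i\<close> determine the values on \<open>ell2\<close>, and
  \<open>bop\<close> fixes them outside.\<close>

lemma op_adj_unique:
  assumes "S \<in> bop" "S' \<in> bop"
    and "\<And>f g. f \<in> ell2 \<Longrightarrow> g \<in> ell2 \<Longrightarrow> vinner f (S g) = vinner f (S' g)"
  shows "S = S'"
proof
  fix g show "S g = S' g"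
  proof (cases "g \<in> ell2")
    case True
    show ?thesis
    proof
      fix i show "S g i = S' g i" using assms(3)[OF evec_ell2 True, of i] by (simp add: vinner_evec)
    qed
  qed (simp add: bop_out[OF assms(1)] bop_out[OF assms(2)])
qed

lemma op_adj_Rep: "op_adj (Rep_bo x) = Rep_bo (adj x)"
  unfolding op_adj_def
proof (rule the_equality)
  show "Rep_bo (adj x) \<in> bop \<and> (\<forall>f\<in>ell2. \<forall>g\<in>ell2. vinner (Rep_bo x f) g = vinner f (Rep_bo (adj x) g))"
    using Rep_bo vinner_adj by blast
next
  fix S assume S: "S \<in> bop \<and> (\<forall>f\<in>ell2. \<forall>g\<in>ell2. vinner (Rep_bo x f) g = vinner f (S g))"
  show "S = Rep_bo (adj x)"
  proof (rule op_adj_unique)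
    show "S \<in> bop" using S by blast
    show "vinner f (S g) = vinner f (Rep_bo (adj x) g)" if "f \<in> ell2" "g \<in> ell2" for f g
      using S that vinner_adj[of f g x] by metis
  qed (rule Rep_bo)
qed

lemma adj_eqI:
  assumes "\<And>f g. f \<in> ell2 \<Longrightarrow> g \<in> ell2 \<Longrightarrow> vinner (Rep_bo x f) g = vinner f (Rep_bo y g)"
  shows "adj x = y"
proof -
  have "Rep_bo (adj x) = Rep_bo y"
    by (rule op_adj_unique[OF Rep_bo Rep_bo]) (metis assms vinner_adj)
  thus ?thesis by (simp add: Rep_bo_inject)
qed

lemmas Rep_ell2 = bop_mem'[OF Rep_bo]

lemma Rep_mult: "Rep_bo (x * y) f = Rep_bo x (Rep_bo y f)"
  by (simp add: times_bo.rep_eq)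

lemma Rep_plus: "Rep_bo (x + y) f = (\<lambda>i. Rep_bo x f i + Rep_bo y f i)"
  by (simp add: plus_bo.rep_eq op_add_def)

lemma Rep_diff: "Rep_bo (x - y) f = (\<lambda>i. Rep_bo x f i - Rep_bo y f i)"
  by (simp add: minus_bo.rep_eq op_add_def op_scale_def)

lemma Rep_cs: "f \<in> ell2 \<Longrightarrow> Rep_bo (cs c) f = (\<lambda>i. c * f i)"
  by (simp add: cs.rep_eq op_scale_def op_one_def)

lemma adj_adj [simp]: "adj (adj x) = x"
  by (rule adj_eqI) (metis Rep_ell2 vinner_adj vinner_cnj)

lemma adj_mult [simp]: "adj (x * y) = adj y * adj x"
  by (rule adj_eqI) (simp add: Rep_mult vinner_adj Rep_ell2)

lemma adj_add [simp]: "adj (x + y) = adj x + adj y"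
  by (rule adj_eqI) (simp add: Rep_plus vinner_add_left vinner_add_right vinner_adj Rep_ell2)

lemma adj_cs [simp]: "adj (cs c) = cs (cnj c)"
  by (rule adj_eqI) (simp add: Rep_cs vinner_scale_left vinner_scale_right)

lemma adj_1 [simp]: "adj 1 = 1"
  using adj_cs[of 1] by simp

lemma adj_0 [simp]: "adj 0 = 0"
  using adj_cs[of 0] by simp

lemma adj_uminus [simp]: "adj (- x) = - adj x"
  using adj_mult[of "cs (-1)" x] unfolding adj_cs by (simp add: cs_uminus)

lemma adj_diff [simp]: "adj (x - y) = adj x - adj y"
  using adj_add[of x "- y"] by simp

lemma adj_power [simp]: "adj (x ^ n) = adj x ^ n"
  by (induct n) (auto simp: power_commutes)

lemma vinner_adj_mult_self: "f \<in> ell2 \<Longrightarrow> vinner f (Rep_bo (adj x * x) f) = of_real ((vnorm (Rep_bo x f))\<^sup>2)"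
  unfolding Rep_mult by (subst vinner_adj[symmetric]) (simp_all add: Rep_ell2 vinner_self)

text \<open>Cauchy-Schwarz applied to \<open>vinner f (x* x f) = (vnorm (x f))^2\<close>. This half
  of the C*-identity already implies that \<open>adj\<close> is isometric.\<close>

lemma norm_adj_mult_self: "(norm x)\<^sup>2 \<le> norm (adj x * x)"
proof -
  have "norm x \<le> sqrt (norm (adj x * x))"
  proof (rule norm_bo_le)
    fix f :: "'a vec" assume f: "f \<in> ell2"
    have "(vnorm (Rep_bo x f))\<^sup>2 = cmod (vinner f (Rep_bo (adj x * x) f))"
      unfolding vinner_adj_mult_self[OF f] norm_of_real by simp
    also have "\<dots> \<le> vnorm f * vnorm (Rep_bo (adj x * x) f)" by (rule vinner_le[OF f Rep_ell2])
    also have "\<dots> \<le> vnorm f * (norm (adj x * x) * vnorm f)" by (intro mult_left_mono norm_bo_bound f) auto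
    also have "\<dots> = (sqrt (norm (adj x * x)) * vnorm f)\<^sup>2"
      by (simp add: power_mult_distrib) (simp add: power2_eq_square)
    finally show "vnorm (Rep_bo x f) \<le> sqrt (norm (adj x * x)) * vnorm f"
      by (rule power2_le_imp_le) auto
  qed auto
  hence "(norm x)\<^sup>2 \<le> (sqrt (norm (adj x * x)))\<^sup>2" by (intro power_mono) auto
  thus ?thesis by simp
qed

lemma norm_adj [simp]: "norm (adj x) = norm x"
proof -
  have le: "norm x \<le> norm (adj x)" for x :: "'a bo"
  proof (cases "norm x = 0")
    case False
    have "norm x * norm x \<le> norm (adj x) * norm x"
      using norm_adj_mult_self[of x] norm_mult_ineq[of "adj x" x] by (simp add: power2_eq_square)
    thus ?thesis by (rule mult_right_le_imp_le) (use False in simp)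
  qed simp
  show ?thesis using le[of x] le[of "adj x"] by simp
qed

lemma adj_mult_self_eq_0: "adj x * x = 0 \<Longrightarrow> x = 0"
  using norm_adj_mult_self[of x] by simp

lemma bounded_linear_adj: "bounded_linear adj"
proof (rule bounded_linear_intro[of _ 1])
  show "adj (r *\<^sub>R x) = r *\<^sub>R adj x" for r and x :: "'a bo"
    by (simp add: scaleR_cs cs_commute)
qed auto

text \<open>This places the argument of the binomial series in the closed unit ball without spectral
  theory. With \<open>N = norm (x* x)\<close>, \<open>c = 1/N\<close> and \<open>g = x* x f\<close>,
  the expansion of the squared norm of \<open>f - c g\<close> is
  \<open>|f|^2 - 2 c |x f|^2 + c^2 |g|^2\<close>. Since \<open>|g|^2 <= N |x f|^2\<close>, the last
  term is at most \<open>c |x f|^2\<close>.\<close>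

lemma norm_one_minus_normalized_le:
  assumes "x \<noteq> 0"
  shows "norm (1 - cs (of_real (inverse (norm (adj x * x)))) * (adj x * x)) \<le> 1"
proof (rule norm_bo_le)
  define N where "N = norm (adj x * x)"
  have N: "N > 0" using adj_mult_self_eq_0 assms unfolding N_def by auto
  fix f :: "'a vec" assume f: "f \<in> ell2"
  define g where "g = Rep_bo (adj x * x) f"
  have g: "g \<in> ell2" unfolding g_def by (rule Rep_ell2)
  have fg: "vinner f g = of_real ((vnorm (Rep_bo x f))\<^sup>2)" unfolding g_def by (rule vinner_adj_mult_self[OF f])
  define c where "c = inverse N"
  have "vnorm g \<le> norm (adj x) * vnorm (Rep_bo x f)" unfolding g_def Rep_mult by (rule norm_bo_bound[OF Rep_ell2])
  hence "(vnorm g)\<^sup>2 \<le> (norm x)\<^sup>2 * (vnorm (Rep_bo x f))\<^sup>2"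
    unfolding power_mult_distrib[symmetric] by (intro power_mono) auto
  also have "\<dots> \<le> N * (vnorm (Rep_bo x f))\<^sup>2"
    unfolding N_def by (intro mult_right_mono norm_adj_mult_self) auto
  finally have g2: "(vnorm g)\<^sup>2 \<le> N * (vnorm (Rep_bo x f))\<^sup>2" .
  have h: "Rep_bo (1 - cs (of_real c) * (adj x * x)) f = (\<lambda>i. f i - of_real c * g i)"
    unfolding g_def Rep_diff Rep_cs_mult op_scale_def one_bo.rep_eq using f by (simp add: op_one_def)
  have cg: "(\<lambda>i. of_real c * g i) \<in> ell2" by (rule ell2_scale[OF g])
  have "of_real ((vnorm (\<lambda>i. f i - of_real c * g i))\<^sup>2) =
      vinner (\<lambda>i. f i - of_real c * g i) (\<lambda>i. f i - of_real c * g i)" by (rule vinner_self[OF ell2_diff[OF f cg], symmetric])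
  also have "\<dots> = vinner (\<lambda>i. f i - of_real c * g i) f - of_real c * vinner (\<lambda>i. f i - of_real c * g i) g"
    by (simp add: vinner_diff_right[OF ell2_diff[OF f cg] f cg] vinner_scale_right)
  also have "vinner (\<lambda>i. f i - of_real c * g i) f = cnj (vinner f f - of_real c * vinner f g)"
    by (subst vinner_cnj[symmetric]) (simp add: vinner_diff_right[OF f f cg] vinner_scale_right)
  also have "vinner (\<lambda>i. f i - of_real c * g i) g = cnj (vinner g f - of_real c * vinner g g)"
    by (subst vinner_cnj[symmetric]) (simp add: vinner_diff_right[OF g f cg] vinner_scale_right)
  also have "vinner g f = cnj (vinner f g)" by (simp add: vinner_cnj)
  finally have "of_real ((vnorm (\<lambda>i. f i - of_real c * g i))\<^sup>2) =
      (of_real ((vnorm f)\<^sup>2 - 2 * c * (vnorm (Rep_bo x f))\<^sup>2 + c\<^sup>2 * (vnorm g)\<^sup>2) :: complex)"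
    unfolding fg vinner_self[OF f] vinner_self[OF g] by (simp add: algebra_simps power2_eq_square)
  hence "(vnorm (\<lambda>i. f i - of_real c * g i))\<^sup>2 = (vnorm f)\<^sup>2 - 2 * c * (vnorm (Rep_bo x f))\<^sup>2 + c\<^sup>2 * (vnorm g)\<^sup>2"
    by (simp only: of_real_eq_iff)
  also have "c\<^sup>2 * (vnorm g)\<^sup>2 \<le> c\<^sup>2 * (N * (vnorm (Rep_bo x f))\<^sup>2)" by (intro mult_left_mono g2) auto
  also have "\<dots> = c * (vnorm (Rep_bo x f))\<^sup>2" using N by (simp add: c_def power2_eq_square)
  also have "(vnorm f)\<^sup>2 - 2 * c * (vnorm (Rep_bo x f))\<^sup>2 + c * (vnorm (Rep_bo x f))\<^sup>2 \<le> (vnorm f)\<^sup>2"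
    using N by (simp add: c_def)
  finally have "(vnorm (\<lambda>i. f i - of_real c * g i))\<^sup>2 \<le> (vnorm f)\<^sup>2" by simp
  hence "vnorm (\<lambda>i. f i - of_real c * g i) \<le> vnorm f" by (rule power2_le_imp_le) auto
  thus "vnorm (Rep_bo (1 - cs (of_real (inverse (norm (adj x * x)))) * (adj x * x)) f) \<le> 1 * vnorm f"
    by (simp only: N_def[symmetric] c_def[symmetric] h mult_1)
qed simp

lemma op_pos_adj_mult_self: "op_pos (Rep_bo (adj x * x))"
  unfolding op_pos_def using Rep_bo[of "adj x * x"] by (simp add: vinner_adj_mult_self)

text \<open>Holds because \<open>vnorm (s v f) <= norm s * vnorm (v f)\<close> for every vector
  \<open>f\<close>. Under a positive trace it lets a factor \<open>s\<close> be pulled out as its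
  operator norm.\<close>

lemma op_pos_contraction:
  "op_pos (Rep_bo (cs (of_real ((norm s)\<^sup>2)) * (adj v * v) - adj v * adj s * s * v))"
  unfolding op_pos_def
proof (intro conjI ballI)
  let ?y = "cs (of_real ((norm s)\<^sup>2)) * (adj v * v) - adj v * adj s * s * v"
  fix f :: "'a vec" assume f: "f \<in> ell2"
  have eq: "adj v * adj s * s * v = adj (s * v) * (s * v)" by (simp add: mult.assoc)
  have "vinner f (Rep_bo ?y f) =
      of_real ((norm s)\<^sup>2 * (vnorm (Rep_bo v f))\<^sup>2 - (vnorm (Rep_bo s (Rep_bo v f)))\<^sup>2)"
    unfolding eq Rep_diff
    by (subst vinner_diff_right[OF f Rep_ell2 Rep_ell2])
       (simp only: Rep_cs_mult op_scale_def vinner_scale_right vinner_adj_mult_self[OF f] of_real_diff of_real_mult,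
         simp only: Rep_mult)
  moreover have "(vnorm (Rep_bo s (Rep_bo v f)))\<^sup>2 \<le> (norm s)\<^sup>2 * (vnorm (Rep_bo v f))\<^sup>2"
    unfolding power_mult_distrib[symmetric] by (intro power_mono norm_bo_bound Rep_ell2) auto
  ultimately show "Im (vinner f (Rep_bo ?y f)) = 0" "0 \<le> Re (vinner f (Rep_bo ?y f))" by auto
qed (rule Rep_bo)

section \<open>Traces\<close>

text \<open>A norm-closed unital *-algebra with a positive tracial functional. Closedness keeps the
  sums of power series inside \<open>M\<close>. Positivity is recorded in the forms in which it is
  applied: on elements \<open>adj x * x\<close> and as the inequality
  \<open>t_contraction\<close>.\<close>

locale vn_trace =
  fixes M :: "'i bo set" and t :: "'i bo \<Rightarrow> complex"
  assumes cs_mem: "cs c \<in> M"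
    and add_mem: "x \<in> M \<Longrightarrow> y \<in> M \<Longrightarrow> x + y \<in> M"
    and mult_mem: "x \<in> M \<Longrightarrow> y \<in> M \<Longrightarrow> x * y \<in> M"
    and adj_mem: "x \<in> M \<Longrightarrow> adj x \<in> M"
    and closed_M: "closed M"
    and t_add: "x \<in> M \<Longrightarrow> y \<in> M \<Longrightarrow> t (x + y) = t x + t y"
    and t_cs: "x \<in> M \<Longrightarrow> t (cs c * x) = c * t x"
    and t_comm: "x \<in> M \<Longrightarrow> y \<in> M \<Longrightarrow> t (x * y) = t (y * x)"
    and t_Im: "x \<in> M \<Longrightarrow> Im (t (adj x * x)) = 0"
    and t_nonneg: "x \<in> M \<Longrightarrow> 0 \<le> Re (t (adj x * x))"
    and t_contraction: "v \<in> M \<Longrightarrow> s \<in> M \<Longrightarrow> Re (t (adj v * adj s * s * v)) \<le> (norm s)\<^sup>2 * Re (t (adj v * v))"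

text \<open>The double commutant property, with \<open>C\<close> the commutant of \<open>A\<close>.
  Membership becomes a family of continuous linear equations in \<open>x\<close>, from which
  scalars, sums, products and norm closure can be read off.\<close>

lemma von_neumann_algebra_commutant:
  assumes "von_neumann_algebra A"
  obtains C where "{x. Rep_bo x \<in> A} = {x. \<forall>y\<in>C. x * y = y * x}"
proof
  define C where "C = {y. Rep_bo y \<in> commutant A}"
  have A: "commutant (commutant A) = A" and "A \<subseteq> bop" using assms by (auto simp: von_neumann_algebra_def)
  have "Rep_bo x \<in> commutant (commutant A) \<longleftrightarrow> (\<forall>y\<in>C. x * y = y * x)" for x
  proof -
    have "Rep_bo x \<in> commutant (commutant A) \<longleftrightarrow> (\<forall>B\<in>commutant A. Rep_bo x \<circ> B = B \<circ> Rep_bo x)"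
      unfolding commutant_def[of "commutant A"] using Rep_bo by blast
    also have "\<dots> \<longleftrightarrow> (\<forall>y\<in>C. Rep_bo x \<circ> Rep_bo y = Rep_bo y \<circ> Rep_bo x)"
    proof -
      have "commutant A \<subseteq> bop" by (auto simp: commutant_def)
      hence "commutant A = Rep_bo ` C" unfolding C_def
        by (auto simp: image_iff) (metis Abs_bo_inverse subset_iff)
      thus ?thesis by auto
    qed
    finally show ?thesis by (simp add: bo_eq times_bo.rep_eq)
  qed
  thus "{x. Rep_bo x \<in> A} = {x. \<forall>y\<in>C. x * y = y * x}" using A by auto
qed

lemma vn_trace_of_trace_on:
  fixes A :: "'i op set"
  assumes vn: "von_neumann_algebra A" and tr: "trace_on A t"
  shows "vn_trace {x. Rep_bo x \<in> A} (\<lambda>x. t (Rep_bo x))"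
proof -
  obtain C where C: "{x. Rep_bo x \<in> A} = {x. \<forall>y\<in>C. x * y = y * x}"
    using von_neumann_algebra_commutant[OF vn] by blast
  have mem: "Rep_bo x \<in> A \<longleftrightarrow> (\<forall>y\<in>C. x * y = y * x)" for x using C by blast
  have adjA: "\<forall>x\<in>A. op_adj x \<in> A"
    using vn unfolding von_neumann_algebra_def by (elim conjE)
  note c1 = tr[unfolded trace_on_def]
  note c2 = conjunct2[OF c1] and c3 = conjunct2[OF conjunct2[OF c1]]
    and c4 = conjunct2[OF conjunct2[OF conjunct2[OF c1]]]
  have tr_add: "\<forall>x\<in>A. \<forall>y\<in>A. t (op_add x y) = t x + t y"
    and tr_scale: "\<forall>x\<in>A. \<forall>c. t (op_scale c x) = c * t x"
    and tr_pos: "\<forall>x\<in>A. op_pos x \<longrightarrow> Im (t x) = 0 \<and> Re (t x) \<ge> 0"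
    and tr_comm: "\<forall>x\<in>A. \<forall>y\<in>A. t (x \<circ> y) = t (y \<circ> x)"
    by (rule conjunct1[OF c1] conjunct1[OF c2] conjunct1[OF c3] conjunct1[OF c4])+
  have 1: "Rep_bo (cs c) \<in> A" for c by (simp add: mem cs_commute)
  have 2: "Rep_bo (x + y) \<in> A" if "Rep_bo x \<in> A" "Rep_bo y \<in> A" for x y
    using that by (simp add: mem algebra_simps)
  have 3: "Rep_bo (x * y) \<in> A" if xy: "Rep_bo x \<in> A" "Rep_bo y \<in> A" for x y
    unfolding mem
  proof
    fix z assume z: "z \<in> C"
    have "x * y * z = x * (z * y)" using xy(2) z by (simp add: mem mult.assoc)
    also have "\<dots> = z * x * y" using xy(1) z by (simp add: mem mult.assoc[symmetric])
    finally show "x * y * z = z * (x * y)" by (simp add: mult.assoc)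
  qed
  have 4: "Rep_bo (adj x) \<in> A" if "Rep_bo x \<in> A" for x
    using adjA that by (metis op_adj_Rep)
  have pos: "Im (t (Rep_bo x)) = 0 \<and> Re (t (Rep_bo x)) \<ge> 0" if "Rep_bo x \<in> A" "op_pos (Rep_bo x)" for x
    using tr_pos that by blast
  have t_add: "t (Rep_bo (x + y)) = t (Rep_bo x) + t (Rep_bo y)" if "Rep_bo x \<in> A" "Rep_bo y \<in> A" for x y
    using tr_add that unfolding plus_bo.rep_eq by blast
  have t_cs: "t (Rep_bo (cs c * x)) = c * t (Rep_bo x)" if "Rep_bo x \<in> A" for c x
    using tr_scale that unfolding Rep_cs_mult by blast
  show ?thesis
  proof
    show "closed {x. Rep_bo x \<in> A}"
    proof -
      have "{x. Rep_bo x \<in> A} = (\<Inter>y\<in>C. {x. x * y = y * x})" unfolding C by auto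
      moreover have "closed {x. x * y = y * x}" for y :: "'i bo"
        by (intro closed_Collect_eq continuous_intros)
      ultimately show ?thesis by auto
    qed
    show "t (Rep_bo (x * y)) = t (Rep_bo (y * x))" if "x \<in> {x. Rep_bo x \<in> A}" "y \<in> {x. Rep_bo x \<in> A}" for x y
      using tr_comm that unfolding times_bo.rep_eq by blast
    show "Im (t (Rep_bo (adj x * x))) = 0" "0 \<le> Re (t (Rep_bo (adj x * x)))" if "x \<in> {x. Rep_bo x \<in> A}" for x
      using pos[OF 3[OF 4] op_pos_adj_mult_self] that by auto
    show "Re (t (Rep_bo (adj v * adj s * s * v))) \<le> (norm s)\<^sup>2 * Re (t (Rep_bo (adj v * v)))"
      if "v \<in> {x. Rep_bo x \<in> A}" "s \<in> {x. Rep_bo x \<in> A}" for v s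
    proof -
      let ?a = "cs (of_real ((norm s)\<^sup>2)) * (adj v * v)" and ?b = "adj v * adj s * s * v"
      have v: "Rep_bo v \<in> A" and s: "Rep_bo s \<in> A" using that by auto
      have a: "Rep_bo ?a \<in> A" and b: "Rep_bo ?b \<in> A" by (intro 1 3 4 v s)+
      have eq: "?a - ?b = ?a + cs (-1) * ?b" by (simp add: cs_uminus)
      have "Rep_bo (?a - ?b) \<in> A" unfolding eq by (intro 1 2 3 a b)
      from pos[OF this op_pos_contraction] have "0 \<le> Re (t (Rep_bo (?a - ?b)))" by blast
      also have "t (Rep_bo (?a - ?b)) = of_real ((norm s)\<^sup>2) * t (Rep_bo (adj v * v)) - t (Rep_bo ?b)"
        unfolding eq t_add[OF a 3[OF 1 b]] t_cs[OF b] t_cs[OF 3[OF 4[OF v] v]] by simp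
      finally show ?thesis by simp
    qed
  qed (use 1 2 3 4 t_add t_cs in auto)
qed

section \<open>Binomial series\<close>

text \<open>The coefficient of \<open>T^n\<close> in \<open>(1 - T)^s\<close>. The Pochhammer form
  absorbs the signs and is visibly a polynomial in \<open>s\<close>.\<close>

definition gcoef :: "complex \<Rightarrow> nat \<Rightarrow> complex" where
  "gcoef s n = pochhammer (- s) n / fact n"

lemma gbinomial_minus_one_power:
  fixes a :: "'a :: field_char_0"
  shows "(a gchoose n) * (-1) ^ n = pochhammer (- a) n / fact n"
  unfolding gbinomial_pochhammer by (simp flip: power_add power_mult_distrib add: algebra_simps)

lemma gcoef_eq_gbinomial: "gcoef s n = (s gchoose n) * (-1) ^ n"
  by (simp only: gcoef_def gbinomial_minus_one_power)

lemma gcoef_of_real: "gcoef (of_real s) n = of_real ((s gchoose n) * (-1) ^ n)"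
  unfolding gcoef_def gbinomial_minus_one_power by (simp flip: of_real_minus pochhammer_of_real)

text \<open>Vandermonde's convolution. It is the coefficient form of the law
  \<open>(1 - T)^(s + s') = (1 - T)^s (1 - T)^s'\<close>.\<close>

lemma gcoef_add: "gcoef (s + s') k = (\<Sum>i\<le>k. gcoef s i * gcoef s' (k - i))"
proof -
  have "gcoef (s + s') k = (\<Sum>i\<le>k. (s gchoose i) * (s' gchoose (k - i))) * (-1) ^ k"
    unfolding gcoef_eq_gbinomial gbinomial_Vandermonde[of s s' k, symmetric] by (simp add: atMost_atLeast0)
  also have "\<dots> = (\<Sum>i\<le>k. gcoef s i * gcoef s' (k - i))"
    unfolding sum_distrib_right gcoef_eq_gbinomial
  proof (intro sum.cong refl)
    fix i assume "i \<in> {..k}"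
    hence "(-1 :: complex) ^ k = (-1) ^ i * (-1) ^ (k - i)" by (simp flip: power_add)
    thus "(s gchoose i) * (s' gchoose (k - i)) * (-1) ^ k = (s gchoose i) * (-1) ^ i * ((s' gchoose (k - i)) * (-1) ^ (k - i))"
      by simp
  qed
  finally show ?thesis .
qed

lemma gcoef_0: "gcoef 0 n = (if n = 0 then 1 else 0)"
  by (cases n) (simp_all add: gcoef_def pochhammer_rec)

lemma gcoef_1: "gcoef 1 n = (if n = 0 then 1 else if n = 1 then -1 else 0)"
proof (cases "n \<ge> 2")
  case True
  then obtain m where "n = Suc (Suc m)" by (metis Suc_le_D numeral_2_eq_2 Suc_le_mono)
  thus ?thesis by (simp add: gcoef_def pochhammer_rec)
next
  case False
  hence "n = 0 \<or> n = 1" by auto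
  thus ?thesis by (auto simp: gcoef_def)
qed

lemma cnj_gcoef: "cnj (gcoef s n) = gcoef (cnj s) n"
  by (simp add: gcoef_def)

lemma gcoef_holomorphic: "(\<lambda>z. gcoef z n) holomorphic_on UNIV"
  unfolding gcoef_def pochhammer_prod by (intro holomorphic_intros) auto

text \<open>Each factor of the Pochhammer product satisfies \<open>|j - s| <= R + j\<close>. The
  bound is the n-th coefficient of \<open>(1 - t)^(-R)\<close>, so it is uniform over the disc of
  radius \<open>R\<close> and its power series converges for \<open>|t| < 1\<close>.\<close>

lemma cmod_gcoef_le:
  assumes "cmod s \<le> R"
  shows "cmod (gcoef s n) \<le> pochhammer R n / fact n"
proof -
  have "cmod (pochhammer (- s) n) \<le> pochhammer R n"
  proof (induct n)
    case (Suc n)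
    have "cmod (- s + of_nat n) \<le> R + of_nat n"
      using norm_triangle_ineq[of "- s" "of_nat n"] assms by simp
    thus ?case unfolding pochhammer_Suc norm_mult using Suc by (intro mult_mono) (auto intro: order_trans[OF norm_ge_zero])
  qed simp
  thus ?thesis by (simp add: gcoef_def norm_divide divide_right_mono)
qed

lemma summable_pochhammer_power:
  fixes R r :: real
  assumes "0 \<le> r" "r < 1"
  shows "summable (\<lambda>n. pochhammer R n / fact n * r ^ n)"
proof -
  have "summable (\<lambda>n. (- R gchoose n) * (- r) ^ n)"
    using gen_binomial_real[of "- r" "- R"] assms by (auto simp: sums_iff)
  moreover have "(- R gchoose n) * (- r) ^ n = pochhammer R n / fact n * r ^ n" for n
    unfolding gbinomial_pochhammer power_minus[of r n] by (simp flip: power_add mult.assoc)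
  ultimately show ?thesis by simp
qed

text \<open>With \<open>g n = \<bar>gcoef s n\<bar>\<close> one has \<open>n * g n - (n + 1) * g (n + 1) = s * g n\<close> for \<open>n \<ge> s\<close>,
  so the series telescopes.\<close>

lemma summable_gcoef:
  fixes s :: real
  assumes s: "s > 0"
  shows "summable (\<lambda>n. cmod (gcoef (of_real s) n))"
proof -
  define g where "g = (\<lambda>n. cmod (gcoef (of_real s) n))"
  define N where "N = nat \<lceil>s\<rceil>"
  have N: "real N \<ge> s" unfolding N_def by linarith
  have step: "real (Suc n) * g (Suc n) = (real n - s) * g n" if "n \<ge> N" for n
  proof -
    have "gcoef (of_real s) (Suc n) = gcoef (of_real s) n * of_real ((real n - s) / real (Suc n))"
      unfolding gcoef_def pochhammer_Suc by (simp add: field_simps)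
    hence "g (Suc n) = g n * \<bar>(real n - s) / real (Suc n)\<bar>" unfolding g_def by (simp only: norm_mult norm_of_real)
    also have "\<dots> = g n * ((real n - s) / real (Suc n))" using that N by (intro arg_cong2[where f="(*)"] refl abs_of_nonneg divide_nonneg_pos) auto
    finally show ?thesis by (simp add: field_simps del: of_nat_Suc)
  qed
  have tel: "s * (\<Sum>n<m. g (n + N)) = real N * g N - real (m + N) * g (m + N)" for m
  proof (induct m)
    case (Suc m)
    have "s * (\<Sum>n<Suc m. g (n + N)) = real N * g N - real (m + N) * g (m + N) + s * g (m + N)"
      using Suc by (simp add: algebra_simps)
    also have "\<dots> = real N * g N - (real (m + N) - s) * g (m + N)" by (simp add: algebra_simps)
    also have "(real (m + N) - s) * g (m + N) = real (Suc (m + N)) * g (Suc (m + N))" by (rule step[symmetric]) simp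
    finally show ?case by simp
  qed simp
  have "summable (\<lambda>n. g (n + N))"
  proof (rule summableI_nonneg_bounded)
    show "0 \<le> g (n + N)" for n by (simp add: g_def)
    fix m
    have "s * (\<Sum>n<m. g (n + N)) \<le> real N * g N" unfolding tel by (simp add: g_def)
    thus "(\<Sum>n<m. g (n + N)) \<le> real N * g N / s" using s by (simp add: field_simps)
  qed
  thus ?thesis unfolding g_def by (simp add: summable_iff_shift[of "\<lambda>n. cmod (gcoef (of_real s) n)"])
qed

text \<open>The power \<open>(1 - T)^s\<close>; it is a genuine limit only under one of the
  summability conditions proved below.\<close>

definition binser :: "complex \<Rightarrow> 'i bo \<Rightarrow> 'i bo" where
  "binser s T = (\<Sum>n. cs (gcoef s n) * T ^ n)"

lemma norm_cs_mult_power_le: "norm (cs c * T ^ n) \<le> cmod c * norm T ^ n"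
  unfolding norm_cs_mult by (intro mult_left_mono norm_power_ineq) auto

lemma cs_mult_cs: "(cs a * x) * (cs b * y) = cs (a * b) * (x * y)"
proof -
  have "(cs a * x) * (cs b * y) = cs a * (x * (cs b * y))" by (rule mult.assoc)
  also have "\<dots> = cs a * (cs b * (x * y))" by (simp only: cs_left_commute[of x])
  finally show ?thesis by (simp only: cs_mult mult.assoc)
qed

lemma binser_add:
  assumes "summable (\<lambda>n. norm (cs (gcoef s n) * T ^ n))" "summable (\<lambda>n. norm (cs (gcoef s' n) * T ^ n))"
  shows "binser (s + s') T = binser s T * binser s' T"
proof -
  have "(\<Sum>i\<le>k. (cs (gcoef s i) * T ^ i) * (cs (gcoef s' (k - i)) * T ^ (k - i))) = cs (gcoef (s + s') k) * T ^ k" for k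
  proof -
    have "(cs (gcoef s i) * T ^ i) * (cs (gcoef s' (k - i)) * T ^ (k - i)) = cs (gcoef s i * gcoef s' (k - i)) * T ^ k"
      if "i \<le> k" for i
      using that by (simp add: cs_mult_cs flip: power_add)
    thus ?thesis by (simp add: gcoef_add cs_sum sum_distrib_right)
  qed
  thus ?thesis unfolding binser_def Cauchy_product[OF assms] by simp
qed

lemma binser_0: "binser 0 T = 1"
proof -
  have "binser 0 T = (\<Sum>n\<in>{0}. cs (gcoef 0 n) * T ^ n)"
    unfolding binser_def by (rule suminf_finite) (auto simp: gcoef_0)
  thus ?thesis by (simp add: gcoef_0)
qed

lemma binser_1: "binser 1 T = 1 - T"
proof -
  have "binser 1 T = (\<Sum>n\<in>{0,1}. cs (gcoef 1 n) * T ^ n)"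
    unfolding binser_def by (rule suminf_finite) (auto simp: gcoef_1)
  thus ?thesis by (simp add: gcoef_1 cs_uminus)
qed

lemma adj_binser:
  assumes "adj T = T" "summable (\<lambda>n. norm (cs (gcoef s n) * T ^ n))"
  shows "adj (binser s T) = binser (cnj s) T"
  unfolding binser_def bounded_linear.suminf[OF bounded_linear_adj summable_norm_cancel[OF assms(2)]]
  by (simp add: assms(1) cs_commute cnj_gcoef)

text \<open>The boundary case \<open>norm T = 1\<close> is included, at the price of
  \<open>s > 0\<close>. This is the range in which the unregularized powers \<open>rpow\<close>
  operate.\<close>

lemma summable_binser_of_real:
  assumes "s > 0" "norm T \<le> 1"
  shows "summable (\<lambda>n. norm (cs (gcoef (of_real s) n) * T ^ n))"
proof (rule summable_comparison_test'[OF summable_gcoef[OF assms(1)]])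
  fix n
  have "cmod (gcoef (of_real s) n) * norm T ^ n \<le> cmod (gcoef (of_real s) n) * 1"
    using assms(2) by (intro mult_left_mono power_le_one) auto
  thus "norm (norm (cs (gcoef (of_real s) n) * T ^ n)) \<le> cmod (gcoef (of_real s) n)"
    using norm_cs_mult_power_le[of "gcoef (of_real s) n" T n] by simp
qed

lemma norm_binser_term_le:
  assumes "cmod s \<le> R"
  shows "norm (cs (gcoef s n) * T ^ n) \<le> pochhammer R n / fact n * norm T ^ n"
  using norm_cs_mult_power_le[of "gcoef s n" T n] mult_right_mono[OF cmod_gcoef_le[OF assms, of n], of "norm T ^ n"]
  by simp

lemma summable_binser:
  assumes "norm T < 1"
  shows "summable (\<lambda>n. norm (cs (gcoef s n) * T ^ n))"
  by (rule summable_comparison_test'[OF summable_pochhammer_power[OF norm_ge_zero assms, of "cmod s"]])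
     (use norm_binser_term_le[OF order_refl] in simp)

section \<open>Real powers of \<open>x* x\<close> and their agreement with
  \<open>op_rpow\<close>\<close>

definition rpow :: "'i bo \<Rightarrow> real \<Rightarrow> 'i bo" where
  "rpow c s = (if c = 0 then 0 else cs (of_real (norm c powr s)) *
     binser (of_real s) (1 - cs (of_real (inverse (norm c))) * c))"

lemma op_power_Rep: "op_power (Rep_bo T) n = Rep_bo (T ^ n)"
  by (induct n) (simp_all add: one_bo.rep_eq times_bo.rep_eq)

lemma op_psum_Rep: "op_psum (\<lambda>n. Rep_bo (f n)) N = Rep_bo (\<Sum>n<N. f n)"
  by (induct N) (simp_all add: zero_bo.rep_eq plus_bo.rep_eq)

lemma op_lim_Rep:
  assumes "S \<longlonglongrightarrow> L"
  shows "op_lim (\<lambda>N. Rep_bo (S N)) = Rep_bo L"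
proof -
  have eq: "opnorm (op_add (Rep_bo x) (op_scale (-1) (Rep_bo y))) = norm (x - y)" for x y :: "'a bo"
    by (simp add: norm_bo.rep_eq minus_bo.rep_eq)
  show ?thesis unfolding op_lim_def
  proof (rule the_equality)
    show "Rep_bo L \<in> bop \<and> (\<lambda>N. opnorm (op_add (Rep_bo (S N)) (op_scale (-1) (Rep_bo L)))) \<longlonglongrightarrow> 0"
      unfolding eq using assms by (auto simp: Rep_bo tendsto_norm_zero_iff LIM_zero_iff)
  next
    fix L' assume *: "L' \<in> bop \<and> (\<lambda>N. opnorm (op_add (Rep_bo (S N)) (op_scale (-1) L'))) \<longlonglongrightarrow> 0"
    then obtain y where y: "L' = Rep_bo y" by (metis Abs_bo_inverse)
    have "S \<longlonglongrightarrow> y" using * unfolding y eq by (simp add: tendsto_norm_zero_iff LIM_zero_iff)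
    thus "L' = Rep_bo L" using LIMSEQ_unique[OF assms] y by simp
  qed
qed

text \<open>For \<open>s > 0\<close> and an argument in the closed unit ball the binomial series
  converges in norm, so the \<open>THE\<close> inside \<open>op_lim\<close> denotes its sum.\<close>

lemma op_rpow_Rep:
  assumes "s > 0" and T: "c \<noteq> 0 \<Longrightarrow> norm (1 - cs (of_real (inverse (norm c))) * c) \<le> 1"
  shows "op_rpow (Rep_bo c) s = Rep_bo (rpow c s)"
proof (cases "c = 0")
  case True
  thus ?thesis by (simp add: rpow_def op_rpow_def zero_bo.rep_eq)
next
  case False
  define T where "T = 1 - cs (of_real (inverse (norm c))) * c"
  have T_eq: "op_add op_one (op_scale (- of_real (inverse (opnorm (Rep_bo c)))) (Rep_bo c)) = Rep_bo T"
    unfolding T_def by (simp add: norm_bo.rep_eq minus_bo.rep_eq one_bo.rep_eq Rep_cs_mult) (simp add: op_scale_def)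
  have sum: "summable (\<lambda>n. cs (gcoef (of_real s) n) * T ^ n)"
    by (rule summable_norm_cancel[OF summable_binser_of_real[OF assms(1)]]) (unfold T_def, rule T[OF False])
  have "Rep_bo c \<noteq> op_zero" using False by (simp add: Rep_bo_inject flip: zero_bo.rep_eq)
  hence "op_rpow (Rep_bo c) s = op_scale (of_real (norm c powr s))
      (op_lim (op_psum (\<lambda>n. Rep_bo (cs (gcoef (of_real s) n) * T ^ n))))"
    unfolding op_rpow_def Let_def T_eq op_power_Rep Rep_cs_mult gcoef_of_real by (simp add: norm_bo.rep_eq)
  also have "op_psum (\<lambda>n. Rep_bo (cs (gcoef (of_real s) n) * T ^ n)) = (\<lambda>N. Rep_bo (\<Sum>n<N. cs (gcoef (of_real s) n) * T ^ n))"
    by (rule ext) (rule op_psum_Rep)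
  also have "op_lim \<dots> = Rep_bo (binser (of_real s) T)"
    unfolding binser_def by (rule op_lim_Rep[OF summable_LIMSEQ[OF sum]])
  finally show ?thesis using False by (simp add: rpow_def Rep_cs_mult T_def)
qed

context
  fixes x :: "'i bo" and c T :: "'i bo"
  assumes c_def: "c = adj x * x" and T_def: "T = 1 - cs (of_real (inverse (norm c))) * c"
begin

lemma adj_normalized: "adj T = T"
  unfolding T_def c_def by (simp add: cs_commute)

lemma norm_normalized: "c \<noteq> 0 \<Longrightarrow> norm T \<le> 1"
  unfolding T_def c_def by (rule norm_one_minus_normalized_le) auto

lemma rpow_add:
  assumes "s > 0" "s' > 0"
  shows "rpow c (s + s') = rpow c s * rpow c s'"
proof (cases "c = 0")
  case False
  have "binser (of_real s + of_real s') T = binser (of_real s) T * binser (of_real s') T"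
    by (intro binser_add summable_binser_of_real assms norm_normalized False)
  hence "binser (of_real s) T * binser (of_real s') T = binser (of_real (s + s')) T" by simp
  moreover have "complex_of_real (norm c powr s) * of_real (norm c powr s') = of_real (norm c powr (s + s'))"
    by (simp flip: of_real_mult powr_add)
  ultimately show ?thesis using False
    by (simp only: rpow_def T_def[symmetric] cs_mult_cs if_False)
qed (simp add: rpow_def)

lemma rpow_1: "rpow c 1 = c"
proof (cases "c = 0")
  case False
  thus ?thesis
    by (simp add: rpow_def binser_1 mult.assoc[symmetric] flip: cs_mult)
qed (simp add: rpow_def)

lemma adj_rpow:
  assumes "s > 0"
  shows "adj (rpow c s) = rpow c s"
proof (cases "c = 0")
  case False
  thus ?thesis using adj_binser[OF adj_normalized summable_binser_of_real[OF assms norm_normalized[OF False]]]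
    by (simp add: rpow_def T_def[symmetric] cs_commute del: of_real_inverse)
qed (simp add: rpow_def)

end

section \<open>Complex powers of the regularized absolute value\<close>

definition reg_const :: "'i bo \<Rightarrow> 'i bo" where
  "reg_const x = 1 - cs (of_real (inverse (norm (adj x * x)))) * (adj x * x)"

text \<open>
  \<open>reg_power r x z\<close> is \<open>(x\<^sup>* x + \<epsilon>)\<^sup>z\<close> for \<open>\<epsilon> = norm (x\<^sup>* x) * (1 - r) / r\<close>. With this choice of \<open>\<epsilon>\<close> the
  series has the same \<open>T = reg_const x\<close> as the one in \<open>rpow\<close>, only with \<open>r * T\<close> in place of \<open>T\<close>.
\<close>

definition reg_power :: "real \<Rightarrow> 'i bo \<Rightarrow> complex \<Rightarrow> 'i bo" where
  "reg_power r x z = cs (exp (z * of_real (ln (norm (adj x * x) / r)))) * binser z (cs (of_real r) * reg_const x)"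

lemma adj_mult_self_pos: "x \<noteq> 0 \<Longrightarrow> norm (adj x * x) > 0"
  using adj_mult_self_eq_0 by auto

lemma norm_reg_const: "x \<noteq> 0 \<Longrightarrow> norm (reg_const x) \<le> 1"
  unfolding reg_const_def by (rule norm_one_minus_normalized_le)

lemma norm_reg_const_power: "x \<noteq> 0 \<Longrightarrow> norm (reg_const x ^ n) \<le> 1"
  using norm_power_ineq[of "reg_const x" n] power_le_one[OF norm_ge_zero norm_reg_const[of x], of n] by simp

context
  fixes r :: real and x :: "'i bo"
  assumes r: "0 < r" "r < 1" and x: "x \<noteq> 0"
begin

lemma norm_reg_arg_le: "norm (cs (of_real r) * reg_const x) \<le> r"
  unfolding norm_cs_mult using norm_reg_const[OF x] r by (simp add: mult_left_le)

lemma norm_reg_arg: "norm (cs (of_real r) * reg_const x) < 1"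
  using norm_reg_arg_le r by linarith

lemma adj_reg_arg: "adj (cs (of_real r) * reg_const x) = cs (of_real r) * reg_const x"
  unfolding reg_const_def by (simp add: cs_commute)

lemma reg_add: "reg_power r x (z + w) = reg_power r x z * reg_power r x w"
  unfolding reg_power_def cs_mult_cs binser_add[OF summable_binser[OF norm_reg_arg] summable_binser[OF norm_reg_arg]]
  by (simp add: ring_distribs exp_add)

lemma reg_0: "reg_power r x 0 = 1"
  by (simp add: reg_power_def binser_0)

lemma adj_reg: "adj (reg_power r x z) = reg_power r x (cnj z)"
  unfolding reg_power_def adj_mult adj_binser[OF adj_reg_arg summable_binser[OF norm_reg_arg]]
  by (simp add: cs_commute exp_cnj)

text \<open>With \<open>N = norm (x* x)\<close> this is
  \<open>(N/r) (1 - r (1 - x* x / N)) = x* x + N (1 - r) / r\<close>, which identifies the base of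
  the powers and the value of the regularizing constant.\<close>

lemma reg_1: "reg_power r x 1 = adj x * x + cs (of_real (norm (adj x * x) * (1 - r) / r))"
proof -
  define N where "N = norm (adj x * x)"
  have N: "N > 0" unfolding N_def by (rule adj_mult_self_pos[OF x])
  have "exp (1 * complex_of_real (ln (N / r))) = of_real (N / r)"
    using N r by (simp only: mult_1_left exp_of_real exp_ln divide_pos_pos)
  hence "reg_power r x 1 = cs (of_real (N / r)) * (1 - cs (of_real r) * (1 - cs (of_real (inverse N)) * (adj x * x)))"
    unfolding reg_power_def binser_1 reg_const_def N_def[symmetric] by (simp only:)
  also have "\<dots> = cs (of_real (N / r)) - cs (of_real (N / r) * of_real r) +
      cs (of_real (N / r) * of_real r * of_real (inverse N)) * (adj x * x)"
    by (simp only: cs_mult ring_distribs mult_1_right mult.assoc) (simp add: algebra_simps)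
  also have "complex_of_real (N / r) * of_real r = of_real N" using r by simp
  also have "complex_of_real N * of_real (inverse N) = 1" using N by simp
  also have "cs (of_real (N / r)) - cs (of_real N) = cs (of_real (N * (1 - r) / r))"
    using r by (simp add: field_simps flip: cs_diff)
  finally show ?thesis unfolding N_def by simp
qed

end

text \<open>As \<open>r\<close> tends to 1 the series is evaluated at \<open>r T\<close> with
  \<open>norm T <= 1\<close>, so its terms are dominated by \<open>|gcoef s n|\<close> for all
  \<open>r\<close> at once. This majorant is summable since \<open>s > 0\<close>, and Tannery's
  theorem permits the termwise limit.\<close>

lemma reg_tendsto_rpow:
  fixes x :: "'i bo"
  assumes x: "x \<noteq> 0" and s: "s > 0" and r: "\<And>n. 0 < r n" "\<And>n. r n < 1" "r \<longlonglongrightarrow> 1"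
  shows "(\<lambda>n. reg_power (r n) x (of_real s)) \<longlonglongrightarrow> rpow (adj x * x) s"
proof -
  define N where "N = norm (adj x * x)"
  define T where "T = reg_const x"
  have N: "N > 0" unfolding N_def by (rule adj_mult_self_pos[OF x])
  have T: "norm T \<le> 1" unfolding T_def by (rule norm_reg_const[OF x])
  have cslim: "(\<lambda>n. cs (a n) :: 'i bo) \<longlonglongrightarrow> cs l" if "a \<longlonglongrightarrow> l" for a l
  proof -
    have "norm (cs z :: 'i bo) = cmod z" for z using norm_cs_mult[of z 1] by simp
    moreover have "(\<lambda>n. cmod (a n - l)) \<longlonglongrightarrow> 0" using that by (simp add: tendsto_norm_zero_iff LIM_zero_iff)
    ultimately have "(\<lambda>n. norm (cs (a n) - cs l :: 'i bo)) \<longlonglongrightarrow> 0" by (simp only: flip: cs_diff)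
    thus ?thesis by (simp add: tendsto_norm_zero_iff LIM_zero_iff)
  qed
  have ser: "(\<lambda>n. binser (of_real s) (cs (of_real (r n)) * T)) \<longlonglongrightarrow> binser (of_real s) T"
  proof -
    have pw: "(cs c * T) ^ k = cs (c ^ k) * T ^ k" for c k
      by (induct k) (simp_all add: cs_mult_cs)
    have "(\<lambda>n. \<Sum>k. cs (gcoef (of_real s) k) * (cs (of_real (r n)) * T) ^ k) \<longlonglongrightarrow> (\<Sum>k. cs (gcoef (of_real s) k) * T ^ k)"
    proof (rule tannerys_theorem[THEN conjunct2, THEN conjunct2])
      fix k
      have "(\<lambda>n. cs (gcoef (of_real s) k) * (cs (of_real (r n) ^ k) * T ^ k)) \<longlonglongrightarrow> cs (gcoef (of_real s) k) * (cs (of_real 1 ^ k) * T ^ k)"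
        by (intro tendsto_intros cslim r)
      thus "(\<lambda>n. cs (gcoef (of_real s) k) * (cs (of_real (r n)) * T) ^ k) \<longlonglongrightarrow> cs (gcoef (of_real s) k) * T ^ k"
        by (simp add: pw)
    next
      show "\<forall>\<^sub>F (k, n) in sequentially \<times>\<^sub>F sequentially.
          norm (cs (gcoef (of_real s) k) * (cs (of_real (r n)) * T) ^ k) \<le> cmod (gcoef (of_real s) k)"
      proof (intro always_eventually allI, clarify)
        fix k n
        have "norm (cs (of_real (r n)) * T) \<le> 1" unfolding norm_cs_mult using T r(1,2)[of n] by (simp add: mult_le_one less_imp_le)
        hence "norm (cs (of_real (r n)) * T) ^ k \<le> 1" by (intro power_le_one) auto
        hence "cmod (gcoef (of_real s) k) * norm (cs (of_real (r n)) * T) ^ k \<le> cmod (gcoef (of_real s) k) * 1"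
          by (intro mult_left_mono) auto
        thus "norm (cs (gcoef (of_real s) k) * (cs (of_real (r n)) * T) ^ k) \<le> cmod (gcoef (of_real s) k)"
          using norm_cs_mult_power_le[of "gcoef (of_real s) k" "cs (of_real (r n)) * T" k] by simp
      qed
    qed (use summable_gcoef[OF s] in auto)
    thus ?thesis by (simp add: binser_def)
  qed
  have "(\<lambda>n. exp (of_real s * of_real (ln (N / r n)))) \<longlonglongrightarrow> exp (of_real s * complex_of_real (ln (N / 1)))"
    using N by (intro tendsto_intros r) auto
  also have "exp (of_real s * complex_of_real (ln (N / 1))) = of_real (N powr s)"
    using N by (simp add: powr_def exp_of_real[symmetric])
  finally have "(\<lambda>n. reg_power (r n) x (of_real s)) \<longlonglongrightarrow> cs (of_real (N powr s)) * binser (of_real s) T"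
    unfolding reg_power_def N_def[symmetric] T_def[symmetric] by (intro tendsto_mult cslim ser)
  moreover have "adj x * x \<noteq> 0" using N unfolding N_def by auto
  ultimately show ?thesis by (simp add: rpow_def N_def T_def reg_const_def)
qed

section \<open>Cauchy-Schwarz and norm continuity of a trace\<close>

context vn_trace
begin

lemma one_mem: "1 \<in> M" using cs_mem[of 1] by simp
lemma zero_mem: "0 \<in> M" using cs_mem[of 0] by simp
lemma diff_mem: "x \<in> M \<Longrightarrow> y \<in> M \<Longrightarrow> x - y \<in> M"
  using add_mem[OF _ mult_mem[OF cs_mem[of "-1"]], of x y] by (simp add: cs_uminus)
lemma power_mem: "x \<in> M \<Longrightarrow> x ^ n \<in> M"
  by (induct n) (auto intro: one_mem mult_mem)
lemma sum_mem: "(\<And>i. i \<in> I \<Longrightarrow> f i \<in> M) \<Longrightarrow> sum f I \<in> M"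
  by (induct I rule: infinite_finite_induct) (auto intro: zero_mem add_mem)

lemma suminf_mem:
  assumes "summable f" "\<And>n. f n \<in> M"
  shows "suminf f \<in> M"
  by (rule closed_sequentially[OF closed_M _ summable_LIMSEQ[OF assms(1)]]) (intro sum_mem assms(2))

lemma t_zero: "t 0 = 0"
  using t_cs[OF one_mem, of 0] by simp

lemma t_diff: "x \<in> M \<Longrightarrow> y \<in> M \<Longrightarrow> t (x - y) = t x - t y"
  using t_add[OF diff_mem, of x y y] by simp

text \<open>The polarization \<open>4 h = (h + 1)^2 - (h - 1)^2\<close> expresses \<open>h\<close>
  through elements of the form \<open>adj y * y\<close>, on which the trace is real.\<close>

lemma t_Im_selfadj:
  assumes "h \<in> M" "adj h = h"
  shows "Im (t h) = 0"
proof -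
  have 4: "cs 4 * h = adj (h + 1) * (h + 1) - adj (h - 1) * (h - 1)"
  proof -
    have "cs ((1 + 1) + (1 + 1)) * h = (h + h) + (h + h)" by (simp only: cs_add cs_1 ring_distribs mult_1_left)
    moreover have "(1 + 1) + (1 + 1) = (4 :: complex)" by simp
    ultimately have "cs 4 * h = (h + h) + (h + h)" by (simp only:)
    thus ?thesis using assms by (simp add: algebra_simps)
  qed
  have "4 * t h = t (cs 4 * h)" using t_cs[OF assms(1)] by simp
  also have "\<dots> = t (adj (h + 1) * (h + 1)) - t (adj (h - 1) * (h - 1))"
    unfolding 4 by (intro t_diff mult_mem adj_mem add_mem diff_mem assms one_mem)
  finally have "Im (4 * t h) = 0"
    using t_Im[OF add_mem[OF assms(1) one_mem]] t_Im[OF diff_mem[OF assms(1) one_mem]] by (simp only: minus_complex.sel)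
  thus ?thesis by simp
qed

lemma t_adj:
  assumes "x \<in> M"
  shows "t (adj x) = cnj (t x)"
proof -
  note m = assms adj_mem[OF assms]
  have "Im (t (x + adj x)) = 0" by (intro t_Im_selfadj add_mem m) (simp add: add.commute)
  hence 1: "Im (t x) + Im (t (adj x)) = 0" by (simp add: t_add m)
  have "Im (t (cs \<i> * (x - adj x))) = 0"
    by (intro t_Im_selfadj mult_mem cs_mem diff_mem m) (simp add: cs_commute cs_uminus algebra_simps)
  hence "Re (t x) - Re (t (adj x)) = 0" by (simp add: t_cs diff_mem t_diff m)
  thus ?thesis using 1 by (simp add: complex_eq_iff)
qed

lemma t_mult_self_real:
  assumes "x \<in> M"
  shows "t (adj x * x) = of_real (Re (t (adj x * x)))"
  using t_Im[OF assms] by (simp add: complex_eq_iff)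

text \<open>Positivity of \<open>t (adj w * w)\<close> for \<open>w = s u* - y cnj(c) v\<close>
  gives a real quadratic form in \<open>s\<close> and \<open>y\<close>. The phase of
  \<open>c = t (u v)\<close> is built into the coefficient of \<open>v\<close>, so only
  \<open>(cmod c)^2\<close> appears.\<close>

lemma Cauchy_Schwarz_trace:
  assumes u: "u \<in> M" and v: "v \<in> M"
  shows "(cmod (t (u * v)))\<^sup>2 \<le> Re (t (u * adj u)) * Re (t (adj v * v))"
proof -
  define a where "a = Re (t (u * adj u))"
  define b where "b = Re (t (adj v * v))"
  define c where "c = t (u * v)"
  have a: "t (u * adj u) = of_real a" "a \<ge> 0"
    using t_mult_self_real[OF adj_mem[OF u]] t_nonneg[OF adj_mem[OF u]] unfolding a_def by simp_all
  have b: "t (adj v * v) = of_real b" "b \<ge> 0"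
    using t_mult_self_real[OF v] t_nonneg[OF v] unfolding b_def by simp_all
  have c': "t (adj v * adj u) = cnj c" unfolding c_def using t_adj[OF mult_mem[OF u v]] by simp
  have main: "0 \<le> s\<^sup>2 * a - 2 * s * y * (cmod c)\<^sup>2 + y\<^sup>2 * (cmod c)\<^sup>2 * b" for s y :: real
  proof -
    define \<mu> where "\<mu> = - of_real y * cnj c"
    define w where "w = cs (of_real s) * adj u + cs \<mu> * v"
    have w: "w \<in> M" unfolding w_def by (intro add_mem mult_mem cs_mem adj_mem u v)
    have adjw: "adj w = cs (of_real s) * u + cs (cnj \<mu>) * adj v" unfolding w_def by (simp add: cs_commute)
    have "adj w * w = (cs (of_real s * of_real s) * (u * adj u) + cs (of_real s * \<mu>) * (u * v)) +
        (cs (cnj \<mu> * of_real s) * (adj v * adj u) + cs (cnj \<mu> * \<mu>) * (adj v * v))"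
      unfolding adjw unfolding w_def by (simp only: ring_distribs cs_mult_cs add_ac)
    hence "t (adj w * w) = (of_real s * of_real s * of_real a + of_real s * \<mu> * c) +
        (cnj \<mu> * of_real s * cnj c + cnj \<mu> * \<mu> * of_real b)"
      by (simp only: t_add t_cs add_mem mult_mem cs_mem adj_mem u v a b c_def[symmetric] c')
    also have "\<dots> = of_real (s\<^sup>2 * a - 2 * s * y * (cmod c)\<^sup>2 + y\<^sup>2 * (cmod c)\<^sup>2 * b)"
    proof -
      define K where "K = (cmod c)\<^sup>2"
      have K: "of_real K = c * cnj c" unfolding K_def by (rule complex_norm_square)
      show ?thesis unfolding \<mu>_def K_def[symmetric] by (simp add: K algebra_simps power2_eq_square)
    qed
    finally show ?thesis using t_nonneg[OF w] by simp
  qed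
  have "(cmod c)\<^sup>2 \<le> a * b"
  proof (cases "c = 0")
    case True
    thus ?thesis using a b by simp
  next
    case False
    hence c0: "(cmod c)\<^sup>2 > 0" by simp
    show ?thesis
    proof (cases "a = 0")
      case True
      \<comment> \<open>If \<open>a = 0\<close>, the form is linear in \<open>s\<close>. This value
        of \<open>s\<close> makes \<open>b - 2 s = -1\<close>, so the form equals
        \<open>-(cmod c)^2\<close>, contradicting \<open>c \<noteq> 0\<close>.\<close>
      define K where "K = (b + 1) / 2"
      have "0 \<le> - (2 * K * (cmod c)\<^sup>2) + (cmod c)\<^sup>2 * b" using main[of K 1] True by simp
      also have "\<dots> = - ((cmod c)\<^sup>2)" unfolding K_def by (simp add: field_simps)
      finally show ?thesis using c0 by linarith
    next
      case False
      hence a0: "a > 0" using a by linarith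
      \<comment> \<open>With \<open>s = (cmod c)^2\<close> and \<open>y = a\<close> the form factors
        as \<open>(cmod c)^2 * a * (a b - (cmod c)^2)\<close>.\<close>
      have "0 \<le> (cmod c)\<^sup>2 * ((cmod c)\<^sup>2 * a - 2 * a * (cmod c)\<^sup>2 + a * a * b)"
        using main[of "(cmod c)\<^sup>2" a] by (simp add: algebra_simps power2_eq_square)
      hence "0 \<le> (cmod c)\<^sup>2 * a - 2 * a * (cmod c)\<^sup>2 + a * a * b" using c0 by (simp add: zero_le_mult_iff)
      also have "\<dots> = a * (a * b - (cmod c)\<^sup>2)" by (simp add: algebra_simps)
      finally show ?thesis using a0 by (simp add: zero_le_mult_iff)
    qed
  qed
  thus ?thesis unfolding a_def b_def c_def .
qed

lemma t_one_nonneg: "Re (t 1) \<ge> 0"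
  using t_nonneg[OF one_mem] by simp

lemma t_adj_mult_le:
  assumes "x \<in> M"
  shows "Re (t (adj x * x)) \<le> Re (t 1) * (norm x)\<^sup>2"
  using t_contraction[OF one_mem assms] by (simp add: mult.commute)

text \<open>Cauchy-Schwarz against the unit, then \<open>t_contraction\<close>. The resulting
  continuity of \<open>t\<close> in operator norm is what carries traces through series and through
  the limit of the regularization.\<close>

lemma cmod_t_le:
  assumes "x \<in> M"
  shows "cmod (t x) \<le> Re (t 1) * norm x"
proof -
  have "(cmod (t (1 * x)))\<^sup>2 \<le> Re (t (1 * adj 1)) * Re (t (adj x * x))"
    by (rule Cauchy_Schwarz_trace[OF one_mem assms])
  also have "\<dots> \<le> Re (t 1) * (Re (t 1) * (norm x)\<^sup>2)"
    using t_adj_mult_le[OF assms] t_one_nonneg by (simp add: mult_left_mono)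
  finally have "(cmod (t x))\<^sup>2 \<le> (Re (t 1) * norm x)\<^sup>2" by (simp add: power2_eq_square algebra_simps)
  thus ?thesis by (rule power2_le_imp_le) (simp add: t_one_nonneg)
qed

lemma t_tendsto:
  assumes "\<And>n. X n \<in> M" "l \<in> M" "(X \<longlongrightarrow> l) F"
  shows "((\<lambda>n. t (X n)) \<longlongrightarrow> t l) F"
proof -
  have "((\<lambda>n. t (X n) - t l) \<longlongrightarrow> 0) F"
  proof (rule Lim_null_comparison)
    show "\<forall>\<^sub>F n in F. norm (t (X n) - t l) \<le> Re (t 1) * norm (X n - l)"
      using cmod_t_le[OF diff_mem[OF assms(1,2)]] by (simp add: t_diff[OF assms(1,2)])
    show "((\<lambda>n. Re (t 1) * norm (X n - l)) \<longlongrightarrow> 0) F"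
      using assms(3) by (intro tendsto_mult_right_zero tendsto_norm_zero) (simp add: LIM_zero)
  qed
  thus ?thesis by (simp add: LIM_zero_iff)
qed

lemma binser_mem:
  assumes "T \<in> M" "summable (\<lambda>n. norm (cs (gcoef s n) * T ^ n))"
  shows "binser s T \<in> M"
  unfolding binser_def by (intro suminf_mem summable_norm_cancel[OF assms(2)] mult_mem cs_mem power_mem assms(1))

lemma reg_const_mem: "x \<in> M \<Longrightarrow> reg_const x \<in> M"
  unfolding reg_const_def by (intro diff_mem one_mem mult_mem cs_mem adj_mem)

lemma rpow_mem:
  assumes "x \<in> M" "s > 0"
  shows "rpow (adj x * x) s \<in> M"
proof (cases "adj x * x = 0")
  case False
  hence x: "x \<noteq> 0" by auto
  show ?thesis using False unfolding rpow_def reg_const_def[symmetric]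
    by (simp add: mult_mem cs_mem binser_mem[OF reg_const_mem[OF assms(1)] summable_binser_of_real[OF assms(2) norm_reg_const[OF x]]])
qed (simp add: rpow_def zero_mem)

lemma t_rpow_nonneg:
  assumes "x \<in> M" "s > 0"
  shows "Re (t (rpow (adj x * x) s)) \<ge> 0"
proof -
  have s: "s / 2 > 0" using assms by simp
  have "rpow (adj x * x) s = adj (rpow (adj x * x) (s/2)) * rpow (adj x * x) (s/2)"
    using adj_rpow[OF refl refl s, of x] rpow_add[OF refl refl s s, of x] by simp
  thus ?thesis using t_nonneg[OF rpow_mem[OF assms(1) s]] by simp
qed

section \<open>Trace bounds for complex powers of the regularized absolute value\<close>

context
  fixes r :: real and x :: "'i bo"
  assumes r: "0 < r" "r < 1" and x: "x \<noteq> 0" and xM: "x \<in> M"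
begin

lemma reg_mem: "reg_power r x z \<in> M"
  unfolding reg_power_def
  by (intro mult_mem cs_mem binser_mem reg_const_mem xM summable_binser[OF norm_reg_arg[OF r x]])

lemma t_reg_nonneg: "Re (t (reg_power r x (of_real s))) \<ge> 0"
proof -
  have "reg_power r x (of_real s) = adj (reg_power r x (of_real (s/2))) * reg_power r x (of_real (s/2))"
    unfolding adj_reg[OF r x] by (simp flip: reg_add[OF r x])
  thus ?thesis using t_nonneg[OF reg_mem] by metis
qed

text \<open>Writing \<open>a = x* x + e\<close> by \<open>reg_1\<close>, the two traces differ by
  \<open>e * t (a^s)\<close>, which is nonnegative.\<close>

lemma t_reg_mult_le:
  "Re (t (reg_power r x (of_real s) * (adj x * x))) \<le> Re (t (reg_power r x (of_real (1 + s))))"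
proof -
  define e where "e = norm (adj x * x) * (1 - r) / r"
  have e: "e \<ge> 0" unfolding e_def using r by simp
  have "reg_power r x (of_real (1 + s)) = reg_power r x (of_real s) * reg_power r x 1"
    by (simp add: add.commute flip: reg_add[OF r x])
  also have "\<dots> = reg_power r x (of_real s) * (adj x * x) + cs (of_real e) * reg_power r x (of_real s)"
    unfolding reg_1[OF r x] e_def by (simp add: ring_distribs cs_commute)
  finally have "t (reg_power r x (of_real (1 + s))) = t (reg_power r x (of_real s) * (adj x * x)) + of_real e * t (reg_power r x (of_real s))"
    by (simp only: t_add t_cs mult_mem cs_mem reg_mem adj_mem xM)
  thus ?thesis using mult_nonneg_nonneg[OF e t_reg_nonneg[of s]] by simp
qed

lemma reg_conj:
  "adj (x * reg_power r x z) * (x * reg_power r x z) = reg_power r x (cnj z) * (adj x * x) * reg_power r x z"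
  by (simp add: adj_reg[OF r x] mult.assoc)

text \<open>The trace property brings \<open>a^z\<close> next to \<open>a^(cnj z)\<close>; the
  imaginary parts cancel and \<open>a^(2 Re z) x* x\<close> remains. This bounds the squared 2-norm
  of \<open>x a^z\<close>.\<close>

lemma t_left_reg:
  "Re (t (adj (x * reg_power r x z) * (x * reg_power r x z))) \<le> Re (t (reg_power r x (of_real (1 + 2 * Re z))))"
proof -
  have "t (adj (x * reg_power r x z) * (x * reg_power r x z)) = t (reg_power r x z * (reg_power r x (cnj z) * (adj x * x)))"
    unfolding reg_conj by (rule t_comm) (intro mult_mem reg_mem adj_mem xM)+
  also have "reg_power r x z * (reg_power r x (cnj z) * (adj x * x)) = reg_power r x (of_real (2 * Re z)) * (adj x * x)"
    by (simp only: mult.assoc[symmetric] reg_add[OF r x, symmetric] complex_add_cnj)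
  finally show ?thesis using t_reg_mult_le[of "2 * Re z"] by simp
qed

text \<open>The element is the adjoint of \<open>x a^(cnj z)\<close>, and traciality makes the
  2-norms of an element and its adjoint equal.\<close>

lemma t_right_reg:
  "Re (t (adj (reg_power r x z * adj x) * (reg_power r x z * adj x))) \<le> Re (t (reg_power r x (of_real (1 + 2 * Re z))))"
proof -
  have "t (adj (reg_power r x z * adj x) * (reg_power r x z * adj x)) = t ((reg_power r x z * adj x) * adj (reg_power r x z * adj x))"
    by (rule t_comm) (intro mult_mem reg_mem adj_mem xM)+
  also have "(reg_power r x z * adj x) * adj (reg_power r x z * adj x) = adj (x * reg_power r x (cnj z)) * (x * reg_power r x (cnj z))"
    by (simp add: adj_reg[OF r x])
  finally show ?thesis using t_left_reg[of "cnj z"] by simp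
qed

text \<open>Here \<open>e\<close> plays the role of \<open>|x a^z|\<close>, so this is a trace-norm
  bound. Cauchy-Schwarz is applied to \<open>e = (e a^(-\<sigma>)) a^\<sigma>\<close> with
  \<open>2 \<sigma> = 1/2 + Re z\<close>. This choice balances the factors: the second contributes
  \<open>t (a^(2 \<sigma>))\<close>, and the first is the squared 2-norm of
  \<open>x a^(z - \<sigma>)\<close>, which is bounded by the trace of the same power.\<close>

lemma t_sqrt_le:
  assumes e: "e \<in> M" "adj e = e" "e * e = adj (x * reg_power r x z) * (x * reg_power r x z)"
  shows "cmod (t e) \<le> Re (t (reg_power r x (of_real (1/2 + Re z))))"
proof -
  define \<sigma> where "\<sigma> = (1/2 + Re z) / 2"
  define B where "B = Re (t (reg_power r x (of_real (1/2 + Re z))))"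
  let ?m = "reg_power r x (- of_real \<sigma>)" and ?p = "reg_power r x (of_real \<sigma>)"
  have mp: "?m * ?p = 1" by (simp add: reg_0[OF r x] flip: reg_add[OF r x])
  have "(cmod (t ((e * ?m) * ?p)))\<^sup>2 \<le> Re (t ((e * ?m) * adj (e * ?m))) * Re (t (adj ?p * ?p))"
    by (intro Cauchy_Schwarz_trace mult_mem e reg_mem)
  also have "(e * ?m) * ?p = e" by (simp add: mult.assoc mp)
  also have "adj ?p * ?p = reg_power r x (of_real (1/2 + Re z))"
    unfolding adj_reg[OF r x] by (simp add: \<sigma>_def flip: reg_add[OF r x])
  also have "t ((e * ?m) * adj (e * ?m)) = t (adj (e * ?m) * (e * ?m))"
    by (rule t_comm) (intro adj_mem mult_mem e reg_mem)+
  also have "adj (e * ?m) * (e * ?m) = ?m * (e * e) * ?m"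
    by (simp add: adj_reg[OF r x] e(2) mult.assoc)
  also have "\<dots> = adj (x * reg_power r x (z - of_real \<sigma>)) * (x * reg_power r x (z - of_real \<sigma>))"
  proof -
    have "reg_power r x (z - of_real \<sigma>) = reg_power r x z * ?m"
      using reg_add[OF r x, of z "- of_real \<sigma>"] by simp
    moreover have "reg_power r x (cnj (z - of_real \<sigma>)) = ?m * reg_power r x (cnj z)"
      using reg_add[OF r x, of "- of_real \<sigma>" "cnj z"] by simp
    ultimately show ?thesis unfolding e(3) reg_conj by (simp only: mult.assoc)
  qed
  finally have "(cmod (t e))\<^sup>2 \<le> Re (t (adj (x * reg_power r x (z - of_real \<sigma>)) * (x * reg_power r x (z - of_real \<sigma>)))) * B"
    unfolding B_def .
  also have "\<dots> \<le> B * B"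
  proof (rule mult_right_mono)
    have "1 + 2 * Re (z - of_real \<sigma>) = 1/2 + Re z" by (simp add: \<sigma>_def field_simps)
    thus "Re (t (adj (x * reg_power r x (z - of_real \<sigma>)) * (x * reg_power r x (z - of_real \<sigma>)))) \<le> B"
      using t_left_reg[of "z - of_real \<sigma>"] unfolding B_def by metis
    show "B \<ge> 0" unfolding B_def by (rule t_reg_nonneg)
  qed
  finally have "(cmod (t e))\<^sup>2 \<le> B\<^sup>2" by (simp add: power2_eq_square)
  thus ?thesis unfolding B_def by (rule power2_le_imp_le) (rule t_reg_nonneg)
qed

text \<open>Hoelder's inequality for the exponents infinity and 1, obtained from Cauchy-Schwarz for
  \<open>s a^\<rho>\<close> and \<open>a^(z - \<rho>) x*\<close>. Taking
  \<open>2 \<rho> = 1/2 + Re z\<close> gives both factors the same power of \<open>a\<close>, and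
  \<open>t_contraction\<close> extracts \<open>norm s\<close>.\<close>

lemma t_mult_reg_le:
  assumes s: "s \<in> M"
  shows "cmod (t (s * (reg_power r x z * adj x))) \<le> norm s * Re (t (reg_power r x (of_real (1/2 + Re z))))"
proof -
  define \<rho> where "\<rho> = (1/2 + Re z) / 2"
  define B where "B = Re (t (reg_power r x (of_real (1/2 + Re z))))"
  have B: "B \<ge> 0" unfolding B_def by (rule t_reg_nonneg)
  let ?p = "reg_power r x (of_real \<rho>)" and ?q = "reg_power r x (z - of_real \<rho>) * adj x"
  have "(cmod (t ((s * ?p) * ?q)))\<^sup>2 \<le> Re (t ((s * ?p) * adj (s * ?p))) * Re (t (adj ?q * ?q))"
    by (intro Cauchy_Schwarz_trace mult_mem s reg_mem adj_mem xM)
  also have "?p * reg_power r x (z - of_real \<rho>) = reg_power r x z" by (simp flip: reg_add[OF r x])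
  hence "(s * ?p) * ?q = s * (reg_power r x z * adj x)" by (simp add: mult.assoc flip: mult.assoc[of ?p])
  also have "t ((s * ?p) * adj (s * ?p)) = t (adj (s * ?p) * (s * ?p))"
    by (rule t_comm) (intro adj_mem mult_mem s reg_mem)+
  also have "adj (s * ?p) * (s * ?p) = adj ?p * adj s * s * ?p" by (simp add: mult.assoc)
  also have "Re (t (adj ?p * adj s * s * ?p)) * Re (t (adj ?q * ?q)) \<le> ((norm s)\<^sup>2 * B) * B"
  proof (rule mult_mono)
    have "adj ?p * ?p = reg_power r x (of_real (1/2 + Re z))"
      unfolding adj_reg[OF r x] by (simp add: \<rho>_def flip: reg_add[OF r x])
    thus "Re (t (adj ?p * adj s * s * ?p)) \<le> (norm s)\<^sup>2 * B"
      using t_contraction[OF reg_mem s, of "of_real \<rho>"] unfolding B_def by simp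
    have "1 + 2 * Re (z - of_real \<rho>) = 1/2 + Re z" by (simp add: \<rho>_def field_simps)
    thus "Re (t (adj ?q * ?q)) \<le> B"
      using t_right_reg[of "z - of_real \<rho>"] unfolding B_def by metis
    show "(norm s)\<^sup>2 * B \<ge> 0" using B by simp
    show "0 \<le> Re (t (adj ?q * ?q))" by (intro t_nonneg mult_mem reg_mem adj_mem xM)
  qed
  finally have "(cmod (t (s * (reg_power r x z * adj x))))\<^sup>2 \<le> (norm s * B)\<^sup>2"
    by (simp add: power2_eq_square algebra_simps)
  thus ?thesis unfolding B_def by (rule power2_le_imp_le) (intro mult_nonneg_nonneg norm_ge_zero t_reg_nonneg)
qed

end

end

section \<open>Interpolation\<close>

text \<open>Hadamard's theorem. Dividing by the interpolated bound normalizes both edges to 1, and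
  the extra factor \<open>exp (e (z^2 - 1))\<close> decays in the imaginary direction, so the
  maximum principle on a tall rectangle suffices; finally \<open>e\<close> tends to 0.\<close>

lemma three_lines:
  fixes f :: "complex \<Rightarrow> complex"
  assumes hol: "f holomorphic_on UNIV"
    and bdd: "\<And>z. 0 \<le> Re z \<Longrightarrow> Re z \<le> 1 \<Longrightarrow> cmod (f z) \<le> B"
    and f0: "\<And>z. Re z = 0 \<Longrightarrow> cmod (f z) \<le> M0" and f1: "\<And>z. Re z = 1 \<Longrightarrow> cmod (f z) \<le> M1"
    and M: "M0 > 0" "M1 > 0" and th: "0 \<le> \<theta>" "\<theta> \<le> 1"
  shows "cmod (f (of_real \<theta>)) \<le> M0 powr (1 - \<theta>) * M1 powr \<theta>"
proof -
  define N where "N = (\<lambda>t::real. M0 powr (1 - t) * M1 powr t)"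
  have N: "N t > 0" for t unfolding N_def using M by simp
  define C where "C = exp (\<bar>ln M0\<bar> + \<bar>ln M1\<bar>)"
  have B: "B \<ge> 0" using order_trans[OF norm_ge_zero bdd[of 0]] by simp
  have Ninv: "inverse (N t) = exp (- (1 - t) * ln M0 - t * ln M1)" for t
    unfolding N_def using M by (simp add: powr_def exp_minus[symmetric] exp_add[symmetric] algebra_simps)
  have NC: "inverse (N t) \<le> C" if "0 \<le> t" "t \<le> 1" for t
  proof -
    have "- (1 - t) * ln M0 - t * ln M1 \<le> \<bar>(1 - t) * ln M0\<bar> + \<bar>t * ln M1\<bar>" by linarith
    also have "\<dots> \<le> \<bar>ln M0\<bar> + \<bar>ln M1\<bar>"
      unfolding abs_mult using that by (intro add_mono) (auto intro: mult_left_le_one_le)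
    finally show ?thesis unfolding C_def Ninv by simp
  qed
  have approx: "cmod (f (of_real \<theta>)) \<le> N \<theta> * exp ((1 - \<theta>\<^sup>2) * e)" if e: "e > 0" for e
  proof -
    \<comment> \<open>On the strip \<open>Re (z^2 - 1) <= - (Im z)^2\<close>, so the damping factor
      has modulus at most 1. At \<open>\<theta>\<close> it costs only
      \<open>exp ((1 - \<theta>^2) e)\<close>, which tends to 1.\<close>
    define g where "g = (\<lambda>z. f z * exp (- (1 - z) * of_real (ln M0) - z * of_real (ln M1) + of_real e * (z\<^sup>2 - 1)))"
    have ng: "cmod (g z) = cmod (f z) * inverse (N (Re z)) * exp (e * ((Re z)\<^sup>2 - (Im z)\<^sup>2 - 1))" for z
    proof -
      have "Re (- (1 - z) * of_real (ln M0) - z * of_real (ln M1) + of_real e * (z\<^sup>2 - 1)) =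
          (- (1 - Re z) * ln M0 - Re z * ln M1) + e * ((Re z)\<^sup>2 - (Im z)\<^sup>2 - 1)"
        by (simp add: power2_eq_square)
      thus ?thesis unfolding g_def norm_mult norm_exp_eq_Re Ninv by (simp only: exp_add mult.assoc)
    qed
    \<comment> \<open>The height is chosen so that \<open>B * C <= e * Y^2\<close>; then the
      horizontal edges are covered by \<open>t * exp (- t) <= 1\<close> with
      \<open>t = B * C\<close>. The summand 1 ensures \<open>Y <= Y^2\<close>.\<close>
    define Y where "Y = B * C / e + 1"
    have BC: "B * C \<ge> 0" unfolding C_def using B by simp
    have Y: "Y \<ge> 1" unfolding Y_def using BC e by simp
    have "B * C \<le> e * Y" unfolding Y_def using e by (simp add: field_simps)
    also have "e * Y \<le> e * Y\<^sup>2" using Y e by (intro mult_left_mono) (auto simp: power2_eq_square)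
    finally have BCY: "B * C \<le> e * Y\<^sup>2" .
    define S where "S = cbox (Complex 0 (- Y)) (Complex 1 Y)"
    have "cmod (g (of_real \<theta>)) \<le> 1"
    proof (rule maximum_modulus_frontier[of g S])
      have hg: "g holomorphic_on UNIV" unfolding g_def by (intro holomorphic_intros hol)
      show "g holomorphic_on interior S" using hg holomorphic_on_subset by blast
      show "continuous_on (closure S) g"
        using holomorphic_on_imp_continuous_on[OF hg] continuous_on_subset by blast
      show "bounded S" unfolding S_def by (rule bounded_cbox)
      show "of_real \<theta> \<in> S" unfolding S_def using th Y by (simp add: in_cbox_complex_iff)
      fix z assume "z \<in> frontier S"
      hence z: "0 \<le> Re z" "Re z \<le> 1" "\<bar>Im z\<bar> \<le> Y" and fr: "Re z = 0 \<or> Re z = 1 \<or> \<bar>Im z\<bar> = Y"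
        unfolding S_def frontier_cbox by (auto simp: in_cbox_complex_iff in_box_complex_iff)
      have sq: "(Re z)\<^sup>2 \<le> 1" using z by (simp add: power_le_one)
      have ex: "exp (e * ((Re z)\<^sup>2 - (Im z)\<^sup>2 - 1)) \<le> 1"
      proof -
        have "(Re z)\<^sup>2 - (Im z)\<^sup>2 - 1 \<le> 0" using sq zero_le_power2[of "Im z"] by linarith
        thus ?thesis using e by (simp add: mult_le_0_iff)
      qed
      show "cmod (g z) \<le> 1"
      proof (cases "Re z = 0 \<or> Re z = 1")
        case True
        hence "cmod (f z) \<le> N (Re z)" using f0[of z] f1[of z] M unfolding N_def by auto
        hence fN: "cmod (f z) * inverse (N (Re z)) \<le> 1" using N[of "Re z"] by (simp add: field_simps)
        show ?thesis unfolding ng by (rule mult_le_one[OF fN _ ex]) simp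
      next
        case False
        hence im: "(Im z)\<^sup>2 = Y\<^sup>2" using fr by (metis power2_abs)
        have "cmod (g z) \<le> B * C * exp (- (e * Y\<^sup>2))"
          unfolding ng
        proof (intro mult_mono)
          show "exp (e * ((Re z)\<^sup>2 - (Im z)\<^sup>2 - 1)) \<le> exp (- (e * Y\<^sup>2))"
            using sq e mult_left_mono[of "(Re z)\<^sup>2 - Y\<^sup>2 - 1" "- Y\<^sup>2" e] unfolding im by simp
        qed (use bdd[of z] NC[of "Re z"] z N[of "Re z"] B BC in auto)
        also have "\<dots> \<le> B * C * exp (- (B * C))" using BCY BC by (intro mult_left_mono) auto
        also have "\<dots> \<le> 1"
        proof -
          have "B * C \<le> exp (B * C)" using exp_ge_add_one_self[of "B * C"] by linarith
          thus ?thesis by (simp add: exp_minus field_simps)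
        qed
        finally show ?thesis .
      qed
    qed
    hence *: "cmod (f (of_real \<theta>)) * inverse (N \<theta>) * exp (e * (\<theta>\<^sup>2 - 1)) \<le> 1" unfolding ng by simp
    have "cmod (f (of_real \<theta>)) = (cmod (f (of_real \<theta>)) * inverse (N \<theta>) * exp (e * (\<theta>\<^sup>2 - 1))) * (N \<theta> * exp ((1 - \<theta>\<^sup>2) * e))"
      using N[of \<theta>] by (simp add: field_simps exp_add[symmetric])
    also have "\<dots> \<le> 1 * (N \<theta> * exp ((1 - \<theta>\<^sup>2) * e))"
      by (rule mult_right_mono[OF *]) (use N[of \<theta>] in simp)
    finally show ?thesis by simp
  qed
  have "cmod (f (of_real \<theta>)) \<le> N \<theta>"
  proof (rule tendsto_lowerbound[of _ _ "at_right 0"])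
    have "((\<lambda>e. N \<theta> * exp ((1 - \<theta>\<^sup>2) * e)) \<longlongrightarrow> N \<theta> * exp ((1 - \<theta>\<^sup>2) * 0)) (at_right 0)"
      by (intro tendsto_intros)
    thus "((\<lambda>e. N \<theta> * exp ((1 - \<theta>\<^sup>2) * e)) \<longlongrightarrow> N \<theta>) (at_right 0)" by simp
    show "\<forall>\<^sub>F e in at_right 0. cmod (f (of_real \<theta>)) \<le> N \<theta> * exp ((1 - \<theta>\<^sup>2) * e)"
      using eventually_at_right_less[of 0] by eventually_elim (rule approx)
  qed simp
  thus ?thesis unfolding N_def .
qed

section \<open>Holomorphic dependence of the powers on the exponent\<close>

lemma holomorphic_series:
  fixes H :: "nat \<Rightarrow> complex \<Rightarrow> complex"
  assumes hol: "\<And>n. H n holomorphic_on UNIV"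
    and bnd: "\<And>R n z. cmod z \<le> R \<Longrightarrow> cmod (H n z) \<le> M R n" and sum: "\<And>R. R \<ge> 0 \<Longrightarrow> summable (M R)"
    and G: "\<And>z. (\<lambda>n. H n z) sums G z"
  shows "G holomorphic_on UNIV"
proof (rule holomorphic_uniform_sequence[where f = "\<lambda>N z. \<Sum>n<N. H n z"])
  show "(\<lambda>z. \<Sum>n<N. H n z) holomorphic_on UNIV" for N by (intro holomorphic_intros hol)
  fix z :: complex
  \<comment> \<open>The majorant may vary with the radius: the unit disc around \<open>z\<close>
    lies in the disc of radius \<open>cmod z + 1\<close> about 0, so a single summable sequence
    serves on it.\<close>
  have "uniform_limit (cball z 1) (\<lambda>N z. \<Sum>n<N. H n z) (\<lambda>z. \<Sum>n. H n z) sequentially"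
  proof (rule Weierstrass_m_test)
    show "norm (H n w) \<le> M (cmod z + 1) n" if "w \<in> cball z 1" for n w
      using that norm_triangle_ineq2[of w z] by (intro bnd) (simp add: dist_norm norm_minus_commute)
  qed (simp add: sum)
  also have "(\<lambda>z. \<Sum>n. H n z) = G" using G by (auto simp: sums_iff)
  finally show "\<exists>d>0. cball z d \<subseteq> UNIV \<and> uniform_limit (cball z d) (\<lambda>N z. \<Sum>n<N. H n z) G sequentially"
    by (intro exI[of _ 1]) auto
qed auto

text \<open>The scalar coefficient of \<open>reg_const x ^ n\<close> in
  \<open>reg_power r x z\<close>. All dependence on \<open>z\<close> sits in these entire functions,
  while the operators are fixed.\<close>

definition reg_coeff :: "real \<Rightarrow> 'i bo \<Rightarrow> complex \<Rightarrow> nat \<Rightarrow> complex" where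
  "reg_coeff r x z n = exp (z * of_real (ln (norm (adj x * x) / r))) * gcoef z n * of_real (r ^ n)"

text \<open>A summable majorant of the coefficients, uniform for \<open>cmod z <= R\<close>.\<close>

definition reg_major :: "real \<Rightarrow> 'i bo \<Rightarrow> real \<Rightarrow> nat \<Rightarrow> real" where
  "reg_major r x R n = exp (R * \<bar>ln (norm (adj x * x) / r)\<bar>) * (pochhammer R n / fact n * r ^ n)"

lemma reg_coeff_holomorphic: "f holomorphic_on UNIV \<Longrightarrow> (\<lambda>z. reg_coeff r x (f z) n) holomorphic_on UNIV"
  unfolding reg_coeff_def
  using holomorphic_on_compose[of f UNIV, OF _ holomorphic_on_subset[OF gcoef_holomorphic subset_UNIV]]
  by (intro holomorphic_intros) (auto simp: o_def)

context
  fixes r :: real and x :: "'i bo"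
  assumes r: "0 < r" "r < 1" and x: "x \<noteq> 0"
begin

lemma summable_reg_major: "summable (reg_major r x R)"
  unfolding reg_major_def using r by (intro summable_mult summable_pochhammer_power) auto

lemma reg_coeff_le:
  assumes "cmod z \<le> R"
  shows "cmod (reg_coeff r x z n) \<le> reg_major r x R n"
proof -
  let ?L = "ln (norm (adj x * x) / r)"
  have "Re (z * of_real ?L) \<le> cmod (z * of_real ?L)" by (rule complex_Re_le_cmod)
  also have "\<dots> \<le> R * \<bar>?L\<bar>" unfolding norm_mult norm_of_real using assms by (intro mult_right_mono) auto
  finally have e: "cmod (exp (z * of_real ?L)) \<le> exp (R * \<bar>?L\<bar>)" by (simp only: norm_exp_eq_Re exp_le_cancel_iff)
  have c: "cmod (gcoef z n) * r ^ n \<le> pochhammer R n / fact n * r ^ n"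
    using r by (intro mult_right_mono cmod_gcoef_le assms) auto
  have "cmod (exp (z * of_real ?L)) * (cmod (gcoef z n) * r ^ n) \<le>
      exp (R * \<bar>?L\<bar>) * (pochhammer R n / fact n * r ^ n)"
    by (rule mult_mono[OF e c]) (use r in auto)
  thus ?thesis unfolding reg_coeff_def reg_major_def using r by (simp add: norm_mult norm_power mult.assoc)
qed

lemma norm_reg_term_le:
  assumes "cmod z \<le> R"
  shows "norm (cs (reg_coeff r x z n) * reg_const x ^ n) \<le> reg_major r x R n"
proof -
  have "norm (cs (reg_coeff r x z n) * reg_const x ^ n) \<le> cmod (reg_coeff r x z n) * 1"
    unfolding norm_cs_mult by (intro mult_left_mono norm_reg_const_power x) auto
  thus ?thesis using reg_coeff_le[OF assms, of n] by linarith
qed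

lemma reg_sums: "(\<lambda>n. cs (reg_coeff r x z n) * reg_const x ^ n) sums reg_power r x z"
proof -
  have pw: "(cs c * T) ^ k = cs (c ^ k) * T ^ k" for c k and T :: "'i bo"
    by (induct k) (simp_all add: cs_mult_cs)
  have "(\<lambda>n. cs (gcoef z n) * (cs (of_real r) * reg_const x) ^ n) sums binser z (cs (of_real r) * reg_const x)"
    unfolding binser_def by (rule summable_sums[OF summable_norm_cancel[OF summable_binser[OF norm_reg_arg[OF r x]]]])
  hence "(\<lambda>n. cs (exp (z * of_real (ln (norm (adj x * x) / r)))) * (cs (gcoef z n) * (cs (of_real r) * reg_const x) ^ n)) sums reg_power r x z"
    unfolding reg_power_def by (rule sums_mult)
  thus ?thesis unfolding reg_coeff_def pw by (simp only: cs_mult mult.assoc of_real_power)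
qed

lemma norm_reg_le:
  assumes "cmod z \<le> R"
  shows "norm (reg_power r x z) \<le> suminf (reg_major r x R)"
  unfolding sums_unique[OF reg_sums]
  by (rule norm_suminf_le[OF norm_reg_term_le[OF assms] summable_reg_major])

end

text \<open>The functional is linear and bounded on the set \<open>M\<close> only, not on the whole
  type, so the interchange with the series goes through partial sums that stay in
  \<open>M\<close>.\<close>

lemma (in vn_trace) linear_functional_reg_sums:
  assumes r: "0 < r" "r < 1" and x: "x \<noteq> 0" and xM: "x \<in> M"
    and add: "\<And>u v. u \<in> M \<Longrightarrow> v \<in> M \<Longrightarrow> \<phi> (u + v) = \<phi> u + \<phi> v"
    and scale: "\<And>c u. u \<in> M \<Longrightarrow> \<phi> (cs c * u) = c * \<phi> u"
    and bnd: "\<And>u. u \<in> M \<Longrightarrow> cmod (\<phi> u) \<le> C * norm u"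
  shows "(\<lambda>n. reg_coeff r x z n * \<phi> (reg_const x ^ n)) sums \<phi> (reg_power r x z)"
proof -
  have T: "reg_const x ^ n \<in> M" for n by (intro power_mem reg_const_mem xM)
  have step: "cs (reg_coeff r x z n) * reg_const x ^ n \<in> M" for n by (intro mult_mem cs_mem T)
  define P where "P = (\<lambda>N. \<Sum>n<N. cs (reg_coeff r x z n) * reg_const x ^ n)"
  have PM: "P N \<in> M" for N unfolding P_def by (intro sum_mem step)
  have RM: "reg_power r x z \<in> M" by (rule reg_mem[OF r x xM])
  have \<phi>P: "\<phi> (P N) = (\<Sum>n<N. reg_coeff r x z n * \<phi> (reg_const x ^ n))" for N
  proof (induct N)
    case 0
    show ?case using scale[OF zero_mem, of 0] by (simp add: P_def)
  next
    case (Suc N)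
    have "P (Suc N) = P N + cs (reg_coeff r x z N) * reg_const x ^ N" by (simp add: P_def)
    thus ?case using Suc by (simp add: add[OF PM step] scale[OF T])
  qed
  have diff: "\<phi> (P N) - \<phi> (reg_power r x z) = \<phi> (P N - reg_power r x z)" for N
    using add[OF diff_mem[OF PM RM] RM, of N] by simp
  have "P \<longlonglongrightarrow> reg_power r x z" using reg_sums[OF r x, of z] unfolding P_def sums_def .
  hence "(\<lambda>N. C * norm (P N - reg_power r x z)) \<longlonglongrightarrow> 0"
    by (intro tendsto_mult_right_zero tendsto_norm_zero) (simp add: LIM_zero)
  hence "(\<lambda>N. \<phi> (P N) - \<phi> (reg_power r x z)) \<longlonglongrightarrow> 0"
    by (rule Lim_null_comparison[rotated]) (simp add: diff bnd[OF diff_mem[OF PM RM]])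
  thus ?thesis unfolding sums_def \<phi>P by (simp add: LIM_zero_iff)
qed

text \<open>The two endpoints of the interpolation. \<open>F_one_infty\<close> is the bound from
  trace norm to operator norm, with \<open>rpow (x* x) (1/2)\<close> as \<open>|x|\<close>.
  \<open>F_two_two\<close> says that \<open>F\<close> multiplies squared 2-norms by
  \<open>k\<close>; it expresses the adjoint relation together with
  \<open>Fs (F x) = k x\<close>.\<close>

locale vn_transform = A: vn_trace A d + B: vn_trace B \<tau>
  for A :: "'i bo set" and d :: "'i bo \<Rightarrow> complex" and B :: "'j bo set" and \<tau> :: "'j bo \<Rightarrow> complex" +
  fixes F :: "'i bo \<Rightarrow> 'j bo" and k :: real
  assumes k: "k > 0"
    and F_mem: "x \<in> A \<Longrightarrow> F x \<in> B"
    and F_add: "x \<in> A \<Longrightarrow> y \<in> A \<Longrightarrow> F (x + y) = F x + F y"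
    and F_cs: "x \<in> A \<Longrightarrow> F (cs c * x) = cs c * F x"
    and F_one_infty: "x \<in> A \<Longrightarrow> norm (F x) \<le> Re (d (rpow (adj x * x) (1/2)))"
    and F_two_two: "x \<in> A \<Longrightarrow> Re (\<tau> (F x * adj (F x))) = k * Re (d (x * adj x))"
begin

section \<open>The bilinear pairing induced by the transform\<close>

definition pairing :: "'i bo \<Rightarrow> 'j bo \<Rightarrow> complex" where
  "pairing u v = \<tau> (F u * v)"

lemma pairing_two_two:
  assumes "u \<in> A" "v \<in> B"
  shows "(cmod (pairing u v))\<^sup>2 \<le> k * Re (d (adj u * u)) * Re (\<tau> (adj v * v))"
  using B.Cauchy_Schwarz_trace[OF F_mem[OF assms(1)] assms(2)] F_two_two[OF assms(1)]
    A.t_comm[OF assms(1) A.adj_mem[OF assms(1)]]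
  by (simp add: pairing_def)

text \<open>A crude constant for continuity in operator norm. It serves the convergence of series
  and does not enter the interpolated bound.\<close>

definition pairing_bound :: real where
  "pairing_bound = sqrt (k * Re (d 1) * Re (\<tau> 1))"

lemma pairing_bound:
  assumes u: "u \<in> A" and v: "v \<in> B"
  shows "cmod (pairing u v) \<le> pairing_bound * norm u * norm v"
proof -
  have 0: "0 \<le> k * Re (d 1) * Re (\<tau> 1)" using k A.t_one_nonneg B.t_one_nonneg by simp
  have "(cmod (pairing u v))\<^sup>2 \<le> k * Re (d (adj u * u)) * Re (\<tau> (adj v * v))"
    by (rule pairing_two_two[OF assms])
  also have "\<dots> \<le> k * (Re (d 1) * (norm u)\<^sup>2) * (Re (\<tau> 1) * (norm v)\<^sup>2)"
    using k A.t_one_nonneg B.t_one_nonneg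
    by (intro mult_mono mult_nonneg_nonneg A.t_adj_mult_le B.t_adj_mult_le B.t_nonneg A.t_nonneg u v) auto
  also have "\<dots> = (pairing_bound * norm u * norm v)\<^sup>2"
    unfolding pairing_bound_def power_mult_distrib real_sqrt_pow2[OF 0] by simp
  finally show ?thesis
    by (rule power2_le_imp_le) (use 0 in \<open>simp add: pairing_bound_def\<close>)
qed

lemma pairing_add_left: "u \<in> A \<Longrightarrow> u' \<in> A \<Longrightarrow> v \<in> B \<Longrightarrow> pairing (u + u') v = pairing u v + pairing u' v"
  unfolding pairing_def by (simp add: F_add distrib_right B.t_add B.mult_mem F_mem)

lemma pairing_cs_left: "u \<in> A \<Longrightarrow> v \<in> B \<Longrightarrow> pairing (cs c * u) v = c * pairing u v"
  unfolding pairing_def by (simp add: F_cs mult.assoc B.t_cs B.mult_mem F_mem)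

lemma pairing_add_right: "u \<in> A \<Longrightarrow> v \<in> B \<Longrightarrow> v' \<in> B \<Longrightarrow> pairing u (v + v') = pairing u v + pairing u v'"
  unfolding pairing_def by (simp add: distrib_left B.t_add B.mult_mem F_mem)

lemma pairing_cs_right: "u \<in> A \<Longrightarrow> v \<in> B \<Longrightarrow> pairing u (cs c * v) = c * pairing u v"
  unfolding pairing_def by (simp add: cs_left_commute B.t_cs B.mult_mem F_mem)

context
  fixes r :: real and x :: "'i bo" and y :: "'j bo"
  assumes r: "0 < r" "r < 1" and x: "x \<noteq> 0" "x \<in> A" and y: "y \<noteq> 0" "y \<in> B"
begin

lemma pairing_reg_right_sums:
  assumes u: "u \<in> A"
  shows "(\<lambda>n. reg_coeff r y z n * pairing u (reg_const y ^ n * adj y)) sums pairing u (reg_power r y z * adj y)"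
proof (rule B.linear_functional_reg_sums[OF r y, where \<phi> = "\<lambda>v. pairing u (v * adj y)"])
  have y': "adj y \<in> B" by (rule B.adj_mem[OF y(2)])
  show "pairing u ((v + w) * adj y) = pairing u (v * adj y) + pairing u (w * adj y)" if "v \<in> B" "w \<in> B" for v w
    unfolding distrib_right by (intro pairing_add_right u B.mult_mem that y')
  show "pairing u (cs c * v * adj y) = c * pairing u (v * adj y)" if "v \<in> B" for c v
    unfolding mult.assoc by (intro pairing_cs_right u B.mult_mem that y')
  show "cmod (pairing u (v * adj y)) \<le> (pairing_bound * norm u * norm y) * norm v" if "v \<in> B" for v
  proof -
    have pb: "pairing_bound \<ge> 0" unfolding pairing_bound_def using k A.t_one_nonneg B.t_one_nonneg by simp
    have "cmod (pairing u (v * adj y)) \<le> pairing_bound * norm u * norm (v * adj y)"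
      by (intro pairing_bound u B.mult_mem that y')
    also have "\<dots> \<le> pairing_bound * norm u * (norm v * norm (adj y))"
      using pb by (intro mult_left_mono norm_mult_ineq) auto
    finally show ?thesis by (simp add: mult_ac)
  qed
qed

lemma pairing_reg_left_sums:
  assumes v: "v \<in> B"
  shows "(\<lambda>n. reg_coeff r x z n * pairing (x * reg_const x ^ n) v) sums pairing (x * reg_power r x z) v"
proof (rule A.linear_functional_reg_sums[OF r x, where \<phi> = "\<lambda>u. pairing (x * u) v"])
  show "pairing (x * (u + w)) v = pairing (x * u) v + pairing (x * w) v" if "u \<in> A" "w \<in> A" for u w
    unfolding distrib_left by (intro pairing_add_left v A.mult_mem that x)
  show "pairing (x * (cs c * u)) v = c * pairing (x * u) v" if "u \<in> A" for c u
    unfolding cs_left_commute[of x] by (intro pairing_cs_left v A.mult_mem that x)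
  show "cmod (pairing (x * u) v) \<le> (pairing_bound * norm x * norm v) * norm u" if "u \<in> A" for u
  proof -
    have pb: "pairing_bound \<ge> 0" unfolding pairing_bound_def using k A.t_one_nonneg B.t_one_nonneg by simp
    have "cmod (pairing (x * u) v) \<le> pairing_bound * norm (x * u) * norm v"
      by (intro pairing_bound v A.mult_mem that x)
    also have "\<dots> \<le> pairing_bound * (norm x * norm u) * norm v"
      using pb by (intro mult_left_mono mult_right_mono norm_mult_ineq) auto
    finally show ?thesis by (simp add: mult_ac)
  qed
qed

text \<open>The power on each side is expanded in turn: the series on the right gives holomorphy for
  a fixed left argument, and these functions, times holomorphic coefficients, form the series on the
  left. Linear growth of \<open>f\<close> and \<open>g\<close> keeps their values in a fixed disc
  when \<open>z\<close> ranges over a disc, as the majorants require.\<close>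

lemma pairing_reg_holomorphic:
  assumes f: "f holomorphic_on UNIV" "\<And>z. cmod (f z) \<le> cf * (cmod z + 1)" "cf \<ge> 0"
    and g: "g holomorphic_on UNIV" "\<And>z. cmod (g z) \<le> cg * (cmod z + 1)" "cg \<ge> 0"
  shows "(\<lambda>z. pairing (x * reg_power r x (f z)) (reg_power r y (g z) * adj y)) holomorphic_on UNIV"
proof -
  define pb where "pb = pairing_bound * norm x * norm y"
  have pb0: "pairing_bound \<ge> 0" unfolding pairing_bound_def using k A.t_one_nonneg B.t_one_nonneg by simp
  have pb: "pb \<ge> 0" unfolding pb_def using pb0 by simp
  have xT: "x * reg_const x ^ n \<in> A" for n by (intro A.mult_mem x A.power_mem A.reg_const_mem)
  have regy: "reg_power r y z * adj y \<in> B" for z by (intro B.mult_mem B.reg_mem r y B.adj_mem)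
  have nx: "norm (x * reg_const x ^ n) \<le> norm x" for n
    using norm_mult_ineq[of x "reg_const x ^ n"] mult_left_mono[OF norm_reg_const_power[OF x(1), of n] norm_ge_zero[of x]]
    by linarith
  have fR: "cmod (f z) \<le> cf * (R + 1)" if "cmod z \<le> R" for z R
    using f(2)[of z] mult_left_mono[of "cmod z + 1" "R + 1" cf] f(3) that by linarith
  have gR: "cmod (g z) \<le> cg * (R + 1)" if "cmod z \<le> R" for z R
    using g(2)[of z] mult_left_mono[of "cmod z + 1" "R + 1" cg] g(3) that by linarith
  have inner: "(\<lambda>z. pairing u (reg_power r y (g z) * adj y)) holomorphic_on UNIV" if u: "u \<in> A" for u
  proof (rule holomorphic_series[OF _ _ _ pairing_reg_right_sums[OF u]])
    show "(\<lambda>z. reg_coeff r y (g z) n * pairing u (reg_const y ^ n * adj y)) holomorphic_on UNIV" for n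
      by (intro holomorphic_intros reg_coeff_holomorphic g)
    show "cmod (reg_coeff r y (g z) n * pairing u (reg_const y ^ n * adj y)) \<le>
        reg_major r y (cg * (R + 1)) n * (pairing_bound * norm u * norm y)" if "cmod z \<le> R" for R n z
      unfolding norm_mult
    proof (rule mult_mono)
      show "cmod (reg_coeff r y (g z) n) \<le> reg_major r y (cg * (R + 1)) n"
        by (rule reg_coeff_le[OF r y(1) gR[OF that]])
      show "0 \<le> reg_major r y (cg * (R + 1)) n"
        using reg_coeff_le[OF r y(1) gR[OF that], of n] norm_ge_zero order_trans by blast
      have ny: "norm (reg_const y ^ n * adj y) \<le> norm y"
        using norm_mult_ineq[of "reg_const y ^ n" "adj y"]
          mult_right_mono[OF norm_reg_const_power[OF y(1), of n] norm_ge_zero[of "adj y"]] by simp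
      have "cmod (pairing u (reg_const y ^ n * adj y)) \<le> pairing_bound * norm u * norm (reg_const y ^ n * adj y)"
        by (intro pairing_bound u B.mult_mem B.power_mem B.reg_const_mem y B.adj_mem)
      also have "\<dots> \<le> pairing_bound * norm u * norm y" using pb0 by (intro mult_left_mono ny) auto
      finally show "cmod (pairing u (reg_const y ^ n * adj y)) \<le> pairing_bound * norm u * norm y" .
    qed auto
    show "summable (\<lambda>n. reg_major r y (cg * (R + 1)) n * (pairing_bound * norm u * norm y))" for R
      by (intro summable_mult2 summable_reg_major[OF r y(1)])
  qed
  show ?thesis
  proof (rule holomorphic_series[OF _ _ _ pairing_reg_left_sums[OF regy]])
    show "(\<lambda>z. reg_coeff r x (f z) n * pairing (x * reg_const x ^ n) (reg_power r y (g z) * adj y)) holomorphic_on UNIV" for n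
      by (intro holomorphic_intros reg_coeff_holomorphic f inner xT)
    show "cmod (reg_coeff r x (f z) n * pairing (x * reg_const x ^ n) (reg_power r y (g z) * adj y)) \<le>
        reg_major r x (cf * (R + 1)) n * (pb * suminf (reg_major r y (cg * (R + 1))))" if "cmod z \<le> R" for R n z
      unfolding norm_mult
    proof (rule mult_mono)
      show "cmod (reg_coeff r x (f z) n) \<le> reg_major r x (cf * (R + 1)) n"
        by (rule reg_coeff_le[OF r x(1) fR[OF that]])
      show "0 \<le> reg_major r x (cf * (R + 1)) n"
        using reg_coeff_le[OF r x(1) fR[OF that], of n] norm_ge_zero order_trans by blast
      have "cmod (pairing (x * reg_const x ^ n) (reg_power r y (g z) * adj y)) \<le>
          pairing_bound * norm (x * reg_const x ^ n) * norm (reg_power r y (g z) * adj y)"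
        by (intro pairing_bound xT regy)
      also have "\<dots> \<le> pairing_bound * norm x * (norm (reg_power r y (g z)) * norm (adj y))"
        using pb0 nx by (intro mult_mono mult_left_mono norm_mult_ineq mult_nonneg_nonneg) auto
      also have "\<dots> = pb * norm (reg_power r y (g z))" by (simp add: pb_def)
      also have "\<dots> \<le> pb * suminf (reg_major r y (cg * (R + 1)))"
        by (intro mult_left_mono norm_reg_le[OF r y(1) gR[OF that]] pb)
      finally show "cmod (pairing (x * reg_const x ^ n) (reg_power r y (g z) * adj y)) \<le> pb * suminf (reg_major r y (cg * (R + 1)))" .
    qed auto
    show "summable (\<lambda>n. reg_major r x (cf * (R + 1)) n * (pb * suminf (reg_major r y (cg * (R + 1)))))" for R
      by (intro summable_mult2 summable_reg_major[OF r x(1)])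
  qed
qed

end

text \<open>The positive \<open>\<eta>\<close> guarantees strictly positive edge bounds, as
  \<open>three_lines\<close> demands; it disappears in the later limit.\<close>

lemma interpolation_reg:
  fixes p :: real
  assumes r: "0 < r" "r < 1" and x: "x \<noteq> 0" "x \<in> A" and y: "F x \<noteq> 0" and p: "p \<ge> 2" and \<eta>: "\<eta> > 0"
  defines "q \<equiv> p / (p - 1)"
  shows "Re (\<tau> (reg_power r (F x) (of_real (p/2 - 1)) * (adj (F x) * F x))) \<le>
    k powr (1/p) * ((Re (d (reg_power r x (of_real (q/2)))) + \<eta>) * (Re (\<tau> (reg_power r (F x) (of_real (p/2)))) + \<eta>)) powr (1 - 1/p)"
proof -
  define X where "X = F x"
  have X: "X \<noteq> 0" "X \<in> B" unfolding X_def using y F_mem[OF x(2)] by auto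
  define \<alpha> where "\<alpha> = Re (d (reg_power r x (of_real (q/2)))) + \<eta>"
  define \<beta> where "\<beta> = Re (\<tau> (reg_power r X (of_real (p/2)))) + \<eta>"
  have \<alpha>: "\<alpha> > 0" unfolding \<alpha>_def using A.t_reg_nonneg[OF r x, of "q/2"] \<eta> by linarith
  have \<beta>: "\<beta> > 0" unfolding \<beta>_def using B.t_reg_nonneg[OF r X, of "p/2"] \<eta> by linarith
  \<comment> \<open>These affine functions satisfy \<open>1/2 + Re f = q/2\<close> on
    \<open>Re z = 0\<close> and \<open>1 + 2 Re f = q/2\<close> on \<open>Re z = 1\<close>, and
    likewise for \<open>g\<close> with \<open>p\<close>. The edge bounds therefore involve the same
    two traces on both edges.\<close>
  define f :: "complex \<Rightarrow> complex" where "f = (\<lambda>z. of_real (q/2 - 1/2) - of_real (q/4) * z)"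
  define g :: "complex \<Rightarrow> complex" where "g = (\<lambda>z. of_real (p/2 - 1/2) - of_real (p/4) * z)"
  define G where "G = (\<lambda>z. pairing (x * reg_power r x (f z)) (reg_power r X (g z) * adj X))"
  have uA: "x * reg_power r x z \<in> A" for z by (intro A.mult_mem x A.reg_mem r)
  have vB: "reg_power r X z * adj X \<in> B" for z by (intro B.mult_mem X B.reg_mem r B.adj_mem)
  have lin: "cmod (of_real a - of_real b * z) \<le> (\<bar>a\<bar> + \<bar>b\<bar>) * (cmod z + 1)" for a b :: real and z
  proof -
    have "cmod (of_real a - of_real b * z) \<le> \<bar>a\<bar> + \<bar>b\<bar> * cmod z"
      using norm_triangle_ineq4[of "of_real a" "of_real b * z"] by (simp add: norm_mult)
    also have "\<dots> \<le> (\<bar>a\<bar> + \<bar>b\<bar>) * (cmod z + 1)" by (simp add: algebra_simps)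
    finally show ?thesis .
  qed
  have hol: "G holomorphic_on UNIV" unfolding G_def
  proof (rule pairing_reg_holomorphic[OF r x X])
    show "f holomorphic_on UNIV" "g holomorphic_on UNIV" unfolding f_def g_def by (intro holomorphic_intros)+
    show "cmod (f z) \<le> (\<bar>q/2 - 1/2\<bar> + \<bar>q/4\<bar>) * (cmod z + 1)" for z unfolding f_def by (rule lin)
    show "cmod (g z) \<le> (\<bar>p/2 - 1/2\<bar> + \<bar>p/4\<bar>) * (cmod z + 1)" for z unfolding g_def by (rule lin)
  qed auto
  have Ref: "Re (f z) = q/2 - 1/2 - q/4 * Re z" and Reg: "Re (g z) = p/2 - 1/2 - p/4 * Re z" for z
    unfolding f_def g_def by simp_all
  have G2: "(cmod (G z))\<^sup>2 \<le> k * Re (d (reg_power r x (of_real (1 + 2 * Re (f z))))) * Re (\<tau> (reg_power r X (of_real (1 + 2 * Re (g z)))))" for z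
  proof -
    have "(cmod (G z))\<^sup>2 \<le> k * Re (d (adj (x * reg_power r x (f z)) * (x * reg_power r x (f z)))) *
        Re (\<tau> (adj (reg_power r X (g z) * adj X) * (reg_power r X (g z) * adj X)))"
      unfolding G_def by (rule pairing_two_two[OF uA vB])
    also have "\<dots> \<le> k * Re (d (reg_power r x (of_real (1 + 2 * Re (f z))))) * Re (\<tau> (reg_power r X (of_real (1 + 2 * Re (g z)))))"
      by (intro mult_mono mult_nonneg_nonneg A.t_left_reg[OF r x] B.t_right_reg[OF r X]
          A.t_nonneg[OF uA] B.t_nonneg[OF vB] A.t_reg_nonneg[OF r x] less_imp_le[OF k] order_refl)
    finally show ?thesis .
  qed
  have d_le: "Re (d (reg_power r x (of_real s))) \<le> Re (d 1) * suminf (reg_major r x R)" if "\<bar>s\<bar> \<le> R" for s R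
  proof -
    have "Re (d (reg_power r x (of_real s))) \<le> cmod (d (reg_power r x (of_real s)))" by (rule complex_Re_le_cmod)
    also have "\<dots> \<le> Re (d 1) * norm (reg_power r x (of_real s))" by (rule A.cmod_t_le[OF A.reg_mem[OF r x]])
    also have "\<dots> \<le> Re (d 1) * suminf (reg_major r x R)"
      using that by (intro mult_left_mono norm_reg_le[OF r x(1)] A.t_one_nonneg) auto
    finally show ?thesis .
  qed
  have \<tau>_le: "Re (\<tau> (reg_power r X (of_real s))) \<le> Re (\<tau> 1) * suminf (reg_major r X R)" if "\<bar>s\<bar> \<le> R" for s R
  proof -
    have "Re (\<tau> (reg_power r X (of_real s))) \<le> cmod (\<tau> (reg_power r X (of_real s)))" by (rule complex_Re_le_cmod)
    also have "\<dots> \<le> Re (\<tau> 1) * norm (reg_power r X (of_real s))" by (rule B.cmod_t_le[OF B.reg_mem[OF r X]])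
    also have "\<dots> \<le> Re (\<tau> 1) * suminf (reg_major r X R)"
      using that by (intro mult_left_mono norm_reg_le[OF r X(1)] B.t_one_nonneg) auto
    finally show ?thesis .
  qed
  have q: "q > 0" "1/q = 1 - 1/p" using p by (auto simp: q_def field_simps)
  \<comment> \<open>On the strip \<open>1 + 2 Re (f z) = q - (q/2) Re z\<close> stays in
    \<open>[0, q]\<close>, and similarly for \<open>g\<close> and \<open>p\<close>. This gives some
    uniform bound on \<open>G\<close>; its size is immaterial to \<open>three_lines\<close>.\<close>
  define K where "K = k * (Re (d 1) * suminf (reg_major r x q)) * (Re (\<tau> 1) * suminf (reg_major r X p))"
  have bdd: "cmod (G z) \<le> sqrt K" if z: "0 \<le> Re z" "Re z \<le> 1" for z
  proof (rule real_le_rsqrt)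
    have qz: "0 \<le> q * Re z" "q * Re z \<le> q" and pz: "0 \<le> p * Re z" "p * Re z \<le> p"
      using z p q by (auto simp: mult_left_le)
    have "\<bar>1 + 2 * Re (f z)\<bar> \<le> q" "\<bar>1 + 2 * Re (g z)\<bar> \<le> p"
      unfolding Ref Reg using qz pz by (auto simp: abs_le_iff field_simps)
    from this(1)[THEN d_le] this(2)[THEN \<tau>_le]
    have "Re (d (reg_power r x (of_real (1 + 2 * Re (f z))))) \<le> Re (d 1) * suminf (reg_major r x q)"
      "Re (\<tau> (reg_power r X (of_real (1 + 2 * Re (g z))))) \<le> Re (\<tau> 1) * suminf (reg_major r X p)"
      .
    hence "k * Re (d (reg_power r x (of_real (1 + 2 * Re (f z))))) * Re (\<tau> (reg_power r X (of_real (1 + 2 * Re (g z))))) \<le> K"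
      unfolding K_def
      by (intro mult_mono mult_nonneg_nonneg order_refl less_imp_le[OF k] A.t_reg_nonneg[OF r x] B.t_reg_nonneg[OF r X]
          order_trans[OF A.t_reg_nonneg[OF r x, of "1 + 2 * Re (f z)"]])
    thus "(cmod (G z))\<^sup>2 \<le> K" using G2[of z] by linarith
  qed
  have f0: "cmod (G z) \<le> \<alpha> * \<beta>" if z: "Re z = 0" for z
  proof -
    let ?u = "x * reg_power r x (f z)"
    have h: "1/2 + Re (f z) = q/2" "1/2 + Re (g z) = p/2" unfolding Ref Reg using z by simp_all
    \<comment> \<open>\<open>e\<close> is the modulus of \<open>?u\<close>. The left edge combines
      the bound of \<open>norm (F ?u)\<close> by the trace of \<open>e\<close>, the estimate
      \<open>t_sqrt_le\<close> for that trace, and the Hoelder-type estimate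
      \<open>t_mult_reg_le\<close> on the other side.\<close>
    define e where "e = rpow (adj ?u * ?u) (1/2)"
    have e: "e \<in> A" "adj e = e" "e * e = adj ?u * ?u"
    proof -
      show "e \<in> A" unfolding e_def by (rule A.rpow_mem[OF uA]) simp
      show "adj e = e" unfolding e_def by (rule adj_rpow[OF refl refl]) simp
      have "e * e = rpow (adj ?u * ?u) (1/2 + 1/2)" unfolding e_def by (rule rpow_add[OF refl refl, symmetric]) auto
      also have "\<dots> = adj ?u * ?u" using rpow_1[OF refl refl, of ?u] by simp
      finally show "e * e = adj ?u * ?u" .
    qed
    have "norm (F ?u) \<le> Re (d e)" unfolding e_def by (rule F_one_infty[OF uA])
    also have "\<dots> \<le> cmod (d e)" by (rule complex_Re_le_cmod)
    also have "\<dots> \<le> Re (d (reg_power r x (of_real (1/2 + Re (f z)))))" by (rule A.t_sqrt_le[OF r x e])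
    also have "\<dots> \<le> \<alpha>" unfolding h \<alpha>_def using \<eta> by simp
    finally have Fu: "norm (F ?u) \<le> \<alpha>" .
    have "cmod (G z) \<le> norm (F ?u) * Re (\<tau> (reg_power r X (of_real (1/2 + Re (g z)))))"
      unfolding G_def pairing_def by (rule B.t_mult_reg_le[OF r X F_mem[OF uA]])
    also have "\<dots> \<le> \<alpha> * \<beta>" unfolding h
      using B.t_reg_nonneg[OF r X, of "p/2"] \<alpha> \<eta> by (intro mult_mono Fu) (auto simp: \<beta>_def)
    finally show ?thesis .
  qed
  have f1: "cmod (G z) \<le> sqrt (k * (\<alpha> * \<beta>))" if z: "Re z = 1" for z
  proof (rule real_le_rsqrt)
    have h: "1 + 2 * Re (f z) = q/2" "1 + 2 * Re (g z) = p/2" unfolding Ref Reg using z by (simp_all add: field_simps)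
    have "(cmod (G z))\<^sup>2 \<le> k * Re (d (reg_power r x (of_real (q/2)))) * Re (\<tau> (reg_power r X (of_real (p/2))))"
      using G2[of z] unfolding h .
    also have "\<dots> \<le> k * \<alpha> * \<beta>"
      using k \<alpha> \<eta> B.t_reg_nonneg[OF r X, of "p/2"] A.t_reg_nonneg[OF r x, of "q/2"]
      by (intro mult_mono) (auto simp: \<alpha>_def \<beta>_def)
    finally show "(cmod (G z))\<^sup>2 \<le> k * (\<alpha> * \<beta>)" by (simp add: mult.assoc)
  qed
  have ab: "\<alpha> * \<beta> > 0" using \<alpha> \<beta> by simp
  \<comment> \<open>The conjugacy of \<open>p\<close> and \<open>q\<close> makes \<open>f\<close>
    vanish at \<open>2/p\<close>, so the left argument reduces to \<open>x\<close> and
    \<open>F\<close> produces \<open>X\<close>.\<close>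
  have G\<theta>: "G (of_real (2/p)) = \<tau> (reg_power r X (of_real (p/2 - 1)) * (adj X * X))"
  proof -
    have "f (of_real (2/p)) = of_real (q/2 - 1/2 - q/4 * (2/p))" unfolding f_def by simp
    also have "q/2 - 1/2 - q/4 * (2/p) = 0" using p by (simp add: q_def field_simps)
    finally have f\<theta>: "f (of_real (2/p)) = 0" by simp
    have "g (of_real (2/p)) = of_real (p/2 - 1/2 - p/4 * (2/p))" unfolding g_def by simp
    also have "p/2 - 1/2 - p/4 * (2/p) = p/2 - 1" using p by (simp add: field_simps)
    finally have g\<theta>: "g (of_real (2/p)) = of_real (p/2 - 1)" .
    have "G (of_real (2/p)) = \<tau> (X * (reg_power r X (of_real (p/2 - 1)) * adj X))"
      unfolding G_def f\<theta> g\<theta> pairing_def by (simp add: reg_0[OF r x(1)] X_def)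
    also have "\<dots> = \<tau> ((reg_power r X (of_real (p/2 - 1)) * adj X) * X)"
      by (rule B.t_comm[OF X(2) vB])
    finally show ?thesis by (simp add: mult.assoc)
  qed
  have "cmod (G (of_real (2/p))) \<le> (\<alpha> * \<beta>) powr (1 - 2/p) * sqrt (k * (\<alpha> * \<beta>)) powr (2/p)"
    by (rule three_lines[OF hol bdd f0 f1]) (use ab k p in auto)
  also have "sqrt (k * (\<alpha> * \<beta>)) powr (2/p) = k powr (1/p) * (\<alpha> * \<beta>) powr (1/p)"
    using k ab by (simp add: powr_half_sqrt[symmetric] powr_powr powr_mult)
  also have "(\<alpha> * \<beta>) powr (1 - 2/p) * (k powr (1/p) * (\<alpha> * \<beta>) powr (1/p)) =
      k powr (1/p) * (\<alpha> * \<beta>) powr (1 - 2/p + 1/p)"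
    by (simp only: powr_add mult.left_commute)
  also have "1 - 2/p + 1/p = 1 - 1/p" by (simp add: field_simps)
  finally have "cmod (G (of_real (2/p))) \<le> k powr (1/p) * (\<alpha> * \<beta>) powr (1 - 1/p)" .
  hence "Re (G (of_real (2/p))) \<le> k powr (1/p) * (\<alpha> * \<beta>) powr (1 - 1/p)"
    using complex_Re_le_cmod order_trans by blast
  thus ?thesis unfolding G\<theta> \<alpha>_def \<beta>_def X_def .
qed

text \<open>Letting the regularization tend to its limit gives
  \<open>P <= k^(1/p) (Q P)^(1 - 1/p)\<close>. Dividing by \<open>P^(1 - 1/p)\<close> is the
  assertion, because \<open>1/q = 1 - 1/p\<close>.\<close>

lemma interpolation:
  fixes p :: real
  assumes x: "x \<in> A" and p: "p \<ge> 2"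
  defines "q \<equiv> p / (p - 1)"
  shows "Re (\<tau> (rpow (adj (F x) * F x) (p/2))) powr (1/p) \<le>
    k powr (1/p) * Re (d (rpow (adj x * x) (q/2))) powr (1/q)"
proof -
  define P where "P = Re (\<tau> (rpow (adj (F x) * F x) (p/2)))"
  define Q where "Q = Re (d (rpow (adj x * x) (q/2)))"
  have q: "q > 0" "1/q = 1 - 1/p" using p by (auto simp: q_def field_simps)
  have P0: "P \<ge> 0" unfolding P_def by (rule B.t_rpow_nonneg[OF F_mem[OF x]]) (use p in simp)
  have Q0: "Q \<ge> 0" unfolding Q_def by (rule A.t_rpow_nonneg[OF x]) (use q in simp)
  show ?thesis
  \<comment> \<open>The case is separated because a power of \<open>P\<close> is cancelled at the
    end; \<open>P > 0\<close> also forces \<open>F x\<close> and \<open>x\<close> to be nonzero, as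
    the regularized powers require.\<close>
  proof (cases "P = 0")
    case True
    thus ?thesis unfolding P_def[symmetric] using k by simp
  next
    case False
    have Fx: "F x \<noteq> 0"
    proof
      assume "F x = 0"
      hence "P = 0" unfolding P_def by (simp add: rpow_def B.t_zero)
      thus False using False by simp
    qed
    have x0: "x \<noteq> 0"
      using Fx F_cs[OF x, of 0] by auto
    \<comment> \<open>The shift by 2 makes \<open>r 0 = 1/2\<close>; a shift by 1 would give
      \<open>r 0 = 0\<close>.\<close>
    define r where "r = (\<lambda>n. 1 - 1 / (real n + 2))"
    define \<eta> where "\<eta> = (\<lambda>n. 1 / (real n + 1))"
    have r: "0 < r n" "r n < 1" for n unfolding r_def by (auto simp: field_simps)
    have rl: "r \<longlonglongrightarrow> 1" unfolding r_def by real_asymp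
    have \<eta>: "\<eta> n > 0" for n unfolding \<eta>_def by simp
    have \<eta>l: "\<eta> \<longlonglongrightarrow> 0" unfolding \<eta>_def by real_asymp
    have XX: "adj (F x) * F x \<in> B" by (intro B.mult_mem B.adj_mem F_mem x)
    have lhs: "(\<lambda>n. reg_power (r n) (F x) (of_real (p/2 - 1)) * (adj (F x) * F x)) \<longlonglongrightarrow> rpow (adj (F x) * F x) (p/2)"
    \<comment> \<open>For \<open>p = 2\<close> the exponent \<open>p/2 - 1\<close> is 0, outside the
      range \<open>s > 0\<close> of \<open>reg_tendsto_rpow\<close>; the regularized power is then
      identically 1.\<close>
    proof (cases "p = 2")
      case True
      thus ?thesis using rpow_1[OF refl refl, of "F x"] by (simp add: reg_0[OF r Fx])
    next
      case False
      hence p2: "p/2 - 1 > 0" using p by simp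
      have "(\<lambda>n. reg_power (r n) (F x) (of_real (p/2 - 1)) * (adj (F x) * F x)) \<longlonglongrightarrow>
          rpow (adj (F x) * F x) (p/2 - 1) * (adj (F x) * F x)"
        by (intro tendsto_mult tendsto_const reg_tendsto_rpow[OF Fx p2 r rl])
      also have "rpow (adj (F x) * F x) (p/2 - 1) * (adj (F x) * F x) = rpow (adj (F x) * F x) (p/2)"
        using rpow_add[OF refl refl p2, of 1 "F x"] rpow_1[OF refl refl, of "F x"] by simp
      finally show ?thesis .
    qed
    have L: "(\<lambda>n. Re (\<tau> (reg_power (r n) (F x) (of_real (p/2 - 1)) * (adj (F x) * F x)))) \<longlonglongrightarrow> P"
      unfolding P_def using p
      by (intro tendsto_Re B.t_tendsto lhs B.mult_mem[OF B.reg_mem XX] r Fx F_mem x B.rpow_mem) auto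
    have la: "(\<lambda>n. Re (d (reg_power (r n) x (of_real (q/2))))) \<longlonglongrightarrow> Q"
      unfolding Q_def using q
      by (intro tendsto_Re A.t_tendsto reg_tendsto_rpow A.reg_mem r rl x0 x A.rpow_mem) auto
    have lb: "(\<lambda>n. Re (\<tau> (reg_power (r n) (F x) (of_real (p/2))))) \<longlonglongrightarrow> P"
      unfolding P_def using p
      by (intro tendsto_Re B.t_tendsto reg_tendsto_rpow B.reg_mem r rl Fx F_mem x B.rpow_mem) auto
    define R where "R = (\<lambda>n. (Re (d (reg_power (r n) x (of_real (q/2)))) + \<eta> n) * (Re (\<tau> (reg_power (r n) (F x) (of_real (p/2)))) + \<eta> n))"
    have Rl: "R \<longlonglongrightarrow> (Q + 0) * (P + 0)" unfolding R_def by (intro tendsto_intros la lb \<eta>l)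
    have R0: "R n \<ge> 0" for n unfolding R_def
      by (intro mult_nonneg_nonneg add_nonneg_nonneg less_imp_le[OF \<eta>]
          A.t_reg_nonneg[OF r x0 x] B.t_reg_nonneg[OF r Fx F_mem[OF x]])
    have "(\<lambda>n. k powr (1/p) * R n powr (1 - 1/p)) \<longlonglongrightarrow> k powr (1/p) * ((Q + 0) * (P + 0)) powr (1 - 1/p)"
      by (intro tendsto_mult tendsto_const tendsto_powr' Rl) (use p R0 in auto)
    from LIMSEQ_le[OF L this] have main: "P \<le> k powr (1/p) * (Q * P) powr (1 - 1/p)"
      using interpolation_reg[OF r x0 x Fx p \<eta>] unfolding R_def q_def by auto
    have Pp: "P > 0" using P0 False by simp
    have "P powr (1/p) * P powr (1 - 1/p) = P" using Pp by (simp flip: powr_add)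
    also have "P \<le> k powr (1/p) * Q powr (1 - 1/p) * P powr (1 - 1/p)"
      using main Pp Q0 by (simp add: powr_mult mult.assoc)
    finally have "P powr (1/p) \<le> k powr (1/p) * Q powr (1 - 1/p)"
      by (rule mult_right_le_imp_le) (use Pp in simp)
    thus ?thesis unfolding P_def[symmetric] Q_def[symmetric] q(2) .
  qed
qed

end

section \<open>Transfer between the type \<open>bo\<close> and the operators in
  \<open>bop\<close>\<close>

lemma op_abs_pow_Rep:
  assumes "p > 0"
  shows "op_abs_pow (Rep_bo x) p = Rep_bo (rpow (adj x * x) (p / 2))"
proof -
  have "op_abs_pow (Rep_bo x) p = op_rpow (Rep_bo (adj x * x)) (p / 2)"
    unfolding op_abs_pow_def op_adj_Rep by (simp add: times_bo.rep_eq)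
  also have "\<dots> = Rep_bo (rpow (adj x * x) (p / 2))"
    by (rule op_rpow_Rep) (use assms norm_normalized[OF refl refl] in auto)
  finally show ?thesis .
qed

lemma lpnorm_Rep:
  assumes "p > 0"
  shows "lpnorm t (ereal p) (Rep_bo x) = Re (t (Rep_bo (rpow (adj x * x) (p / 2)))) powr (1 / p)"
  by (simp add: lpnorm_def op_abs_pow_Rep[OF assms])

lemma lpnorm_infinity_Rep: "lpnorm t \<infinity> (Rep_bo x) = norm x"
  by (simp add: lpnorm_def norm_bo.rep_eq)

theorem theorem3p17:
  fixes A :: "'i op set" and B :: "'j op set"
    and d :: "'i op \<Rightarrow> complex" and tau :: "'j op \<Rightarrow> complex"
    and F :: "'i op \<Rightarrow> 'j op" and Fs :: "'j op \<Rightarrow> 'i op" and k :: real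
  assumes vnA: "von_neumann_algebra A" and vnB: "von_neumann_algebra B"
    and trA: "trace_on A d" and trB: "trace_on B tau"
    and kpos: "k > 0"
    and F_maps: "\<forall>x\<in>A. F x \<in> B"
    and F_add: "\<forall>x\<in>A. \<forall>y\<in>A. F (op_add x y) = op_add (F x) (F y)"
    and F_scale: "\<forall>x\<in>A. \<forall>c. F (op_scale c x) = op_scale c (F x)"
    and F_1inf: "\<forall>x\<in>A. lpnorm tau \<infinity> (F x) \<le> lpnorm d 1 x"
    and Fs_maps: "\<forall>y\<in>B. Fs y \<in> A"
    and Fs_adj: "\<forall>x\<in>A. \<forall>y\<in>B. tau (F x \<circ> op_adj y) = d (x \<circ> op_adj (Fs y))"
    and k_transf: "\<forall>x\<in>A. lpnorm d \<infinity> (Fs (F x)) \<ge> k * lpnorm d \<infinity> x"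
    and FsF: "\<forall>x\<in>A. Fs (F x) = op_scale (complex_of_real k) x"
  shows "\<forall>x\<in>A. \<forall>p q :: ereal. 2 \<le> p \<longrightarrow> 1 / p + 1 / q = 1 \<longrightarrow>
           lpnorm tau p (F x) \<le> k powr (real_of_ereal (1 / p)) * lpnorm d q x"
proof -
  define A' where "A' = {x. Rep_bo x \<in> A}"
  define B' where "B' = {x. Rep_bo x \<in> B}"
  define d' where "d' = (\<lambda>x. d (Rep_bo x))"
  define tau' where "tau' = (\<lambda>x. tau (Rep_bo x))"
  define F' where "F' = (\<lambda>x. Abs_bo (F (Rep_bo x)))"
  have bop: "A \<subseteq> bop" "B \<subseteq> bop" using vnA vnB unfolding von_neumann_algebra_def by blast+
  interpret A: vn_trace A' d' unfolding A'_def d'_def by (rule vn_trace_of_trace_on[OF vnA trA])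
  interpret B: vn_trace B' tau' unfolding B'_def tau'_def by (rule vn_trace_of_trace_on[OF vnB trB])
  have memA: "x \<in> A' \<longleftrightarrow> Rep_bo x \<in> A" for x by (simp add: A'_def)
  have RF: "Rep_bo (F' x) = F (Rep_bo x)" if "x \<in> A'" for x
    unfolding F'_def by (rule Abs_bo_inverse) (use that F_maps bop memA in blast)
  have F_one: "norm (F' x) \<le> Re (d' (rpow (adj x * x) (1/2)))" if "x \<in> A'" for x
  proof -
    have "norm (F' x) \<le> lpnorm d (ereal 1) (Rep_bo x)"
      using F_1inf that memA lpnorm_infinity_Rep[of tau "F' x"] RF[OF that] unfolding one_ereal_def by metis
    also have "\<dots> = Re (d' (rpow (adj x * x) (1/2)))"
      using A.t_rpow_nonneg[OF that, of "1/2"] by (simp add: lpnorm_Rep d'_def)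
    finally show ?thesis .
  qed
  \<comment> \<open>The adjoint relation is used with \<open>y = F x\<close>, where
    \<open>Fs (F x)\<close> is \<open>k x\<close>. Since \<open>k\<close> is real, conjugation
    leaves it unchanged and it comes out of the trace.\<close>
  have F_two: "Re (tau' (F' x * adj (F' x))) = k * Re (d' (x * adj x))" if x: "x \<in> A'" for x
  proof -
    have "tau' (F' x * adj (F' x)) = tau (F (Rep_bo x) \<circ> op_adj (F (Rep_bo x)))"
      unfolding tau'_def times_bo.rep_eq op_adj_Rep[symmetric] RF[OF x] ..
    also have "\<dots> = d (Rep_bo x \<circ> op_adj (op_scale (of_real k) (Rep_bo x)))"
      using Fs_adj FsF F_maps x memA by metis
    also have "\<dots> = d' (cs (of_real k) * (x * adj x))"
      unfolding d'_def Rep_cs_mult[symmetric] op_adj_Rep times_bo.rep_eq[symmetric]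
      by (simp add: cs_commute cs_left_commute)
    also have "\<dots> = of_real k * d' (x * adj x)" by (intro A.t_cs A.mult_mem A.adj_mem x)
    finally show ?thesis by simp
  qed
  interpret vn_transform A' d' B' tau' F' k
  proof
    show "F' x \<in> B'" if "x \<in> A'" for x
      using RF[OF that] F_maps that memA by (simp add: B'_def)
    show "F' (x + y) = F' x + F' y" if "x \<in> A'" "y \<in> A'" for x y
      using that F_add memA RF A.add_mem by (simp add: bo_eq plus_bo.rep_eq)
    show "F' (cs c * x) = cs c * F' x" if "x \<in> A'" for c x
      using that F_scale memA RF A.mult_mem[OF A.cs_mem] by (simp add: bo_eq Rep_cs_mult)
  qed (use kpos F_one F_two in auto)
  show ?thesis
  proof (intro ballI allI impI)
    fix x p q assume x: "x \<in> A" and p: "2 \<le> (p :: ereal)" and pq: "1 / p + 1 / q = 1"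
    obtain z where z: "x = Rep_bo z" "z \<in> A'" using x bop memA by (metis Abs_bo_inverse subset_iff)
    have Fx: "F x = Rep_bo (F' z)" using RF[OF z(2)] z(1) by simp
    show "lpnorm tau p (F x) \<le> k powr (real_of_ereal (1 / p)) * lpnorm d q x"
    proof (cases p)
      case PInf
      \<comment> \<open>At \<open>p = \<infinity>\<close> the factor is \<open>k powr 0 = 1\<close>,
        and the claim is the assumed bound from the 1-norm to the operator norm.\<close>
      have "q = 1" using pq PInf by (cases q) (auto simp: one_ereal_def divide_ereal_def split: if_splits)
      thus ?thesis using F_1inf x PInf kpos by simp
    next
      case (real p')
      hence p': "p' \<ge> 2" using p by simp
      \<comment> \<open>An infinite \<open>q\<close> would force \<open>1 / p' = 1\<close>,
        impossible for \<open>p' \<ge> 2\<close>.\<close>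
      obtain q' where q: "q = ereal q'" "1 / p' + 1 / q' = 1"
        using pq real p' by (cases q) (auto simp: one_ereal_def divide_ereal_def field_simps split: if_splits)
      have q': "q' = p' / (p' - 1)" using q(2) p' by (cases "q' = 0") (auto simp: field_simps)
      have "lpnorm tau p (F x) = Re (tau' (rpow (adj (F' z) * F' z) (p' / 2))) powr (1 / p')"
        unfolding Fx real tau'_def using p' by (simp add: lpnorm_Rep)
      also have "\<dots> \<le> k powr (1 / p') * Re (d' (rpow (adj z * z) (q' / 2))) powr (1 / q')"
        unfolding q' by (rule interpolation[OF z(2) p'])
      also have "\<dots> = k powr (real_of_ereal (1 / p)) * lpnorm d q x"
        unfolding z(1) q(1) real d'_def using p' q' by (simp add: lpnorm_Rep one_ereal_def)
      finally show ?thesis .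
    qed (use p in auto)
  qed
qed

end
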